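(* Let $f_1,\dots,f_m$ be rational linear forms on $\mathbb{R}^d$, let $s := \{x\in\mathbb{R}^d : f_1(x)=\cdots=f_m(x)=0\}$, and let $P := [0,1]^d \cap s$. For $t=1,2,\ldots$ let $B^\circ(t)$ be the number of integer points $x \in s$ with distinct entries satisfying $0<x_i<t$ for all $i$, and let $B(t)$ be the number of pairs $(x,\sigma)$ consisting of an integer point $x\in s$ with $0\le x_i\le t$ for all $i$ and a permutation $\sigma$ of $[d]$ that is compatible with $x$ and realizable in $s$. Suppose $P$ does not lie within a coordinate hyperplane. Then $B^\circ$ and $B$ are quasipolynomials with leading term $(\operatorname{vol} P)\,t^{\dim s}$, with constant term $B(0)$ equal to the number of permutations of $[d]$ that are realizable in $s$, and $(-1)^{\dim s} B^\circ(-t) = B(t)$.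
   Context: A quasipolynomial is a function $Q(t)=\sum_{i} c_i(t)t^i$ whose coefficients are periodic functions of the integer $t$; $B^\circ(-t)$ and $B(0)$ refer to the values of these quasipolynomials. $\operatorname{vol} P$ is the volume of $P$ normalized relative to the lattice $\mathbb{Z}^d\cap\operatorname{aff}P$. A point $x$ with distinct coordinates realizes the permutation $\tau$ of $[d]$ if $x_{\tau 1}<\cdots<x_{\tau d}$; $\tau$ is realizable in a set $A$ if some $x\in A$ realizes it. $x$ and $\sigma$ are compatible if $x_{\sigma 1}\le\cdots\le x_{\sigma d}$.
   Formalization: The leading term is claimed only if s lies in no hyperplane x_i = x_j (otherwise both counts vanish); reciprocity for B only if every permutation realizable in s is realizable in P (it fails for 2x_1 = x_2); with "realizable in P" in place of s, reciprocity is proved unconditionally. *)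

theory Defs
  imports "HOL-Analysis.Analysis"
begin

definition rational_linear_form :: "(real^'n \<Rightarrow> real) \<Rightarrow> bool" where
  "rational_linear_form g \<longleftrightarrow>
     (\<exists>a. (\<forall>i. a i \<in> \<rat>) \<and> g = (\<lambda>x. \<Sum>i\<in>UNIV. a i * x $ i))"

definition int_lattice :: "(real^'n) set" where
  "int_lattice = {x. \<forall>i. x $ i \<in> \<int>}"

text \<open>The index set \<open>[d]\<close> is a finite linearly ordered type, so that the chain
  \<open>x\<^bsub>\<tau>1\<^esub> < \<dots> < x\<^bsub>\<tau>d\<^esub>\<close> says that \<open>i \<mapsto> x\<^bsub>\<tau>i\<^esub>\<close> is strictly increasing.\<close>

definition realizes :: "real^'n::{finite,linorder} \<Rightarrow> ('n \<Rightarrow> 'n) \<Rightarrow> bool" where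
  "realizes x \<tau> \<longleftrightarrow> strict_mono (\<lambda>i. x $ \<tau> i)"

definition realizable_perms :: "(real^'n::{finite,linorder}) set \<Rightarrow> ('n \<Rightarrow> 'n) set" where
  "realizable_perms A = {\<tau>. \<tau> permutes UNIV \<and> (\<exists>x\<in>A. realizes x \<tau>)}"

definition compatible :: "real^'n::{finite,linorder} \<Rightarrow> ('n \<Rightarrow> 'n) \<Rightarrow> bool" where
  "compatible x \<sigma> \<longleftrightarrow> mono (\<lambda>i. x $ \<sigma> i)"

definition open_count :: "(real^'n) set \<Rightarrow> nat \<Rightarrow> nat" where
  "open_count s t =
     card {x \<in> int_lattice \<inter> s. inj (\<lambda>i. x $ i) \<and> (\<forall>i. 0 < x $ i \<and> x $ i < real t)}"

text \<open>The set \<open>A\<close> is the one in which the permutations have to be realizable; it is kept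
  separate from \<open>s\<close>, which contains the points.\<close>

definition closed_count ::
  "(real^'n::{finite,linorder}) set \<Rightarrow> (real^'n::{finite,linorder}) set \<Rightarrow> nat \<Rightarrow> nat" where
  "closed_count A s t =
     card {(x, \<sigma>). x \<in> int_lattice \<inter> s \<and> (\<forall>i. 0 \<le> x $ i \<and> x $ i \<le> real t) \<and>
                   \<sigma> \<in> realizable_perms A \<and> compatible x \<sigma>}"

text \<open>The periodic coefficients of a quasipolynomial on the integers are uniquely determined
  by its values, so its leading term is a property of the function.\<close>

definition periodic :: "(int \<Rightarrow> real) \<Rightarrow> bool" where
  "periodic c \<longleftrightarrow> (\<exists>p>0. \<forall>t. c (t + p) = c t)"

definition quasipolynomial :: "(int \<Rightarrow> real) \<Rightarrow> bool" where
  "quasipolynomial Q \<longleftrightarrow>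
     (\<exists>n c. (\<forall>i\<le>n. periodic (c i)) \<and> (\<forall>t. Q t = (\<Sum>i\<le>n. c i t * of_int t ^ i)))"

definition has_leading_term :: "(int \<Rightarrow> real) \<Rightarrow> real \<Rightarrow> nat \<Rightarrow> bool" where
  "has_leading_term Q a n \<longleftrightarrow> a \<noteq> 0 \<and>
     (\<exists>c. (\<forall>i\<le>n. periodic (c i)) \<and> (\<forall>t. Q t = (\<Sum>i\<le>n. c i t * of_int t ^ i)) \<and>
          (\<forall>t. c n t = a))"

text \<open>Volume relative to the lattice \<open>\<Lambda> = \<int>\<^sup>d \<inter> aff P\<close>: the \<open>k\<close>-dimensional Lebesgue measure
  (\<open>k = dim P\<close>) of \<open>P\<close> in the coordinates given by an origin \<open>p \<in> \<Lambda>\<close> and a lattice basis \<open>b\<close>.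
  Two such frames differ by an integral translation and a unimodular map, so the choice does
  not matter. The notion is only meaningful if \<open>\<Lambda>\<close> has rank \<open>k\<close>.\<close>

definition lattice_frame :: "(real^'n) set \<Rightarrow> real^'n \<Rightarrow> (nat \<Rightarrow> real^'n) \<Rightarrow> bool" where
  "lattice_frame P p b \<longleftrightarrow>
     (let k = nat (aff_dim P) in
       inj_on b {..<k} \<and> independent (b ` {..<k}) \<and>
       int_lattice \<inter> affine hull P = {p + (\<Sum>i<k. of_int (z i) *\<^sub>R b i) | z :: nat \<Rightarrow> int. True})"

definition lattice_volume :: "(real^'n) set \<Rightarrow> real" where
  "lattice_volume P =
     (let k = nat (aff_dim P);
          M = PiM {..<k} (\<lambda>_. lborel :: real measure);
          (p, b) = (SOME (p, b). lattice_frame P p b)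
      in measure M {c \<in> space M. p + (\<Sum>i<k. c i *\<^sub>R b i) \<in> P})"

text \<open>If \<open>s\<close> lies in a hyperplane \<open>x\<^sub>i = x\<^sub>j\<close>, both counting functions vanish identically, even
  though \<open>vol P\<close> may be positive; no leading term can then be claimed.\<close>

lemma counts_eq_0_if_subset_diagonal:
  fixes s :: "(real^'n::{finite,linorder}) set"
  assumes "i \<noteq> j" and "s \<subseteq> {x. x $ i = x $ j}"
  shows "open_count s t = 0" and "realizable_perms s = {}" and "closed_count s s t = 0"
proof -
  have eq: "x $ i = x $ j" if "x \<in> s" for x using assms(2) that by auto
  have "\<not> inj (\<lambda>i. x $ i)" if "x \<in> s" for x
    using eq[OF that] assms(1) by (metis injD)
  then have "{x \<in> int_lattice \<inter> s. inj (\<lambda>i. x $ i) \<and> (\<forall>i. 0 < x $ i \<and> x $ i < real t)} = {}"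
    by auto
  then show "open_count s t = 0"
    unfolding open_count_def by (metis card.empty)
  show r: "realizable_perms s = {}"
  proof (rule ccontr)
    assume "realizable_perms s \<noteq> {}"
    then obtain \<tau> x where \<tau>: "\<tau> permutes UNIV" and x: "x \<in> s" "strict_mono (\<lambda>i. x $ \<tau> i)"
      unfolding realizable_perms_def realizes_def by auto
    obtain k l where kl: "i = \<tau> k" "j = \<tau> l"
      using permutes_surj[OF \<tau>] by (metis surjD)
    have "x $ \<tau> k = x $ \<tau> l" using eq[OF x(1)] kl by simp
    then have "k = l" using strict_mono_eq[OF x(2)] by blast
    then show False using kl assms(1) by simp
  qed
  show "closed_count s s t = 0" unfolding closed_count_def r by simp
qed

text \<open>A permutation realizable in \<open>s\<close> need not be realizable in \<open>P = [0,1]\<^sup>d \<inter> s\<close>. For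
  \<open>d = 2\<close> and \<open>s = {x. x\<^sub>2 = 2 x\<^sub>1}\<close>, the transposition is realized in \<open>s\<close> by \<open>(-1, -2)\<close> only with
  negative entries, but is compatible with \<open>0\<close>. There the open count is \<open>\<lfloor>(t-1)/2\<rfloor>\<close>, whose
  reciprocal is \<open>\<lfloor>t/2\<rfloor> + 1\<close>, the closed count for permutations realizable in \<open>P\<close>; the closed
  count for permutations realizable in \<open>s\<close> is \<open>\<lfloor>t/2\<rfloor> + 2\<close>.\<close>

lemma realizable_in_subspace_not_in_polytope:
  fixes s :: "(real^2) set" and \<tau> :: "2 \<Rightarrow> 2"
  assumes "s = {x. 2 * x $ 0 = x $ 1}"
    and "P = {x. \<forall>i. 0 \<le> x $ i \<and> x $ i \<le> 1} \<inter> s"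
    and "\<tau> = Transposition.transpose 0 1"
  shows "\<tau> \<in> realizable_perms s" and "\<tau> \<notin> realizable_perms P" and "compatible 0 \<tau>"
proof -
  have two: "i = 0 \<or> i = 1" for i :: 2
  proof -
    have "(2::2) = 0" by simp
    with exhaust_2[of i] show ?thesis by metis
  qed
  have less: "i < j \<longleftrightarrow> i = 0 \<and> j = 1" for i j :: 2
  proof -
    have l: "(0::2) < 1" by (simp add: less_bit0_def bit0.Rep_0 bit0.Rep_1)
    show ?thesis using two[of i] two[of j] l by (metis less_asym)
  qed
  let ?x = "(\<chi> i. if i = 0 then -1 else -2) :: real^2"
  have "?x \<in> s" "realizes ?x \<tau>"
    unfolding assms realizes_def strict_mono_def by (auto simp: less)
  then show "\<tau> \<in> realizable_perms s"
    unfolding realizable_perms_def assms(3) by (auto intro: permutes_swap_id)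
  show "\<tau> \<notin> realizable_perms P"
  proof
    assume "\<tau> \<in> realizable_perms P"
    then obtain x where x: "x \<in> P" "realizes x \<tau>"
      unfolding realizable_perms_def by auto
    have "x $ 1 < x $ 0"
      using x(2) unfolding realizes_def strict_mono_def assms(3) by (auto simp: less)
    moreover have "2 * x $ 0 = x $ 1" "0 \<le> x $ 0" using x(1) unfolding assms by auto
    ultimately show False by linarith
  qed
  show "compatible 0 \<tau>" unfolding compatible_def by (simp add: mono_def)
qed

end

theory Submission
  imports Defs
begin

text \<open>For a permutation \<open>\<sigma>\<close>, consecutive differences turn the integer points \<open>x\<close> of \<open>s\<close> with
  \<open>0 \<le> x\<^bsub>\<sigma> 1\<^esub> \<le> \<dots> \<le> x\<^bsub>\<sigma> d\<^esub> \<le> t\<close> into the nonnegative integer solutions of degree \<open>t\<close> of a homogeneous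
  linear system, and strict inequalities into positive solutions. So it suffices to prove
  Ehrhart--Macdonald reciprocity for such systems, in Stanley's form: count the solutions that are
  positive on a set \<open>J\<close> of coordinates, against those that are positive on the complement of \<open>J\<close>,
  where \<open>J\<close> is the set of negative coordinates of a real solution \<open>p\<close> without zero coordinates.
  Elliott's identity splits a system along two generators \<open>v\<close>, \<open>w\<close> into the systems with \<open>v\<close>,
  \<open>v + w\<close> and with \<open>v + w\<close>, \<open>w\<close>. If \<open>p\<close> is expressed in the new generators, then each piece and the
  corresponding piece of the complementary count are again complementary. Repeated splitting
  eliminates one equation after the other; for a system without equations, the signed count \<open>Q\<close>
  satisfies \<open>Q t - Q (t - d) = Q' t\<close> for all integers \<open>t\<close>, where \<open>Q'\<close> has one generator of degree \<open>d\<close> less.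

  The permutations realizable in \<open>s\<close> but not in \<open>P\<close> only contribute terms of degree less than
  \<open>dim s\<close>. The leading coefficient is the limit of the Riemann sums of \<open>P\<close> over the scaled lattice.\<close>

subsection \<open>Quasipolynomials of bounded degree\<close>

text \<open>Reciprocity between all solutions and the strictly positive ones is not stable under
  splitting: the two pieces of a cone meet in a common wall, which must be taken away from one of
  them. The sets \<open>J\<close> record the walls that have been removed, and the signs of
  \<open>p\<close> select them so that the count and its complement always make opposite choices. A
  tie \<open>p $ i = p $ j\<close> would give \<open>p\<close> a zero coordinate in the new
  generators; then \<open>p\<close> is moved inside the kernel, and if the whole kernel forces the
  tie, one generator disappears instead.

  Both sides of reciprocity are packed into one function on the integers. Solutions exist only in
  degrees \<open>t \<ge> 0\<close>, so the count lives on \<open>t \<ge> 0\<close> and the reflected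
  complementary count on \<open>t \<le> 0\<close>. That this one function is a quasipolynomial is
  the entire reciprocity statement.

  The number \<open>t\<close> is itself a coordinate of the linear system, namely the total of all
  differences. The kernel therefore has dimension \<open>dim s + 1\<close>, which accounts for the
  signs.\<close>

definition qpoly :: "nat \<Rightarrow> nat \<Rightarrow> (int \<Rightarrow> real) \<Rightarrow> bool" where
  "qpoly N k Q \<longleftrightarrow> N > 0 \<and> (\<exists>c. (\<forall>i t. c i (t + int N) = c i t) \<and>
     (\<forall>t. Q t = (\<Sum>i<k. c i t * of_int t ^ i)))"

lemma periodic_mult:
  fixes c :: "int \<Rightarrow> real"
  assumes "\<And>t. c (t + int N) = c t"
  shows "c (t + int N * j) = c t"
proof -
  have nat: "c (t + int N * int n) = c t" for n t
  proof (induction n arbitrary: t)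
    case (Suc n)
    have "c (t + int N * int (Suc n)) = c ((t + int N * int n) + int N)"
      by (simp add: algebra_simps)
    then show ?case using assms Suc by simp
  qed simp
  show ?thesis
  proof (cases "j \<ge> 0")
    case True
    then show ?thesis using nat[of t "nat j"] by simp
  next
    case False
    then show ?thesis using nat[of "t + int N * j" "nat (-j)"] by (simp add: algebra_simps)
  qed
qed

lemma qpoly_mult_period:
  assumes "qpoly N k Q" "M > 0"
  shows "qpoly (N * M) k Q"
proof -
  obtain c where c: "\<And>i t. c i (t + int N) = c i t" "\<And>t. Q t = (\<Sum>i<k. c i t * of_int t ^ i)"
    using assms unfolding qpoly_def by blast
  have "c i (t + int (N * M)) = c i t" for i t
    using periodic_mult[of "c i" N t "int M"] c(1) by simp
  then show ?thesis using assms c unfolding qpoly_def by auto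
qed

lemma qpoly_add:
  assumes "qpoly N k Q" "qpoly N k R"
  shows "qpoly N k (\<lambda>t. Q t + R t)"
proof -
  obtain c where c: "\<And>i t. c i (t + int N) = c i t" "\<And>t. Q t = (\<Sum>i<k. c i t * of_int t ^ i)"
    using assms unfolding qpoly_def by blast
  obtain c' where c': "\<And>i t. c' i (t + int N) = c' i t" "\<And>t. R t = (\<Sum>i<k. c' i t * of_int t ^ i)"
    using assms unfolding qpoly_def by blast
  show ?thesis using assms(1) unfolding qpoly_def
    by (auto intro!: exI[of _ "\<lambda>i t. c i t + c' i t"] simp: c c' sum.distrib algebra_simps)
qed

lemma qpoly_cmult:
  assumes "qpoly N k Q"
  shows "qpoly N k (\<lambda>t. a * Q t)"
proof -
  obtain c where c: "\<And>i t. c i (t + int N) = c i t" "\<And>t. Q t = (\<Sum>i<k. c i t * of_int t ^ i)"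
    using assms unfolding qpoly_def by blast
  show ?thesis using assms(1) unfolding qpoly_def
    by (auto intro!: exI[of _ "\<lambda>i t. a * c i t"] simp: c sum_distrib_left algebra_simps)
qed

lemma qpoly_diff:
  assumes "qpoly N k Q" "qpoly N k R"
  shows "qpoly N k (\<lambda>t. Q t - R t)"
  using qpoly_add[OF assms(1) qpoly_cmult[OF assms(2), of "-1"]] by simp

lemma qpoly_zero: "N > 0 \<Longrightarrow> qpoly N k (\<lambda>t. 0)"
  unfolding qpoly_def by (auto intro!: exI[of _ "\<lambda>i t. 0"])

lemma qpoly_sum:
  assumes "\<And>x. x \<in> A \<Longrightarrow> qpoly N k (Q x)" "N > 0"
  shows "qpoly N k (\<lambda>t. \<Sum>x\<in>A. Q x t)"
  using assms(1) by (induction A rule: infinite_finite_induct) (auto intro: qpoly_zero qpoly_add assms)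

text \<open>Splitting off the top coefficient drives the inductions on the degree. Since
  \<open>k\<close> bounds the degree strictly, \<open>k = 0\<close> means the zero function, and the
  dimension of a kernel can serve directly as a bound.\<close>

lemma qpoly_Suc_iff:
  "qpoly N (Suc k) Q \<longleftrightarrow>
     (\<exists>c R. (\<forall>t. c (t + int N) = c t) \<and> qpoly N k R \<and> (\<forall>t. Q t = c t * of_int t ^ k + R t))"
proof
  assume q: "qpoly N (Suc k) Q"
  then obtain c where c: "\<And>i t. c i (t + int N) = c i t"
      "\<And>t. Q t = (\<Sum>i<Suc k. c i t * of_int t ^ i)"
    unfolding qpoly_def by blast
  have "qpoly N k (\<lambda>t. \<Sum>i<k. c i t * of_int t ^ i)"
    using q c(1) unfolding qpoly_def by auto
  then show "\<exists>c R. (\<forall>t. c (t + int N) = c t) \<and> qpoly N k R \<and> (\<forall>t. Q t = c t * of_int t ^ k + R t)"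
    using c by (intro exI[of _ "c k"] exI[of _ "\<lambda>t. \<Sum>i<k. c i t * of_int t ^ i"]) auto
next
  assume "\<exists>c R. (\<forall>t. c (t + int N) = c t) \<and> qpoly N k R \<and> (\<forall>t. Q t = c t * of_int t ^ k + R t)"
  then obtain b R where b: "\<And>t. b (t + int N) = b t" and R: "qpoly N k R"
    and Q: "\<And>t. Q t = b t * of_int t ^ k + R t" by blast
  obtain c where c: "\<And>i t. c i (t + int N) = c i t" "\<And>t. R t = (\<Sum>i<k. c i t * of_int t ^ i)"
    using R unfolding qpoly_def by blast
  show "qpoly N (Suc k) Q" using R unfolding qpoly_def
    by (auto intro!: exI[of _ "\<lambda>i. if i = k then b else c i"] simp: b c Q)
qed

lemma qpoly_Suc: "qpoly N k Q \<Longrightarrow> qpoly N (Suc k) Q"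
  unfolding qpoly_Suc_iff by (intro exI[of _ "\<lambda>_. 0"] exI[of _ Q]) auto

lemma qpoly_mono:
  assumes "qpoly N k Q" "k \<le> l"
  shows "qpoly N l Q"
  using assms(2) by (induction l rule: dec_induct) (auto intro: assms qpoly_Suc)

lemma qpoly_common_period:
  assumes "finite A" "\<And>x. x \<in> A \<Longrightarrow> \<exists>N. qpoly N (k x) (Q x)"
  shows "\<exists>N>0. \<forall>x\<in>A. qpoly N (k x) (Q x)"
  using assms
proof (induction A rule: finite_induct)
  case (insert x A)
  obtain N where N: "N > 0" "\<forall>x\<in>A. qpoly N (k x) (Q x)" using insert by blast
  obtain M where M: "qpoly M (k x) (Q x)" using insert by blast
  then have "M > 0" unfolding qpoly_def by simp
  have "\<forall>y\<in>insert x A. qpoly (N * M) (k y) (Q y)"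
    using N qpoly_mult_period[OF M, of N] qpoly_mult_period[OF _ \<open>M > 0\<close>, of N]
    by (auto simp: mult.commute[of M N])
  then show ?case using N \<open>M > 0\<close> by (intro exI[of _ "N * M"]) auto
qed auto

lemma qpoly_mult_id:
  assumes "qpoly N k Q"
  shows "qpoly N (Suc k) (\<lambda>t. of_int t * Q t)"
  using assms
proof (induction k arbitrary: Q)
  case 0
  then show ?case unfolding qpoly_def by (auto intro!: exI[of _ "\<lambda>i t. 0"])
next
  case (Suc k)
  then obtain c R where c: "\<And>t. c (t + int N) = c t" and R: "qpoly N k R"
    and Q: "\<And>t. Q t = c t * of_int t ^ k + R t" unfolding qpoly_Suc_iff by blast
  show ?case unfolding qpoly_Suc_iff[of N "Suc k"] using Suc.IH[OF R] c Q
    by (intro exI[of _ c] exI[of _ "\<lambda>t. of_int t * R t"]) (auto simp: algebra_simps)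
qed

text \<open>Multiplying by \<open>t - a\<close> one factor at a time takes the place of the binomial
  expansion.\<close>

lemma qpoly_mult_shifted_power:
  assumes "\<And>t. c (t + int N) = c t" "N > 0"
  shows "qpoly N (Suc k) (\<lambda>t. c t * (of_int t - a) ^ k)"
proof (induction k)
  case 0
  have "qpoly N 0 (\<lambda>t. 0)" using assms(2) by (rule qpoly_zero)
  then show ?case unfolding qpoly_Suc_iff using assms
    by (intro exI[of _ c] exI[of _ "\<lambda>t. 0"]) auto
next
  case (Suc k)
  have "qpoly N (Suc (Suc k)) (\<lambda>t. of_int t * (c t * (of_int t - a) ^ k) - a * (c t * (of_int t - a) ^ k))"
    by (intro qpoly_diff qpoly_mult_id qpoly_Suc[OF qpoly_cmult] Suc)
  then show ?case by (simp add: algebra_simps)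
qed

lemma qpoly_shift:
  assumes "qpoly N k Q"
  shows "qpoly N k (\<lambda>t. Q (t - a))"
  using assms
proof (induction k arbitrary: Q)
  case 0
  then show ?case by (simp add: qpoly_def)
next
  case (Suc k)
  then obtain c R where c: "\<And>t. c (t + int N) = c t" and R: "qpoly N k R"
    and Q: "\<And>t. Q t = c t * of_int t ^ k + R t" unfolding qpoly_Suc_iff by blast
  have N: "N > 0" using R unfolding qpoly_def by simp
  have "c (t + int N - a) = c (t - a)" for t using c[of "t - a"] by (simp add: algebra_simps)
  then have "qpoly N (Suc k) (\<lambda>t. c (t - a) * (of_int t - of_int a) ^ k)"
    using qpoly_mult_shifted_power[of "\<lambda>t. c (t - a)" N k "of_int a"] N by simp
  from qpoly_add[OF this qpoly_Suc[OF Suc.IH[OF R]]] show ?case by (simp add: Q)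
qed

lemma qpoly_reflect:
  assumes "qpoly N k Q"
  shows "qpoly N k (\<lambda>t. Q (- t))"
proof -
  obtain c where c: "\<And>i t. c i (t + int N) = c i t" "\<And>t. Q t = (\<Sum>i<k. c i t * of_int t ^ i)"
    using assms unfolding qpoly_def by blast
  have "c i (- (t + int N)) = c i (- t)" for i t
    using c(1)[of i "- (t + int N)"] by simp
  moreover have "Q (- t) = (\<Sum>i<k. ((-1) ^ i * c i (- t)) * of_int t ^ i)" for t
    unfolding c(2) by (rule sum.cong) (simp_all add: power_minus[of "real_of_int t"])
  ultimately show ?thesis using assms(1) unfolding qpoly_def
    by (intro conjI exI[of _ "\<lambda>i t. (-1) ^ i * c i (- t)"]) auto
qed

text \<open>With \<open>f k = t ^ k - (t - D) ^ k\<close>, the step is the identity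
  \<open>f (k + 2) = t * f (k + 1) + D * (t - D) ^ (k + 1)\<close>, rearranged so that only the
  remainder \<open>?E k\<close> and a power of \<open>t\<close> occur.\<close>

lemma qpoly_power_difference:
  assumes "N > 0"
  shows "qpoly N k (\<lambda>t. of_int t ^ Suc k - (of_int t - D) ^ Suc k - D * real (Suc k) * of_int t ^ k)"
    (is "qpoly N k (?E k)")
proof (induction k)
  case 0
  then show ?case using qpoly_zero[OF assms] by simp
next
  case (Suc k)
  have 1: "qpoly N (Suc k) (\<lambda>t. of_int t * ?E k t)" by (rule qpoly_mult_id[OF Suc])
  have "qpoly N (Suc k) (\<lambda>t. 1 * (of_int t - 0) ^ k)"
    using qpoly_mult_shifted_power[of "\<lambda>_. 1" N k 0] assms by blast
  then have 2: "qpoly N (Suc k) (\<lambda>t. ?E k t + D * real (Suc k) * (1 * (of_int t - 0) ^ k))"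
    by (rule qpoly_add[OF qpoly_Suc[OF Suc] qpoly_cmult])
  show ?case
    using qpoly_diff[OF 1 qpoly_cmult[OF 2, of D]] by (simp add: algebra_simps)
qed

text \<open>When the step equals the period, a periodic coefficient \<open>c\<close> acts as a
  constant, so \<open>c t * t ^ (k + 1) / (N * (k + 1))\<close> has difference
  \<open>c t * t ^ k\<close> up to lower degree. Subtracting it lowers the degree of the right-hand
  side; a function whose difference vanishes is itself periodic.\<close>

lemma qpoly_antidifference_aligned:
  assumes "qpoly N k R" "\<And>t. Q t - Q (t - int N) = R t"
  shows "qpoly N (Suc k) Q"
  using assms
proof (induction k arbitrary: Q R)
  case 0
  then have N: "N > 0" and "Q t = Q (t - int N)" for t by (auto simp: qpoly_def)
  then have "Q (t + int N) = Q t" for t using \<open>\<And>t. Q t = Q (t - int N)\<close>[of "t + int N"] by simp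
  then show ?case using qpoly_zero[OF N, of 0] unfolding qpoly_Suc_iff
    by (intro exI[of _ Q] exI[of _ "\<lambda>t. 0"]) auto
next
  case (Suc k)
  then obtain c R' where c: "\<And>t. c (t + int N) = c t" and R': "qpoly N k R'"
    and R: "\<And>t. R t = c t * of_int t ^ k + R' t" unfolding qpoly_Suc_iff by blast
  have N: "N > 0" using R' unfolding qpoly_def by simp
  have c': "c (t - int N) = c t" for t using c[of "t - int N"] by simp
  define q where "q = real N * real (Suc k)"
  have q: "q \<noteq> 0" using N by (simp add: q_def)
  define G where "G t = c t * of_int t ^ Suc k / q" for t
  define E where "E t = (of_int t ^ Suc k - (of_int t - real N) ^ Suc k - q * of_int t ^ k)" for t
  have E: "qpoly N k E"
    unfolding E_def q_def by (rule qpoly_power_difference[OF N])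
  have "qpoly N k (\<lambda>t. c t * E t)"
  proof -
    obtain b where b: "\<And>i t. b i (t + int N) = b i t" "\<And>t. E t = (\<Sum>i<k. b i t * of_int t ^ i)"
      using E unfolding qpoly_def by blast
    show ?thesis using N unfolding qpoly_def
      by (auto intro!: exI[of _ "\<lambda>i t. c t * b i t"] simp: b c sum_distrib_left algebra_simps)
  qed
  then have "qpoly N k (\<lambda>t. R' t - (1/q) * (c t * E t))"
    by (intro qpoly_diff qpoly_cmult R')
  moreover have "(Q t - G t) - (Q (t - int N) - G (t - int N)) = R' t - (1/q) * (c t * E t)" for t
  proof -
    have "G t - G (t - int N) = c t * (E t + q * of_int t ^ k) / q"
      unfolding G_def E_def c' by (simp only: diff_divide_distrib[symmetric] right_diff_distrib[symmetric]) simp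
    also have "\<dots> = (1/q) * (c t * E t) + c t * of_int t ^ k" using q by (simp add: field_simps)
    finally show ?thesis using Suc.prems(2)[of t] R[of t] by linarith
  qed
  ultimately have 1: "qpoly N (Suc k) (\<lambda>t. Q t - G t)" by (rule Suc.IH)
  show ?case unfolding qpoly_Suc_iff[of N "Suc k"]
    using 1 c by (intro exI[of _ "\<lambda>t. c t / q"] exI[of _ "\<lambda>t. Q t - G t"]) (auto simp: G_def)
qed

text \<open>Telescoping replaces the step \<open>d\<close> by a multiple of the period of the right-hand side.\<close>

lemma qpoly_antidifference:
  assumes R: "qpoly N k R" and "\<And>t. Q t - Q (t - int d) = R t" and "d > 0"
  shows "\<exists>M. qpoly M (Suc k) Q"
proof -
  have N: "N > 0" using R unfolding qpoly_def by simp
  have "Q t - Q (t - int (n * d)) = (\<Sum>j<n. R (t - int (j * d)))" for n t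
  proof (induction n)
    case (Suc n)
    then show ?case using assms(2)[of "t - int (n * d)"] by (simp add: algebra_simps)
  qed simp
  moreover have "qpoly (N * d) k (\<lambda>t. \<Sum>j<N. R (t - int (j * d)))"
    using N assms(3) by (intro qpoly_sum qpoly_shift qpoly_mult_period R) auto
  ultimately show ?thesis using qpoly_antidifference_aligned by blast
qed

lemma qpoly_imp_quasipolynomial:
  assumes "qpoly N k Q"
  shows "quasipolynomial Q"
proof -
  obtain c where c: "\<And>i t. c i (t + int N) = c i t"
      "\<And>t. Q t = (\<Sum>i<Suc k. c i t * of_int t ^ i)" and N: "N > 0"
    using qpoly_Suc[OF assms] unfolding qpoly_def by blast
  show ?thesis unfolding quasipolynomial_def periodic_def
    using c N by (intro exI[of _ k] exI[of _ c]) (auto simp: lessThan_Suc_atMost intro!: exI[of _ "int N"])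
qed

text \<open>The top coefficient is a priori only periodic. A limit along all \<open>t\<close> is
  also the limit along each residue class, where this coefficient is constant, so all its values
  agree with \<open>V\<close>.\<close>

lemma qpoly_leading_term:
  assumes Q: "qpoly N (Suc n) Q" and lim: "(\<lambda>t. Q (int t) / real t ^ n) \<longlonglongrightarrow> V" and "V \<noteq> 0"
  shows "has_leading_term Q V n"
proof -
  obtain c where c: "\<And>i t. c i (t + int N) = c i t"
      "\<And>t. Q t = (\<Sum>i<Suc n. c i t * of_int t ^ i)" and N: "N > 0"
    using Q unfolding qpoly_def by blast
  have "c n t = V" for t
  proof -
    \<comment> \<open>The sequence \<open>r\<close> runs through natural numbers congruent to
      \<open>t\<close> modulo \<open>N\<close>; the integer \<open>t\<close> itself may be
      negative.\<close>
    define r where "r j = nat (t mod int N) + N * j" for j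
    have r: "c i (int (r j)) = c i t" for i j
    proof -
      have "int (r j) = t + int N * (int j - t div int N)"
        using N unfolding r_def 
        using mult_div_mod_eq[of "int N" t] by (simp add: right_diff_distrib algebra_simps)
      then show ?thesis using periodic_mult[of "c i" N] c(1) by metis
    qed
    have sm: "strict_mono r" using N unfolding r_def by (auto simp: strict_mono_def)
    have "(\<lambda>j. Q (int (r j)) / real (r j) ^ n) \<longlonglongrightarrow> V"
      using LIMSEQ_subseq_LIMSEQ[OF lim sm] by (simp add: o_def)
    moreover have "(\<lambda>j. Q (int (r j)) / real (r j) ^ n) \<longlonglongrightarrow> c n t"
    proof -
      have inf: "filterlim (\<lambda>j. real (r j)) at_top sequentially"
        using filterlim_compose[OF filterlim_real_sequentially filterlim_subseq[OF sm]] .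
      have "(\<lambda>j. (\<Sum>i<n. c i t * (1 / real (r j)) ^ (n - i)) + c n t) \<longlonglongrightarrow> (\<Sum>i<n. c i t * 0) + c n t"
      proof (intro tendsto_intros)
        fix i assume "i \<in> {..<n}"
        then have "n - i > 0" by simp
        have "(\<lambda>j. (1 / real (r j)) ^ (n - i)) \<longlonglongrightarrow> 0 ^ (n - i)"
          by (intro tendsto_power tendsto_divide_0[OF tendsto_const] filterlim_at_top_imp_at_infinity inf)
        then show "(\<lambda>j. (1 / real (r j)) ^ (n - i)) \<longlonglongrightarrow> 0"
          using \<open>n - i > 0\<close> by (simp add: power_0_left)
      qed
      moreover have "\<forall>\<^sub>F j in sequentially.
        (\<Sum>i<n. c i t * (1 / real (r j)) ^ (n - i)) + c n t = Q (int (r j)) / real (r j) ^ n"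
      proof (rule eventually_sequentiallyI[of 1])
        fix j :: nat assume "j \<ge> 1"
        then have "r j > 0" using N unfolding r_def by simp
        then have pos: "real (r j) > 0" by simp
        have "c i t * real (r j) ^ i / real (r j) ^ n = c i t * (1 / real (r j)) ^ (n - i)" if "i < n" for i
        proof -
          have "real (r j) ^ n = real (r j) ^ i * real (r j) ^ (n - i)"
            using that by (simp flip: power_add)
          then show ?thesis using pos by (simp add: power_one_over)
        qed
        then show "(\<Sum>i<n. c i t * (1 / real (r j)) ^ (n - i)) + c n t = Q (int (r j)) / real (r j) ^ n"
          using pos by (simp add: c(2) r add_divide_distrib sum_divide_distrib)
      qed
      ultimately show ?thesis by (simp add: tendsto_cong)
    qed
    ultimately show ?thesis using LIMSEQ_unique by blast
  qed
  then show ?thesis unfolding has_leading_term_def periodic_def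
    using c N \<open>V \<noteq> 0\<close>
    by (intro conjI exI[of _ c]) (auto simp: lessThan_Suc_atMost intro!: exI[of _ "int N"])
qed

subsection \<open>Reciprocity for homogeneous linear Diophantine systems\<close>

text \<open>Exponent vectors: the generator \<open>i\<close> has degree \<open>d i\<close> and
  carries the integer vector \<open>u i\<close>. Vanishing outside \<open>I\<close> lets generators
  be dropped while the index type stays fixed. The degree \<open>t\<close> is an integer, so
  negative degrees give the empty set.\<close>

definition solutions ::
  "nat \<Rightarrow> 'i set \<Rightarrow> ('i \<Rightarrow> nat) \<Rightarrow> ('i \<Rightarrow> nat \<Rightarrow> int) \<Rightarrow> 'i set \<Rightarrow> int \<Rightarrow> ('i \<Rightarrow> nat) set" where
  "solutions m I d u J t =
     {a. (\<forall>i. i \<notin> I \<longrightarrow> a i = 0) \<and> (\<forall>i\<in>J. a i \<noteq> 0) \<and>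
         (\<forall>k<m. (\<Sum>i\<in>I. int (a i) * u i k) = 0) \<and> (\<Sum>i\<in>I. int (a i) * int (d i)) = t}"

definition kernel :: "nat \<Rightarrow> 'i::finite set \<Rightarrow> ('i \<Rightarrow> nat \<Rightarrow> int) \<Rightarrow> (real^'i) set" where
  "kernel m I u = {p. (\<forall>i. i \<notin> I \<longrightarrow> p $ i = 0) \<and> (\<forall>k<m. (\<Sum>i\<in>I. p $ i * of_int (u i k)) = 0)}"

text \<open>For \<open>t > 0\<close> only the first term can be nonzero, for \<open>t < 0\<close>
  only the second. A quasipolynomial with these values thus has the first count on one side and, up
  to sign, the complementary count on the other.\<close>

definition signed_count ::
  "nat \<Rightarrow> 'i::finite set \<Rightarrow> ('i \<Rightarrow> nat) \<Rightarrow> ('i \<Rightarrow> nat \<Rightarrow> int) \<Rightarrow> 'i set \<Rightarrow> int \<Rightarrow> real" where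
  "signed_count m I d u J t = real (card (solutions m I d u J t)) -
     (-1) ^ dim (kernel m I u) * real (card (solutions m I d u (I - J) (- t)))"

text \<open>Geometrically, \<open>J\<close> marks the coordinate hyperplanes that separate
  \<open>p\<close> from the cone of nonnegative kernel elements. Half-open cones of this kind are
  closed under splitting.\<close>

definition reciprocal :: "nat \<Rightarrow> 'i::finite set \<Rightarrow> ('i \<Rightarrow> nat) \<Rightarrow> ('i \<Rightarrow> nat \<Rightarrow> int) \<Rightarrow> bool" where
  "reciprocal m I d u \<longleftrightarrow> (\<forall>J p. J \<subseteq> I \<longrightarrow> p \<in> kernel m I u \<longrightarrow> (\<forall>i\<in>J. p $ i < 0) \<longrightarrow>
     (\<forall>i\<in>I-J. p $ i > 0) \<longrightarrow> (\<exists>N. qpoly N (dim (kernel m I u)) (signed_count m I d u J)))"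

lemma reciprocalD:
  assumes "reciprocal m I d u" "J \<subseteq> I" "p \<in> kernel m I u" "\<forall>i\<in>J. p $ i < 0" "\<forall>i\<in>I-J. p $ i > 0"
  shows "\<exists>N. qpoly N (dim (kernel m I u)) (signed_count m I d u J)"
  using assms(1)[unfolded reciprocal_def, rule_format, OF assms(2,3)] assms(4,5) by blast

lemma finite_solutions:
  fixes I :: "'i::finite set"
  assumes "\<forall>i\<in>I. d i > 0"
  shows "finite (solutions m I d u J t)"
proof (rule finite_subset)
  show "solutions m I d u J t \<subseteq> PiE UNIV (\<lambda>_. {..nat t})"
  proof
    fix a assume a: "a \<in> solutions m I d u J t"
    have "a i \<le> nat t" for i
    proof (cases "i \<in> I")
      case True
      have "int (a i) * int (d i) \<le> (\<Sum>i\<in>I. int (a i) * int (d i))"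
        using True by (intro member_le_sum) auto
      moreover have "int (a i) \<le> int (a i) * int (d i)"
        using assms True by (auto simp: mult_le_cancel_left1 Suc_le_eq)
      ultimately show ?thesis using a unfolding solutions_def by auto
    qed (use a in \<open>auto simp: solutions_def\<close>)
    then show "a \<in> PiE UNIV (\<lambda>_. {..nat t})" by auto
  qed
qed (simp add: finite_PiE)

section \<open>Elliott's splitting of a system along two generators\<close>

lemma sum_shear:
  fixes x w :: "'i \<Rightarrow> 'a::comm_ring_1"
  assumes "finite I" "i \<in> I" "j \<in> I" "i \<noteq> j"
  shows "(\<Sum>l\<in>I. (if l = i then x i - x j else x l) * (if l = j then w i + w j else w l)) =
         (\<Sum>l\<in>I. x l * w l)"
proof -
  define K where "K = I - {i, j}"
  have I: "I = insert i (insert j K)" and K: "i \<notin> K" "j \<notin> K" "finite K"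
    using assms unfolding K_def by auto
  have "(\<Sum>l\<in>K. (if l = i then x i - x j else x l) * (if l = j then w i + w j else w l)) =
        (\<Sum>l\<in>K. x l * w l)"
    using K by (intro sum.cong) auto
  then show ?thesis unfolding I using K assms(4) by (simp add: algebra_simps)
qed

text \<open>Slot \<open>j\<close> receives the sum of the generators \<open>i\<close> and
  \<open>j\<close>, while slot \<open>i\<close> keeps its generator. The order of the two indices
  thus says which of the two old generators survives.\<close>

definition merge_deg :: "('i \<Rightarrow> nat) \<Rightarrow> 'i \<Rightarrow> 'i \<Rightarrow> 'i \<Rightarrow> nat" where
  "merge_deg d i j = d(j := d i + d j)"

definition merge_forms :: "('i \<Rightarrow> nat \<Rightarrow> int) \<Rightarrow> 'i \<Rightarrow> 'i \<Rightarrow> 'i \<Rightarrow> nat \<Rightarrow> int" where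
  "merge_forms u i j = u(j := \<lambda>k. u i k + u j k)"

lemma merge_deg_pos: "\<forall>l\<in>I. d l > 0 \<Longrightarrow> \<forall>l\<in>I. merge_deg d i j l > 0"
  by (auto simp: merge_deg_def)

text \<open>Elliott's identity \<open>a i * v + a j * w = (a i - a j) * v + a j * (v + w)\<close>,
  used where the subtraction of natural numbers is exact. The predicate \<open>R\<close>
  accommodates both the weak and the strict half.\<close>

lemma card_solutions_half:
  fixes I :: "'i::finite set"
  assumes ij: "i \<in> I" "j \<in> I" "i \<noteq> j"
    and R: "\<And>a. a j \<le> a i \<Longrightarrow>
      (\<forall>l\<in>J. a l \<noteq> 0) \<and> R a \<longleftrightarrow> (\<forall>l\<in>J'. (a(i := a i - a j)) l \<noteq> 0)"
  shows "card {a \<in> solutions m I d u J t. a j \<le> a i \<and> R a} =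
         card (solutions m I (merge_deg d i j) (merge_forms u i j) J' t)"
proof (rule bij_betw_same_card[of "\<lambda>a. a(i := a i - a j)"])
  have sums: "(\<Sum>l\<in>I. int ((a(i := a i - a j)) l) * (if l = j then w i + w j else w l)) =
      (\<Sum>l\<in>I. int (a l) * w l)" if "a j \<le> a i" for a and w :: "'i \<Rightarrow> int"
  proof -
    have "(\<Sum>l\<in>I. int ((a(i := a i - a j)) l) * (if l = j then w i + w j else w l)) =
      (\<Sum>l\<in>I. (if l = i then int (a i) - int (a j) else int (a l)) * (if l = j then w i + w j else w l))"
      using that by (intro sum.cong) auto
    also have "\<dots> = (\<Sum>l\<in>I. int (a l) * w l)"
      using sum_shear[of I i j "\<lambda>l. int (a l)" w] ij by simp
    finally show ?thesis .
  qed
  have mf: "merge_forms u i j l k = (if l = j then u i k + u j k else u l k)" for l k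
    by (simp add: merge_forms_def)
  have md: "int (merge_deg d i j l) = (if l = j then int (d i) + int (d j) else int (d l))" for l
    by (simp add: merge_deg_def)
  have iff: "a(i := a i - a j) \<in> solutions m I (merge_deg d i j) (merge_forms u i j) J' t \<longleftrightarrow>
      a \<in> solutions m I d u J t \<and> R a" if "a j \<le> a i" for a
  proof -
    have "(\<Sum>l\<in>I. int ((a(i := a i - a j)) l) * merge_forms u i j l k) = (\<Sum>l\<in>I. int (a l) * u l k)" for k
      unfolding mf using sums[OF that, of "\<lambda>l. u l k"] .
    moreover have "(\<Sum>l\<in>I. int ((a(i := a i - a j)) l) * int (merge_deg d i j l)) = (\<Sum>l\<in>I. int (a l) * int (d l))"
      unfolding md using sums[OF that, of "\<lambda>l. int (d l)"] .
    moreover have "(\<forall>l. l \<notin> I \<longrightarrow> (a(i := a i - a j)) l = 0) \<longleftrightarrow> (\<forall>l. l \<notin> I \<longrightarrow> a l = 0)"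
    proof -
      have "l \<noteq> i" if "l \<notin> I" for l using that ij by auto
      then show ?thesis by auto
    qed
    ultimately show ?thesis
      by (simp only: solutions_def mem_Collect_eq R[OF that, symmetric]) blast
  qed
  show "bij_betw (\<lambda>a. a(i := a i - a j)) {a \<in> solutions m I d u J t. a j \<le> a i \<and> R a}
     (solutions m I (merge_deg d i j) (merge_forms u i j) J' t)"
  proof (rule bij_betw_byWitness[where f' = "\<lambda>a. a(i := a i + a j)"])
    show "(\<lambda>a. a(i := a i + a j)) ` solutions m I (merge_deg d i j) (merge_forms u i j) J' t
       \<subseteq> {a \<in> solutions m I d u J t. a j \<le> a i \<and> R a}"
    proof (rule image_subsetI)
      fix a assume a: "a \<in> solutions m I (merge_deg d i j) (merge_forms u i j) J' t"
      let ?b = "a(i := a i + a j)"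
      have "?b(i := ?b i - ?b j) = a" "?b j \<le> ?b i" using ij by auto
      then show "?b \<in> {a \<in> solutions m I d u J t. a j \<le> a i \<and> R a}"
        using iff[of ?b] a by simp
    qed
  qed (use iff ij in auto)
qed

text \<open>Ties \<open>a i = a j\<close> belong to the first half. If \<open>i\<close> is in
  \<open>J\<close>, then so is \<open>j\<close>, and \<open>a i \<ge> a j > 0\<close> holds
  automatically there; the difference may vanish, so \<open>i\<close> leaves \<open>J\<close>. In
  the second half the difference is strictly positive, so \<open>j\<close> enters
  \<open>J\<close>.\<close>

lemma card_solutions_split:
  fixes I :: "'i::finite set"
  assumes d: "\<forall>l\<in>I. d l > 0" and ij: "i \<in> I" "j \<in> I" "i \<noteq> j" and J: "i \<in> J \<longrightarrow> j \<in> J"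
  shows "card (solutions m I d u J t) =
    card (solutions m I (merge_deg d i j) (merge_forms u i j) (J - {i}) t) +
    card (solutions m I (merge_deg d j i) (merge_forms u j i) (insert j J) t)"
proof -
  let ?S = "solutions m I d u J t"
  have "?S = {a \<in> ?S. a j \<le> a i \<and> True} \<union> {a \<in> ?S. a i \<le> a j \<and> a i \<noteq> a j}"
  proof (rule set_eqI)
    fix a :: "'i \<Rightarrow> nat"
    have "a j \<le> a i \<or> a i \<le> a j \<and> a i \<noteq> a j" by linarith
    then show "a \<in> ?S \<longleftrightarrow> a \<in> {a \<in> ?S. a j \<le> a i \<and> True} \<union> {a \<in> ?S. a i \<le> a j \<and> a i \<noteq> a j}"
      by (simp only: Un_iff mem_Collect_eq) blast
  qed
  then have "card ?S = card ({a \<in> ?S. a j \<le> a i \<and> True} \<union> {a \<in> ?S. a i \<le> a j \<and> a i \<noteq> a j})" by (rule arg_cong)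
  also have "\<dots> = card {a \<in> ?S. a j \<le> a i \<and> True} + card {a \<in> ?S. a i \<le> a j \<and> a i \<noteq> a j}"
    using finite_solutions[OF d, of m u J t] by (intro card_Un_disjoint finite_Collect_conjI) auto
  also have "card {a \<in> ?S. a j \<le> a i \<and> True} =
      card (solutions m I (merge_deg d i j) (merge_forms u i j) (J - {i}) t)"
  proof (rule card_solutions_half[OF ij])
    fix a :: "'i \<Rightarrow> nat" assume le: "a j \<le> a i"
    have "a i \<noteq> 0" if "i \<in> J" "\<forall>l\<in>J-{i}. a l \<noteq> 0"
    proof -
      have "a j \<noteq> 0" using that J ij by blast
      then show ?thesis using le by linarith
    qed
    then show "(\<forall>l\<in>J. a l \<noteq> 0) \<and> True \<longleftrightarrow> (\<forall>l\<in>J-{i}. (a(i := a i - a j)) l \<noteq> 0)"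
      by (metis DiffD1 DiffD2 DiffI fun_upd_other singletonD singletonI)
  qed
  also have "card {a \<in> ?S. a i \<le> a j \<and> a i \<noteq> a j} =
      card (solutions m I (merge_deg d j i) (merge_forms u j i) (insert j J) t)"
  proof (rule card_solutions_half[OF ij(2,1) ij(3)[symmetric]])
    fix a :: "'i \<Rightarrow> nat" assume le: "a i \<le> a j"
    have "(\<forall>l\<in>insert j J. (a(j := a j - a i)) l \<noteq> 0) \<longleftrightarrow> a j - a i \<noteq> 0 \<and> (\<forall>l\<in>J-{j}. a l \<noteq> 0)"
      by (auto split: if_splits)
    moreover have "a j - a i \<noteq> 0 \<longleftrightarrow> a i \<noteq> a j" using le by linarith
    moreover have "a j \<noteq> 0" if "a i \<noteq> a j" using le that by linarith
    ultimately show "(\<forall>l\<in>J. a l \<noteq> 0) \<and> a i \<noteq> a j \<longleftrightarrow> (\<forall>l\<in>insert j J. (a(j := a j - a i)) l \<noteq> 0)"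
      by (metis DiffD1 DiffI singletonD)
  qed
  finally show ?thesis .
qed

definition shear :: "'i \<Rightarrow> 'i \<Rightarrow> real^'i \<Rightarrow> real^'i" where
  "shear i j p = (\<chi> l. if l = i then p $ i - p $ j else p $ l)"

lemma shear_in_kernel_iff:
  fixes I :: "'i::finite set"
  assumes ij: "i \<in> I" "j \<in> I" "i \<noteq> j"
  shows "shear i j p \<in> kernel m I (merge_forms u i j) \<longleftrightarrow> p \<in> kernel m I u"
proof -
  have "(\<Sum>l\<in>I. shear i j p $ l * of_int (merge_forms u i j l k)) = (\<Sum>l\<in>I. p $ l * of_int (u l k))" for k
  proof -
    have "(\<Sum>l\<in>I. shear i j p $ l * of_int (merge_forms u i j l k)) =
      (\<Sum>l\<in>I. (if l = i then p $ i - p $ j else p $ l) *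
         (if l = j then of_int (u i k) + of_int (u j k) else of_int (u l k)))"
      by (intro sum.cong) (auto simp: shear_def merge_forms_def)
    then show ?thesis
      using sum_shear[of I i j "\<lambda>l. p $ l" "\<lambda>l. of_int (u l k)"] ij by simp
  qed
  moreover have "(\<forall>l. l \<notin> I \<longrightarrow> shear i j p $ l = 0) \<longleftrightarrow> (\<forall>l. l \<notin> I \<longrightarrow> p $ l = 0)"
  proof -
    have "shear i j p $ l = p $ l" if "l \<notin> I" for l using that ij by (auto simp: shear_def)
    then show ?thesis by auto
  qed
  ultimately show ?thesis by (simp add: kernel_def)
qed

lemma subspace_kernel: "subspace (kernel m I u)"
proof -
  have [simp]: "(\<Sum>i\<in>I. (c * x $ i) * of_int (u i k)) = c * (\<Sum>i\<in>I. x $ i * of_int (u i k))"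
    for c k and x :: "real^'a"
    by (simp add: sum_distrib_left mult.assoc)
  show ?thesis unfolding subspace_def kernel_def
    by (auto simp: distrib_right sum.distrib)
qed

lemma dim_kernel_merge:
  fixes I :: "'i::finite set"
  assumes ij: "i \<in> I" "j \<in> I" "i \<noteq> j"
  shows "dim (kernel m I (merge_forms u i j)) = dim (kernel m I u)"
proof -
  have inv: "shear i j (\<chi> l. if l = i then p $ i + p $ j else p $ l) = p" for p
    using ij by (auto simp: shear_def vec_eq_iff)
  have "kernel m I (merge_forms u i j) = shear i j ` kernel m I u"
    
  proof
    show "kernel m I (merge_forms u i j) \<subseteq> shear i j ` kernel m I u"
      using shear_in_kernel_iff[OF ij] inv by (metis (no_types, lifting) image_iff subsetI)
  qed (use shear_in_kernel_iff[OF ij] in blast)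
  moreover have "linear (shear i j)"
    by (rule linearI) (auto simp: shear_def vec_eq_iff algebra_simps)
  moreover have "inj (shear i j)"
  proof (rule injI)
    fix p q assume eq: "shear i j p = shear i j q"
    have "p $ l = q $ l" if "l \<noteq> i" for l
      using arg_cong[OF eq, of "\<lambda>x. x $ l"] that by (simp add: shear_def)
    moreover have "p $ i - p $ j = q $ i - q $ j"
      using arg_cong[OF eq, of "\<lambda>x. x $ i"] by (simp add: shear_def)
    moreover from calculation have "p $ i = q $ i" using ij by auto
    ultimately show "p = q" unfolding vec_eq_iff by metis
  qed
  ultimately show ?thesis using dim_image_eq[of "shear i j" "kernel m I u"] by (simp add: inj_on_subset)
qed

lemma ex_qpoly_add:
  assumes "\<exists>N. qpoly N k Q" "\<exists>N. qpoly N k R"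
  shows "\<exists>N. qpoly N k (\<lambda>t. Q t + R t)"
proof -
  obtain N M where "qpoly N k Q" "qpoly M k R" using assms by blast
  moreover from this have "N > 0" "M > 0" by (auto simp: qpoly_def)
  ultimately have "qpoly (N * M) k (\<lambda>t. Q t + R t)"
    using qpoly_add[OF qpoly_mult_period[of N k Q M]] qpoly_mult_period[of M k R N]
    by (simp add: mult.commute)
  then show ?thesis by blast
qed

text \<open>In the new generators \<open>p\<close> has the coordinate
  \<open>p $ i - p $ j > 0\<close> in one piece and \<open>p $ j - p $ i < 0\<close> in the other.
  Its sets of negative coordinates become \<open>J - {i}\<close> and \<open>insert j J\<close>,
  which are exactly the sets produced by splitting the count.\<close>

lemma reciprocal_split_generic:
  fixes I :: "'i::finite set"
  assumes d: "\<forall>l\<in>I. d l > 0" and ij: "i \<in> I" "j \<in> I" "i \<noteq> j"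
    and rec1: "reciprocal m I (merge_deg d i j) (merge_forms u i j)"
    and rec2: "reciprocal m I (merge_deg d j i) (merge_forms u j i)"
    and J: "J \<subseteq> I" and p: "p \<in> kernel m I u" "\<forall>l\<in>J. p $ l < 0" "\<forall>l\<in>I-J. p $ l > 0"
    and less: "p $ j < p $ i"
  shows "\<exists>N. qpoly N (dim (kernel m I u)) (signed_count m I d u J)"
proof -
  have ji: "j \<in> I" "i \<in> I" "j \<noteq> i" using ij by auto
  have iJ: "i \<in> J \<longrightarrow> j \<in> J"
  proof
    assume "i \<in> J"
    then have "p $ j < 0" using p(2) less by force
    then show "j \<in> J" using p(3) ij by force
  qed
  let ?s1 = "signed_count m I (merge_deg d i j) (merge_forms u i j) (J - {i})"
  let ?s2 = "signed_count m I (merge_deg d j i) (merge_forms u j i) (insert j J)"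
  have p1: "\<exists>N. qpoly N (dim (kernel m I u)) ?s1"
  proof -
    have "shear i j p \<in> kernel m I (merge_forms u i j)"
      using shear_in_kernel_iff[OF ij] p by blast
    moreover have "\<forall>l\<in>J-{i}. shear i j p $ l < 0" using p by (auto simp: shear_def)
    moreover have "\<forall>l\<in>I-(J-{i}). shear i j p $ l > 0" using p less by (auto simp: shear_def)
    moreover have "J - {i} \<subseteq> I" using J by auto
    ultimately show ?thesis using reciprocalD[OF rec1] dim_kernel_merge[OF ij] by metis
  qed
  have p2: "\<exists>N. qpoly N (dim (kernel m I u)) ?s2"
  proof -
    have "shear j i p \<in> kernel m I (merge_forms u j i)"
      using shear_in_kernel_iff[OF ji] p by blast
    moreover have "\<forall>l\<in>insert j J. shear j i p $ l < 0" using p less by (auto simp: shear_def)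
    moreover have "\<forall>l\<in>I-insert j J. shear j i p $ l > 0" using p by (auto simp: shear_def)
    moreover have "insert j J \<subseteq> I" using J ij by auto
    ultimately show ?thesis using reciprocalD[OF rec2] dim_kernel_merge[OF ji] by metis
  qed
  have "signed_count m I d u J t = ?s1 t + ?s2 t" for t
  proof -
    \<comment> \<open>The complementary count is split with \<open>i\<close> and \<open>j\<close>
      interchanged: its ties go to the opposite piece, and this keeps each pair of pieces
      complementary.\<close>
    have "I - (J - {i}) = insert i (I - J)" "I - insert j J = (I - J) - {j}"
      using ij by auto
    moreover have "card (solutions m I d u (I - J) (- t)) =
      card (solutions m I (merge_deg d j i) (merge_forms u j i) ((I - J) - {j}) (- t)) +
      card (solutions m I (merge_deg d i j) (merge_forms u i j) (insert i (I - J)) (- t))"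
      using iJ ij by (intro card_solutions_split[OF d ji]) auto
    ultimately show ?thesis
      unfolding signed_count_def card_solutions_split[OF d ij iJ] dim_kernel_merge[OF ij]
        dim_kernel_merge[OF ji]
      by (simp add: distrib_left)
  qed
  then have "signed_count m I d u J = (\<lambda>t. ?s1 t + ?s2 t)" by blast
  then show ?thesis using ex_qpoly_add[OF p1 p2] by simp
qed

lemma solution_in_kernel:
  assumes "a \<in> solutions m I d u J t"
  shows "(\<chi> i. real (a i)) \<in> kernel m I u"
proof -
  have "(\<Sum>i\<in>I. real (a i) * of_int (u i k)) = of_int (\<Sum>i\<in>I. int (a i) * u i k)" for k
    by simp
  moreover have "(\<Sum>i\<in>I. int (a i) * u i k) = 0" if "k < m" for k
    using assms that unfolding solutions_def by blast
  moreover have "a i = 0" if "i \<notin> I" for i using assms that unfolding solutions_def by blast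
  ultimately show ?thesis unfolding kernel_def by (simp del: of_int_sum)
qed

lemma sum_collapse:
  fixes x w :: "'i \<Rightarrow> 'a::comm_ring_1"
  assumes "finite I" "i \<in> I" "j \<in> I" "i \<noteq> j" "x i = x j"
  shows "(\<Sum>l\<in>I-{i}. x l * (if l = j then w i + w j else w l)) = (\<Sum>l\<in>I. x l * w l)"
proof -
  define K where "K = I - {i, j}"
  have I: "I = insert i (insert j K)" "I - {i} = insert j K" and K: "i \<notin> K" "j \<notin> K" "finite K"
    using assms unfolding K_def by auto
  have "(\<Sum>l\<in>K. x l * (if l = j then w i + w j else w l)) = (\<Sum>l\<in>K. x l * w l)"
    using K by (intro sum.cong) auto
  then show ?thesis unfolding I(2) unfolding I(1) using K assms(4,5) by (simp add: algebra_simps)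
qed

text \<open>A coordinate equality on the whole kernel holds for every solution as well, so the
  generators \<open>i\<close> and \<open>j\<close> occur only through their sum. Placing the sum in
  slot \<open>j\<close> and dropping \<open>i\<close> changes neither the counts nor the kernel
  dimension, and \<open>i\<close>, \<open>j\<close> lie on the same side of \<open>J\<close> because
  \<open>p\<close> ties them too.\<close>

lemma reciprocal_split_tied:
  fixes I :: "'i::finite set"
  assumes ij: "i \<in> I" "j \<in> I" "i \<noteq> j"
    and rec: "reciprocal m (I - {i}) (merge_deg d i j) (merge_forms u i j)"
    and J: "J \<subseteq> I" and p: "p \<in> kernel m I u" "\<forall>l\<in>J. p $ l < 0" "\<forall>l\<in>I-J. p $ l > 0"
    and tied: "\<And>q. q \<in> kernel m I u \<Longrightarrow> q $ i = q $ j"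
  shows "\<exists>N. qpoly N (dim (kernel m I u)) (signed_count m I d u J)"
proof -
  let ?d = "merge_deg d i j" and ?u = "merge_forms u i j"
  have iJ: "i \<in> J \<longleftrightarrow> j \<in> J"
  proof -
    have "p $ l < 0 \<longleftrightarrow> l \<in> J" if "l \<in> I" for l
    proof (cases "l \<in> J")
      case False
      then have "p $ l > 0" using p(3) that by blast
      then show ?thesis using False by auto
    qed (use p(2) in auto)
    then show ?thesis using tied[OF p(1)] ij by metis
  qed
  have mf: "?u l k = (if l = j then u i k + u j k else u l k)" for l k
    by (simp add: merge_forms_def)
  have md: "int (?d l) = (if l = j then int (d i) + int (d j) else int (d l))" for l
    by (simp add: merge_deg_def)
  let ?h = "\<lambda>q::real^'i. (\<chi> l. if l = i then 0 else q $ l) :: real^'i"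
  have h_iff: "?h q \<in> kernel m (I - {i}) ?u \<longleftrightarrow> q \<in> kernel m I u" if "q $ i = q $ j" for q
  proof -
    have "(\<Sum>l\<in>I-{i}. ?h q $ l * of_int (?u l k)) = (\<Sum>l\<in>I. q $ l * of_int (u l k))" for k
    proof -
      have "(\<Sum>l\<in>I-{i}. ?h q $ l * of_int (?u l k)) =
        (\<Sum>l\<in>I-{i}. q $ l * (if l = j then of_int (u i k) + of_int (u j k) else of_int (u l k)))"
        by (intro sum.cong) (auto simp: mf)
      then show ?thesis
        using sum_collapse[of I i j "\<lambda>l. q $ l" "\<lambda>l. of_int (u l k)"] ij that by simp
    qed
    moreover have "(\<forall>l. l \<notin> I - {i} \<longrightarrow> ?h q $ l = 0) \<longleftrightarrow> (\<forall>l. l \<notin> I \<longrightarrow> q $ l = 0)"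
    proof -
      have "l \<noteq> i" if "l \<notin> I" for l using that ij by auto
      then show ?thesis by auto
    qed
    ultimately show ?thesis by (simp only: kernel_def mem_Collect_eq)
  qed
  have dim: "dim (kernel m (I - {i}) ?u) = dim (kernel m I u)"
  proof -
    have "kernel m (I - {i}) ?u = ?h ` kernel m I u"
    proof
      show "kernel m (I - {i}) ?u \<subseteq> ?h ` kernel m I u"
      proof
        fix q assume q: "q \<in> kernel m (I - {i}) ?u"
        let ?q = "(\<chi> l. if l = i then q $ j else q $ l) :: real^'i"
        have "q $ i = 0" using q by (auto simp: kernel_def)
        then have hq: "?h ?q = q" by (auto simp: vec_eq_iff)
        have "?q $ i = ?q $ j" by simp
        from h_iff[OF this] have "?q \<in> kernel m I u" using q unfolding hq by blast
        then show "q \<in> ?h ` kernel m I u" by (rule image_eqI[where x = ?q, rotated]) (simp only: hq)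
      qed
    next
      show "?h ` kernel m I u \<subseteq> kernel m (I - {i}) ?u" using h_iff tied by blast
    qed
    moreover have "linear ?h" by (rule linearI) (auto simp: vec_eq_iff)
    moreover have "inj_on ?h (kernel m I u)"
    proof (rule inj_onI)
      fix q r assume qr: "q \<in> kernel m I u" "r \<in> kernel m I u" and eq: "?h q = ?h r"
      have "q $ l = r $ l" if "l \<noteq> i" for l
        using arg_cong[OF eq, of "\<lambda>x. x $ l"] that by simp
      moreover from this[of j] have "q $ i = r $ i" using tied[OF qr(1)] tied[OF qr(2)] ij by simp
      ultimately show "q = r" unfolding vec_eq_iff by metis
    qed
    ultimately show ?thesis
      using dim_image_eq[of ?h "kernel m I u"] iffD2[OF span_eq_iff subspace_kernel[of m I u]] by simp
  qed
  have card: "card (solutions m I d u K t) = card (solutions m (I - {i}) ?d ?u (K - {i}) t)"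
    if K: "K \<subseteq> I" "i \<in> K \<longleftrightarrow> j \<in> K" for K t
  proof (rule bij_betw_same_card[of "\<lambda>a. a(i := 0)"])
    have iff: "a(i := 0) \<in> solutions m (I - {i}) ?d ?u (K - {i}) t \<longleftrightarrow> a \<in> solutions m I d u K t"
      if a: "a i = a j" for a
    proof -
      have sums: "(\<Sum>l\<in>I-{i}. int ((a(i := 0)) l) * (if l = j then w i + w j else w l)) =
         (\<Sum>l\<in>I. int (a l) * w l)" for w :: "'i \<Rightarrow> int"
      proof -
        have "(\<Sum>l\<in>I-{i}. int ((a(i := 0)) l) * (if l = j then w i + w j else w l)) =
          (\<Sum>l\<in>I-{i}. int (a l) * (if l = j then w i + w j else w l))"
          by (intro sum.cong) auto
        then show ?thesis using sum_collapse[of I i j "\<lambda>l. int (a l)" w] ij a by simp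
      qed
      have "(\<Sum>l\<in>I-{i}. int ((a(i := 0)) l) * ?u l k) = (\<Sum>l\<in>I. int (a l) * u l k)" for k
        unfolding mf using sums[of "\<lambda>l. u l k"] .
      moreover have "(\<Sum>l\<in>I-{i}. int ((a(i := 0)) l) * int (?d l)) = (\<Sum>l\<in>I. int (a l) * int (d l))"
        unfolding md using sums[of "\<lambda>l. int (d l)"] .
      moreover have "(\<forall>l. l \<notin> I - {i} \<longrightarrow> (a(i := 0)) l = 0) \<longleftrightarrow> (\<forall>l. l \<notin> I \<longrightarrow> a l = 0)"
      proof -
        have "l \<noteq> i" if "l \<notin> I" for l using that ij by auto
        then show ?thesis by auto
      qed
      moreover have "(\<forall>l\<in>K-{i}. (a(i := 0)) l \<noteq> 0) \<longleftrightarrow> (\<forall>l\<in>K. a l \<noteq> 0)"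
      proof -
        have "a i \<noteq> 0" if "i \<in> K" "\<forall>l\<in>K-{i}. a l \<noteq> 0" using that K a ij by auto
        then show ?thesis by auto
      qed
      ultimately show ?thesis by (simp only: solutions_def mem_Collect_eq)
    qed
    have eq: "a i = a j" if "a \<in> solutions m I d u K t" for a
      using tied[OF solution_in_kernel[OF that]] by simp
    show "bij_betw (\<lambda>a. a(i := 0)) (solutions m I d u K t) (solutions m (I - {i}) ?d ?u (K - {i}) t)"
    proof (rule bij_betw_byWitness[where f' = "\<lambda>a. a(i := a j)"])
      show "\<forall>a\<in>solutions m I d u K t. (a(i := 0))(i := (a(i := 0)) j) = a"
        using ij by (auto simp: fun_eq_iff dest: eq[symmetric])
      show zero: "\<forall>a\<in>solutions m (I - {i}) ?d ?u (K - {i}) t. (a(i := a j))(i := 0) = a"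
        by (auto simp: solutions_def fun_eq_iff)
      show "(\<lambda>a. a(i := 0)) ` solutions m I d u K t \<subseteq> solutions m (I - {i}) ?d ?u (K - {i}) t"
        using iff eq by blast
      show "(\<lambda>a. a(i := a j)) ` solutions m (I - {i}) ?d ?u (K - {i}) t \<subseteq> solutions m I d u K t"
      proof (rule image_subsetI)
        fix a assume a: "a \<in> solutions m (I - {i}) ?d ?u (K - {i}) t"
        show "a(i := a j) \<in> solutions m I d u K t"
          using iff[of "a(i := a j)"] bspec[OF zero a] a ij by simp
      qed
    qed
  qed
  have "signed_count m I d u J = signed_count m (I - {i}) ?d ?u (J - {i})"
  proof
    fix t
    have "(I - J) - {i} = (I - {i}) - (J - {i})" by auto
    moreover have "card (solutions m I d u (I - J) (- t)) =
        card (solutions m (I - {i}) ?d ?u ((I - J) - {i}) (- t))"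
      using ij iJ by (intro card) blast+
    ultimately show "signed_count m I d u J t = signed_count m (I - {i}) ?d ?u (J - {i}) t"
      unfolding signed_count_def dim card[OF J iJ] by simp
  qed
  moreover have "\<exists>N. qpoly N (dim (kernel m (I - {i}) ?u)) (signed_count m (I - {i}) ?d ?u (J - {i}))"
  proof -
    have "?h p \<in> kernel m (I - {i}) ?u" using h_iff tied p by blast
    moreover have "\<forall>l\<in>J-{i}. ?h p $ l < 0" "\<forall>l\<in>(I-{i})-(J-{i}). ?h p $ l > 0" using p by auto
    moreover have "J - {i} \<subseteq> I - {i}" using J by auto
    ultimately show ?thesis by (intro reciprocalD[OF rec])
  qed
  ultimately show ?thesis using dim by simp
qed

text \<open>Either the kernel forces the tie, or some \<open>q\<close> in it distinguishes the two
  coordinates and a small multiple of \<open>q\<close> added to \<open>p\<close> breaks the tie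
  without changing any sign on \<open>I\<close>.\<close>

lemma reciprocal_split:
  fixes I :: "'i::finite set"
  assumes d: "\<forall>l\<in>I. d l > 0" and ij: "i \<in> I" "j \<in> I" "i \<noteq> j"
    and rec1: "reciprocal m I (merge_deg d i j) (merge_forms u i j)"
    and rec2: "reciprocal m I (merge_deg d j i) (merge_forms u j i)"
    and rec3: "reciprocal m (I - {i}) (merge_deg d i j) (merge_forms u i j)"
  shows "reciprocal m I d u"
  unfolding reciprocal_def
proof (intro allI impI)
  fix J p
  assume J: "J \<subseteq> I" and p: "p \<in> kernel m I u" "\<forall>l\<in>J. p $ l < 0" "\<forall>l\<in>I-J. p $ l > 0"
  show "\<exists>N. qpoly N (dim (kernel m I u)) (signed_count m I d u J)"
  proof (cases "\<forall>q\<in>kernel m I u. q $ i = q $ j")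
    case True
    then show ?thesis using reciprocal_split_tied[OF ij rec3 J p] by blast
  next
    case False
    have "\<exists>p'\<in>kernel m I u. (\<forall>l\<in>J. p' $ l < 0) \<and> (\<forall>l\<in>I-J. p' $ l > 0) \<and> p' $ i \<noteq> p' $ j"
    proof (cases "p $ i = p $ j")
      case eq: True
      obtain q where q: "q \<in> kernel m I u" "q $ i \<noteq> q $ j" using False by blast
      \<comment> \<open>Small enough that \<open>\<epsilon> * q\<close> cannot change the sign of
        any coordinate of \<open>p\<close>; the summand 1 covers the coordinates where
        \<open>q\<close> vanishes.\<close>
      define \<epsilon> where "\<epsilon> = Min ((\<lambda>l. \<bar>p $ l\<bar> / (\<bar>q $ l\<bar> + 1)) ` I)"
      have nz: "p $ l \<noteq> 0" if "l \<in> I" for l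
      proof (cases "l \<in> J")
        case False
        then have "p $ l > 0" using p(3) that by blast
        then show ?thesis by auto
      qed (use p(2) in force)
      have "\<epsilon> > 0" unfolding \<epsilon>_def using ij nz by (subst Min_gr_iff) auto
      have small: "\<bar>\<epsilon> * q $ l\<bar> < \<bar>p $ l\<bar>" if "l \<in> I" for l
      proof -
        have "\<epsilon> \<le> \<bar>p $ l\<bar> / (\<bar>q $ l\<bar> + 1)" unfolding \<epsilon>_def using that by (intro Min_le) auto
        then have "\<epsilon> * (\<bar>q $ l\<bar> + 1) \<le> \<bar>p $ l\<bar>" by (simp add: field_simps)
        moreover have "\<bar>\<epsilon> * q $ l\<bar> = \<epsilon> * \<bar>q $ l\<bar>" using \<open>\<epsilon> > 0\<close> by (simp add: abs_mult)
        ultimately show ?thesis using \<open>\<epsilon> > 0\<close> by (simp add: distrib_left)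
      qed
      have "p + \<epsilon> *\<^sub>R q \<in> kernel m I u"
        using subspace_kernel p(1) q(1) by (metis subspace_add subspace_scale)
      moreover have "\<forall>l\<in>J. (p + \<epsilon> *\<^sub>R q) $ l < 0"
      proof
        fix l assume l: "l \<in> J"
        then have "p $ l < 0" "\<bar>\<epsilon> * q $ l\<bar> < \<bar>p $ l\<bar>" using p(2) small J by blast+
        then show "(p + \<epsilon> *\<^sub>R q) $ l < 0" by auto
      qed
      moreover have "\<forall>l\<in>I-J. (p + \<epsilon> *\<^sub>R q) $ l > 0"
      proof
        fix l assume l: "l \<in> I - J"
        then have "p $ l > 0" "\<bar>\<epsilon> * q $ l\<bar> < \<bar>p $ l\<bar>" using p(3) small by blast+
        then show "(p + \<epsilon> *\<^sub>R q) $ l > 0" by auto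
      qed
      moreover have "(p + \<epsilon> *\<^sub>R q) $ i \<noteq> (p + \<epsilon> *\<^sub>R q) $ j" using eq q(2) \<open>\<epsilon> > 0\<close> by simp
      ultimately show ?thesis by blast
    qed (use p in blast)
    then obtain p' where p': "p' \<in> kernel m I u" "\<forall>l\<in>J. p' $ l < 0" "\<forall>l\<in>I-J. p' $ l > 0"
      "p' $ i \<noteq> p' $ j" by blast
    then consider "p' $ j < p' $ i" | "p' $ i < p' $ j" by linarith
    then show ?thesis
    proof cases
      case 1
      then show ?thesis using reciprocal_split_generic[OF d ij rec1 rec2 J p'(1-3)] by blast
    next
      case 2
      then show ?thesis
        using reciprocal_split_generic[OF d ij(2,1) ij(3)[symmetric] rec2 rec1 J p'(1-3)] by blast
    qed
  qed
qed

section \<open>Systems without equations\<close>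

lemma solutions_insert_free:
  assumes "finite I" "i \<notin> I" "i \<notin> J"
  shows "card (solutions 0 (insert i I) d u (insert i J) t) = card (solutions 0 (insert i I) d u J (t - int (d i)))"
proof (rule bij_betw_same_card[of "\<lambda>a. a(i := a i - 1)"])
  have sum: "(\<Sum>l\<in>I. int ((a(i := c)) l) * int (d l)) = (\<Sum>l\<in>I. int (a l) * int (d l))" for a c
    using assms by (intro sum.cong) auto
  show "bij_betw (\<lambda>a. a(i := a i - 1)) (solutions 0 (insert i I) d u (insert i J) t)
     (solutions 0 (insert i I) d u J (t - int (d i)))"
  proof (rule bij_betw_byWitness[where f' = "\<lambda>a. a(i := a i + 1)"])
    show "\<forall>a\<in>solutions 0 (insert i I) d u (insert i J) t. (a(i := a i - 1))(i := (a(i := a i - 1)) i + 1) = a"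
      by (auto simp: solutions_def)
    show "\<forall>a\<in>solutions 0 (insert i I) d u J (t - int (d i)). (a(i := a i + 1))(i := (a(i := a i + 1)) i - 1) = a"
      by auto
    show "(\<lambda>a. a(i := a i - 1)) ` solutions 0 (insert i I) d u (insert i J) t
       \<subseteq> solutions 0 (insert i I) d u J (t - int (d i))"
    proof (rule image_subsetI)
      fix a assume a: "a \<in> solutions 0 (insert i I) d u (insert i J) t"
      then have "int (a i) * int (d i) + (\<Sum>l\<in>I. int (a l) * int (d l)) = t" "a i \<noteq> 0"
        using assms by (auto simp: solutions_def)
      moreover from this have "int (a i - 1) * int (d i) = int (a i) * int (d i) - int (d i)"
        by (simp add: of_nat_diff left_diff_distrib Suc_le_eq)
      ultimately have "(\<Sum>l\<in>insert i I. int ((a(i := a i - 1)) l) * int (d l)) = t - int (d i)"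
        unfolding sum.insert[OF assms(1,2)] sum by simp
      then show "a(i := a i - 1) \<in> solutions 0 (insert i I) d u J (t - int (d i))"
        using a assms(3) by (auto simp: solutions_def)
    qed
    show "(\<lambda>a. a(i := a i + 1)) ` solutions 0 (insert i I) d u J (t - int (d i))
       \<subseteq> solutions 0 (insert i I) d u (insert i J) t"
    proof (rule image_subsetI)
      fix a assume a: "a \<in> solutions 0 (insert i I) d u J (t - int (d i))"
      then have "int (a i) * int (d i) + (\<Sum>l\<in>I. int (a l) * int (d l)) = t - int (d i)"
        using assms by (auto simp: solutions_def)
      moreover have "int (a i + 1) * int (d i) = int (a i) * int (d i) + int (d i)"
        by (simp add: distrib_right)
      ultimately have "(\<Sum>l\<in>insert i I. int ((a(i := a i + 1)) l) * int (d l)) = t"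
        unfolding sum.insert[OF assms(1,2)] sum by simp
      then show "a(i := a i + 1) \<in> solutions 0 (insert i I) d u (insert i J) t"
        using a assms(3) by (auto simp: solutions_def)
    qed
  qed
qed

lemma card_solutions_insert_free:
  fixes I :: "'i::finite set"
  assumes "\<forall>l\<in>insert i I. d l > 0" "i \<notin> I" "i \<notin> J"
  shows "card (solutions 0 (insert i I) d u J t) =
    card (solutions 0 I d u J t) + card (solutions 0 (insert i I) d u J (t - int (d i)))"
proof -
  let ?S = "solutions 0 (insert i I) d u J t"
  have "?S = solutions 0 I d u J t \<union> solutions 0 (insert i I) d u (insert i J) t"
  proof (rule set_eqI)
    fix a :: "'i \<Rightarrow> nat"
    have "(\<forall>l. l \<notin> I \<longrightarrow> a l = 0) \<longleftrightarrow> (\<forall>l. l \<notin> insert i I \<longrightarrow> a l = 0) \<and> a i = 0"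
      using assms(2) by (metis insert_iff)
    moreover have "(\<Sum>l\<in>insert i I. int (a l) * int (d l)) = (\<Sum>l\<in>I. int (a l) * int (d l))" if "a i = 0"
      using assms that by simp
    ultimately show "a \<in> ?S \<longleftrightarrow> a \<in> solutions 0 I d u J t \<union> solutions 0 (insert i I) d u (insert i J) t"
      unfolding solutions_def Un_iff mem_Collect_eq by (cases "a i = 0") auto
  qed
  moreover have "solutions 0 I d u J t \<inter> solutions 0 (insert i I) d u (insert i J) t = {}"
    using assms by (auto simp: solutions_def)
  moreover have "finite (solutions 0 I d u J t)" "finite (solutions 0 (insert i I) d u (insert i J) t)"
    using assms by (intro finite_solutions; auto)+
  ultimately have "card ?S = card (solutions 0 I d u J t) + card (solutions 0 (insert i I) d u (insert i J) t)"
    using card_Un_disjoint by metis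
  then show ?thesis using solutions_insert_free[of I i J] assms by simp
qed

lemma dim_kernel_0: "dim (kernel 0 (I::'i::finite set) u) = card I"
proof -
  have "kernel 0 I u = {x::real^'i. \<forall>i. i \<notin> I \<longrightarrow> x $ i = 0}" by (simp add: kernel_def)
  then show ?thesis using dim_substandard_cart[of I, where 'a=real] by (simp add: dim_vec_eq)
qed

text \<open>Induction on the generators. Separating \<open>a i = 0\<close> from
  \<open>a i > 0\<close> says that the difference with step \<open>d i\<close> removes the generator
  \<open>i\<close>, so the signed count is an antidifference of one with a generator less, and the
  degree bound rises by one.\<close>

lemma signed_count_free:
  fixes I :: "'i::finite set"
  assumes "\<forall>l\<in>I. d l > 0" "J \<subseteq> I"
  shows "\<exists>N. qpoly N (card I) (signed_count 0 I d u J)"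
proof -
  have "finite I" by simp
  then show ?thesis using assms
  proof (induction I arbitrary: J rule: finite_induct)
    case empty
    \<comment> \<open>At \<open>t = 0\<close> the zero vector is counted once with each sign, and
      the two terms cancel.\<close>
    then have "signed_count 0 {} d u J t = 0" for t
      by (auto simp: signed_count_def dim_kernel_0 solutions_def)
    then have "signed_count 0 {} d u J = (\<lambda>t. 0)" by auto
    then show ?case using qpoly_zero[of 1] by auto
  next
    case (insert i I)
    let ?K = "J - {i}"
    let ?c = "\<lambda>K t. real (card (solutions 0 (insert i I) d u K t))"
    let ?b = "\<lambda>K t. real (card (solutions 0 I d u K t))"
    obtain N where N: "qpoly N (card I) (signed_count 0 I d u ?K)"
      using insert.IH[of ?K] insert.prems by auto
    have rec: "?c K t = ?b K t + ?c K (t - int (d i))" if "i \<notin> K" for K t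
      by (subst card_solutions_insert_free[OF insert.prems(1) insert.hyps(2) that]) (rule of_nat_add)
    have dif: "?b K t = ?c K t - ?c K (t - int (d i))" if "i \<notin> K" for K t
      using rec[OF that, of t] by linarith
    have eq: "- (t - int (d i)) - int (d i) = - t" for t by simp
    have ins: "?c (insert i K) t = ?c K (t - int (d i))" if "i \<notin> K" for K t
      by (simp only: solutions_insert_free[OF insert.hyps that])
    have K: "i \<notin> ?K" "i \<notin> I - ?K" using insert.hyps by auto
    have s: "signed_count 0 I d u ?K t = ?b ?K t - (-1) ^ card I * ?b (I - ?K) (- t)" for t
      by (simp add: signed_count_def dim_kernel_0)
    have dim: "dim (kernel 0 (insert i I) u) = Suc (card I)"
      using insert.hyps by (simp add: dim_kernel_0)
    have dpos: "d i > 0" using insert.prems by simp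
    show ?case
    proof (cases "i \<in> J")
      case False
      then have J: "insert i I - J = insert i (I - ?K)" by auto
      have sc: "signed_count 0 (insert i I) d u J t =
          ?c ?K t - (-1) ^ Suc (card I) * ?c (I - ?K) (- t - int (d i))" for t
        unfolding signed_count_def dim J using ins[OF K(2), of "- t"] False by simp
      \<comment> \<open>The reflected argument moves the other way, so the difference of the
        complementary counts is \<open>- ?b (I - ?K) (- t)\<close>. The power of -1, one higher for
        the larger kernel, compensates for this sign.\<close>
      have "signed_count 0 (insert i I) d u J t - signed_count 0 (insert i I) d u J (t - int (d i)) =
          signed_count 0 I d u ?K t" for t
        unfolding sc s eq dif[OF K(1)] dif[OF K(2)] by (simp add: right_diff_distrib)
      from qpoly_antidifference[OF N this dpos] show ?thesis using insert.hyps by simp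
    next
      case True
      then have J: "insert i I - J = I - ?K" using insert.hyps by auto
      have sc: "signed_count 0 (insert i I) d u J t =
          ?c ?K (t - int (d i)) - (-1) ^ Suc (card I) * ?c (I - ?K) (- t)" for t
        unfolding signed_count_def dim J using ins[OF K(1), of "t"] True by (simp add: insert_absorb)
      have "signed_count 0 (insert i I) d u J t - signed_count 0 (insert i I) d u J (t - int (d i)) =
          signed_count 0 I d u ?K (t - int (d i))" for t
        unfolding sc s dif[OF K(1)] dif[OF K(2)] eq by (simp add: right_diff_distrib)
      from qpoly_antidifference[OF qpoly_shift[OF N] this dpos] show ?thesis using insert.hyps by simp
    qed
  qed
qed

section \<open>Elimination of one equation\<close>

lemma solutions_empty_if_definite:
  fixes \<epsilon> :: int
  assumes p: "p \<in> kernel (Suc m) I u" "\<forall>i\<in>J. p $ i < 0" "\<forall>i\<in>I-J. p $ i > 0" and J: "J \<subseteq> I"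
    and f: "\<forall>i\<in>I. \<epsilon> * u i m \<ge> 0" and i0: "i0 \<in> I" "u i0 m \<noteq> 0" and \<epsilon>: "\<epsilon> \<noteq> 0"
  shows "solutions (Suc m) I d u J t = {}"
proof (rule ccontr)
  assume "solutions (Suc m) I d u J t \<noteq> {}"
  then obtain a where a: "a \<in> solutions (Suc m) I d u J t" by blast
  have "(\<Sum>i\<in>I. int (a i) * (\<epsilon> * u i m)) = \<epsilon> * (\<Sum>i\<in>I. int (a i) * u i m)"
    by (simp add: sum_distrib_left mult_ac)
  also have "\<dots> = 0" using a by (simp add: solutions_def)
  finally have "\<forall>i\<in>I. int (a i) * (\<epsilon> * u i m) = 0"
    using f by (subst (asm) sum_nonneg_eq_0_iff) auto
  \<comment> \<open>A sum of terms of one sign vanishes termwise, and \<open>a\<close> has no zero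
    entry on \<open>J\<close>; so the form is zero there.\<close>
  then have zero: "u i m = 0" if "i \<in> J" for i
  proof -
    have "int (a i) * (\<epsilon> * u i m) = 0"
      using \<open>\<forall>i\<in>I. int (a i) * (\<epsilon> * u i m) = 0\<close> that J by blast
    moreover have "a i \<noteq> 0" using a that unfolding solutions_def by blast
    ultimately show ?thesis using \<epsilon> by simp
  qed
  \<comment> \<open>Outside \<open>J\<close>, where alone the form can be nonzero, \<open>p\<close>
    is positive. So the equation for \<open>p\<close> is again a sum of terms of one sign, and the
    term at \<open>i0\<close> contradicts it.\<close>
  have nonneg: "p $ i * of_int (\<epsilon> * u i m) \<ge> 0" if "i \<in> I" for i
  proof (cases "i \<in> J")
    case True
    then show ?thesis using zero by simp
  next
    case False
    then have "p $ i > 0" using p(3) that by blast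
    then show ?thesis using f that by (metis mult_nonneg_nonneg less_imp_le of_int_0_le_iff)
  qed
  have "(\<Sum>i\<in>I. p $ i * of_int (\<epsilon> * u i m)) = of_int \<epsilon> * (\<Sum>i\<in>I. p $ i * of_int (u i m))"
    by (simp add: sum_distrib_left mult_ac)
  also have "\<dots> = 0" using p(1) by (simp add: kernel_def)
  finally have "p $ i0 * of_int (\<epsilon> * u i0 m) = 0"
    using nonneg i0(1) by (subst (asm) sum_nonneg_eq_0_iff) auto
  moreover have "p $ i0 \<noteq> 0" using p(3) i0 zero by (metis DiffI less_irrefl)
  ultimately show False using i0(2) \<epsilon> by simp
qed

text \<open>Both counts are empty: within \<open>I\<close>, the point \<open>- p\<close> is negative
  exactly on \<open>I - J\<close>, so the preceding argument covers the complementary count as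
  well.\<close>

lemma reciprocal_if_definite:
  fixes I :: "'i::finite set" and \<epsilon> :: int
  assumes f: "\<forall>i\<in>I. \<epsilon> * u i m \<ge> 0" and i0: "i0 \<in> I" "u i0 m \<noteq> 0" and \<epsilon>: "\<epsilon> \<noteq> 0"
  shows "reciprocal (Suc m) I d u"
  unfolding reciprocal_def
proof (intro allI impI)
  fix J p
  assume J: "J \<subseteq> I" and p: "p \<in> kernel (Suc m) I u" "\<forall>l\<in>J. p $ l < 0" "\<forall>l\<in>I-J. p $ l > 0"
  have "- p \<in> kernel (Suc m) I u" using subspace_neg[OF subspace_kernel p(1)] .
  moreover have "\<forall>l\<in>I-J. (- p) $ l < 0" "\<forall>l\<in>I-(I-J). (- p) $ l > 0" using p(2,3) by auto
  moreover have "I - J \<subseteq> I" by auto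
  ultimately have "solutions (Suc m) I d u (I - J) t = {}" for t
    using f i0 \<epsilon> by (rule solutions_empty_if_definite)
  moreover have "solutions (Suc m) I d u J t = {}" for t
    using solutions_empty_if_definite[OF p J f i0 \<epsilon>] .
  ultimately have "signed_count (Suc m) I d u J = (\<lambda>t. 0)" by (auto simp: signed_count_def)
  then show "\<exists>N. qpoly N (dim (kernel (Suc m) I u)) (signed_count (Suc m) I d u J)"
    using qpoly_zero[of 1] by auto
qed

lemma reciprocal_if_trivial_form:
  assumes "reciprocal m I d u" "\<forall>i\<in>I. u i m = 0"
  shows "reciprocal (Suc m) I d u"
proof -
  have "kernel (Suc m) I u = kernel m I u" "solutions (Suc m) I d u J t = solutions m I d u J t" for J t
    using assms(2) unfolding kernel_def solutions_def by (auto simp: less_Suc_eq)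
  then show ?thesis using assms(1) unfolding reciprocal_def signed_count_def by simp
qed

text \<open>Elliott's reduction: as long as the form takes both signs on the generators, merging one of
  maximal absolute value with one of the opposite sign lowers the lexicographic rank given by the
  bound \<open>M\<close>, the number of generators attaining it, and the number of those of opposite sign.\<close>

lemma reciprocal_bounded:
  fixes u :: "'i::finite \<Rightarrow> nat \<Rightarrow> int"
  assumes IH: "\<And>(I::'i set) d u. \<forall>l\<in>I. d l > 0 \<Longrightarrow> reciprocal m I d u"
    and "\<forall>l\<in>I. d l > 0" "\<forall>l\<in>I. \<bar>u l m\<bar> \<le> int M"
  shows "reciprocal (Suc m) I d u"
  using assms(2,3)
proof (induction M arbitrary: I d u)
  case 0
  then show ?case using IH[of I d u] by (intro reciprocal_if_trivial_form) auto
next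
  case (Suc M)
  define big where "big I v = {l\<in>I. \<bar>v l m\<bar> = int (Suc M)}" for I :: "'i set" and v :: "'i \<Rightarrow> nat \<Rightarrow> int"
  show ?case using Suc.prems
  proof (induction "card (big I u)" arbitrary: I d u rule: less_induct)
    case (less I u d)
    note outer = less.hyps
    show ?case
    proof (cases "big I u = {}")
      case True
      have "\<bar>u l m\<bar> \<le> int M" if "l \<in> I" for l
      proof -
        have "\<bar>u l m\<bar> \<le> int (Suc M)" using less.prems(2) that by blast
        moreover have "\<bar>u l m\<bar> \<noteq> int (Suc M)" using True that unfolding big_def by blast
        ultimately show ?thesis by linarith
      qed
      then have "\<forall>l\<in>I. \<bar>u l m\<bar> \<le> int M" by blast
      then show ?thesis by (rule Suc.IH[OF less.prems(1)])
    next
      case False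
      then obtain i0 where i0: "i0 \<in> I" "\<bar>u i0 m\<bar> = int (Suc M)" unfolding big_def by blast
      \<comment> \<open>Multiplication by this sign makes the chosen extremal value positive, so
        only one orientation has to be treated.\<close>
      define \<epsilon> :: int where "\<epsilon> = sgn (u i0 m)"
      have \<epsilon>: "\<bar>\<epsilon>\<bar> = 1" "\<epsilon> \<noteq> 0" using i0(2) unfolding \<epsilon>_def sgn_if by auto
      have "\<epsilon> * u i0 m = int (Suc M)" using i0(2) unfolding \<epsilon>_def sgn_if by (auto split: if_splits)
      then have ex: "\<exists>i\<in>I. \<epsilon> * u i m = int (Suc M)" using i0 by blast
      \<comment> \<open>Freezing the outer measure in \<open>C\<close> keeps the outer hypothesis
        available for all systems met in the inner induction.\<close>
      define C where "C = card (big I u)"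
      have abs\<epsilon>: "\<bar>\<epsilon> * x\<bar> = \<bar>x\<bar>" for x using \<epsilon> by (simp add: abs_mult)
      have outer: "reciprocal (Suc m) I' d' u'"
        if "card (big I' u') < C" "\<forall>l\<in>I'. d' l > 0" "\<forall>l\<in>I'. \<bar>u' l m\<bar> \<le> int (Suc M)" for I' d' u'
        using that unfolding C_def by (intro outer)
      have "card (big I u) \<le> C" unfolding C_def by simp
      with less.prems ex show ?thesis
      proof (induction "card {l\<in>I. \<epsilon> * u l m < 0}" arbitrary: I d u rule: less_induct)
        case (less I u d)
        obtain i where i: "i \<in> I" "\<epsilon> * u i m = int (Suc M)" using less.prems by blast
        show ?case
        proof (cases "\<exists>j\<in>I. \<epsilon> * u j m < 0")
          case False
          then have "\<forall>l\<in>I. 0 \<le> \<epsilon> * u l m" by (meson not_less)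
          moreover have "u i m \<noteq> 0" using i(2) by auto
          ultimately show ?thesis using i(1) \<epsilon>(2) by (intro reciprocal_if_definite)
        next
          case True
          then obtain j where j: "j \<in> I" "\<epsilon> * u j m < 0" by blast
          have ij: "i \<noteq> j" using i j by force
          \<comment> \<open>The value of the merged generator: an extremal positive value plus a
            negative one of no larger absolute value (up to the sign \<open>\<epsilon>\<close>),
            hence nonnegative and strictly below the bound.\<close>
          define w where "w = u i m + u j m"
          have "\<bar>\<epsilon> * u j m\<bar> \<le> int (Suc M)" using less.prems(2) j(1) abs\<epsilon> by simp
          then have w: "0 \<le> \<epsilon> * w" "\<epsilon> * w < int (Suc M)"
            using i(2) j(2) unfolding w_def by (simp_all add: distrib_left)
          then have "\<bar>\<epsilon> * w\<bar> < int (Suc M)" by linarith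
          then have wabs: "\<bar>w\<bar> < int (Suc M)" unfolding abs\<epsilon> .
          have mf: "merge_forms u i j l m = (if l = j then w else u l m)"
            "merge_forms u j i l m = (if l = i then w else u l m)" for l
            unfolding merge_forms_def w_def by auto
          have ibig: "i \<in> big I u" using i abs\<epsilon>[of "u i m"] unfolding big_def by simp
          have bnd1: "\<forall>l\<in>I. \<bar>merge_forms u i j l m\<bar> \<le> int (Suc M)"
            using less.prems(2) wabs unfolding mf by auto
          have bnd2: "\<forall>l\<in>I. \<bar>merge_forms u j i l m\<bar> \<le> int (Suc M)"
            using less.prems(2) wabs unfolding mf by auto
          have fin: "finite (big I u)" by simp
          \<comment> \<open>In these two systems the extremal generator \<open>i\<close> is
            overwritten by the merged one or removed, so the outer measure drops.\<close>
          have "big I (merge_forms u j i) \<subset> big I u" "big (I - {i}) (merge_forms u i j) \<subset> big I u"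
            using ibig wabs unfolding big_def mf by auto
          then have c2: "card (big I (merge_forms u j i)) < C" "card (big (I - {i}) (merge_forms u i j)) < C"
            using less_le_trans[OF psubset_card_mono[OF fin] less.prems(4)] by blast+
          \<comment> \<open>Here \<open>i\<close> stays extremal, but slot \<open>j\<close> no
            longer has the opposite sign, so the inner measure drops.\<close>
          have rec1: "reciprocal (Suc m) I (merge_deg d i j) (merge_forms u i j)"
          proof (rule less.hyps)
            have "{l\<in>I. \<epsilon> * merge_forms u i j l m < 0} \<subset> {l\<in>I. \<epsilon> * u l m < 0}"
              using j w unfolding mf by auto
            then show "card {l\<in>I. \<epsilon> * merge_forms u i j l m < 0} < card {l\<in>I. \<epsilon> * u l m < 0}"
              by (intro psubset_card_mono) auto
            show "\<exists>i'\<in>I. \<epsilon> * merge_forms u i j i' m = int (Suc M)"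
              using i ij unfolding mf by (intro bexI[of _ i]) auto
            have "big I (merge_forms u i j) \<subseteq> big I u"
              using wabs unfolding big_def mf by auto
            then show "card (big I (merge_forms u i j)) \<le> C"
              using card_mono[OF fin] less.prems(4) le_trans by blast
          qed (use bnd1 merge_deg_pos[OF less.prems(1)] in auto)
          have rec2: "reciprocal (Suc m) I (merge_deg d j i) (merge_forms u j i)"
            using outer[OF c2(1) merge_deg_pos[OF less.prems(1)] bnd2] .
          have rec3: "reciprocal (Suc m) (I - {i}) (merge_deg d i j) (merge_forms u i j)"
            using outer[OF c2(2)] merge_deg_pos[OF less.prems(1)] bnd1 by blast
          show ?thesis
            using reciprocal_split[OF less.prems(1) i(1) j(1) ij rec1 rec2 rec3] .
        qed
      qed
    qed
  qed
qed

lemma reciprocal: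
  fixes I :: "'i::finite set" and u :: "'i \<Rightarrow> nat \<Rightarrow> int"
  assumes "\<forall>l\<in>I. d l > 0"
  shows "reciprocal m I d u"
  using assms
proof (induction m arbitrary: I d u)
  case 0
  then show ?case unfolding reciprocal_def dim_kernel_0 by (intro allI impI signed_count_free)
next
  case (Suc m I d u)
  define M where "M = (\<Sum>l\<in>I. nat \<bar>u l m\<bar>)"
  have "\<bar>u l m\<bar> \<le> int M" if "l \<in> I" for l
  proof -
    have "nat \<bar>u l m\<bar> \<le> M" unfolding M_def using that by (intro member_le_sum) auto
    then show ?thesis by linarith
  qed
  then have "\<forall>l\<in>I. \<bar>u l m\<bar> \<le> int M" by blast
  then show ?case using Suc.prems by (intro reciprocal_bounded[OF Suc.IH, where M = M])
qed

section \<open>Special values, and systems without a positive solution\<close>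

lemma solutions_neg_empty: "t < 0 \<Longrightarrow> solutions m I d u J t = {}"
proof (rule equals0I)
  fix a assume "t < 0" and a: "a \<in> solutions m I d u J t"
  have "0 \<le> (\<Sum>i\<in>I. int (a i) * int (d i))" by (intro sum_nonneg) simp
  then show False using a \<open>t < 0\<close> unfolding solutions_def by simp
qed

lemma solutions_0:
  fixes I :: "'i::finite set"
  assumes "\<forall>i\<in>I. d i > 0" "J \<subseteq> I"
  shows "solutions m I d u J 0 = (if J = {} then {\<lambda>_. 0} else {})"
proof -
  have z: "a = (\<lambda>_. 0)" if a: "a \<in> solutions m I d u J 0" for a
  proof
    fix i
    have "(\<Sum>i\<in>I. int (a i) * int (d i)) = 0" using a by (simp add: solutions_def)
    then have "\<forall>i\<in>I. int (a i) * int (d i) = 0" by (subst (asm) sum_nonneg_eq_0_iff) auto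
    moreover have "a i = 0" if "i \<notin> I" using a that unfolding solutions_def by blast
    ultimately show "a i = 0" using assms(1) by (cases "i \<in> I") fastforce+
  qed
  show ?thesis
  proof (cases "J = {}")
    case True
    then have "(\<lambda>_. 0) \<in> solutions m I d u J 0" by (simp add: solutions_def)
    then have "solutions m I d u J 0 = {\<lambda>_. 0}" using z by blast
    then show ?thesis using True by simp
  next
    case False
    have "a \<notin> solutions m I d u J 0" for a
    proof
      assume a: "a \<in> solutions m I d u J 0"
      obtain i where "i \<in> J" using False by blast
      then have "a i \<noteq> 0" using a unfolding solutions_def by blast
      then show False using z[OF a] by simp
    qed
    then have "solutions m I d u J 0 = {}" by blast
    then show ?thesis using False by simp
  qed
qed

lemma signed_count_closed:
  fixes I :: "'i::finite set"
  assumes "\<forall>i\<in>I. d i > 0" "I \<noteq> {}"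
  shows "t > 0 \<Longrightarrow> signed_count m I d u {} t = real (card (solutions m I d u {} t))"
    and "t > 0 \<Longrightarrow> signed_count m I d u {} (- t) =
          - ((-1) ^ dim (kernel m I u)) * real (card (solutions m I d u I t))"
    and "signed_count m I d u {} 0 = 1"
  using assms by (simp_all add: signed_count_def solutions_neg_empty solutions_0)

text \<open>Let \<open>S\<close> consist of the coordinates that are positive on some nonnegative
  kernel element. Nonnegative solutions are supported on \<open>S\<close>, and the sum of the
  witnesses is positive on all of \<open>S\<close>, so reciprocity applies to \<open>S\<close>. Its
  kernel is a proper subspace because \<open>q1\<close> does not vanish at \<open>j0\<close>, hence
  the smaller degree; \<open>i0\<close> makes \<open>S\<close> nonempty, hence the value 1 at
  0.\<close>

lemma closed_solutions_qpoly:
  fixes I :: "'i::finite set"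
  assumes d: "\<forall>i\<in>I. d i > 0"
    and i0: "i0 \<in> I" "q0 \<in> kernel m I u" "\<forall>l. q0 $ l \<ge> 0" "q0 $ i0 > 0"
    and j0: "j0 \<in> I" "q1 \<in> kernel m I u" "q1 $ j0 \<noteq> 0"
      "\<And>q. q \<in> kernel m I u \<Longrightarrow> \<forall>l. q $ l \<ge> 0 \<Longrightarrow> q $ j0 = 0"
  shows "\<exists>N k Q. k < dim (kernel m I u) \<and> qpoly N k Q \<and>
    (\<forall>t>0. Q t = real (card (solutions m I d u {} t))) \<and> Q 0 = 1"
proof -
  define S where "S = {i\<in>I. \<exists>q\<in>kernel m I u. (\<forall>l. q $ l \<ge> 0) \<and> q $ i > 0}"
  have SI: "S \<subseteq> I" unfolding S_def by blast
  have S0: "i0 \<in> S" using i0 unfolding S_def by blast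
  have S1: "j0 \<notin> S"
  proof
    assume "j0 \<in> S"
    then obtain q where "q \<in> kernel m I u" "\<forall>l. q $ l \<ge> 0" "q $ j0 > 0" unfolding S_def by blast
    then show False using j0(4)[of q] by simp
  qed
  have sumS: "(\<Sum>i\<in>S. g i) = (\<Sum>i\<in>I. g i)" if "\<And>i. i \<in> I - S \<Longrightarrow> g i = 0" for g :: "'i \<Rightarrow> 'c::comm_monoid_add"
    using SI that by (intro sum.mono_neutral_left) auto
  have kerS: "kernel m S u = {q \<in> kernel m I u. \<forall>i. i \<notin> S \<longrightarrow> q $ i = 0}"
  proof (rule set_eqI)
    fix q :: "real^'i"
    show "q \<in> kernel m S u \<longleftrightarrow> q \<in> {q \<in> kernel m I u. \<forall>i. i \<notin> S \<longrightarrow> q $ i = 0}"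
    proof (cases "\<forall>i. i \<notin> S \<longrightarrow> q $ i = 0")
      case True
      then have "(\<Sum>i\<in>S. q $ i * of_int (u i k)) = (\<Sum>i\<in>I. q $ i * of_int (u i k))" for k
        by (intro sumS) auto
      then show ?thesis using True SI unfolding kernel_def by auto
    qed (auto simp: kernel_def)
  qed
  have nonneg_zero: "q $ i = 0" if "q \<in> kernel m I u" "\<forall>l. q $ l \<ge> 0" "i \<notin> S" for q i
  proof (cases "i \<in> I")
    case True
    then have "\<not> q $ i > 0" using that unfolding S_def by blast
    then show ?thesis using that(2)[rule_format, of i] by linarith
  qed (use that in \<open>auto simp: kernel_def\<close>)
  have "\<forall>i\<in>S. \<exists>q. q \<in> kernel m I u \<and> (\<forall>l. q $ l \<ge> 0) \<and> q $ i > 0" unfolding S_def by blast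
  then obtain r where r: "\<forall>i\<in>S. r i \<in> kernel m I u \<and> (\<forall>l. r i $ l \<ge> 0) \<and> r i $ i > 0"
    using bchoice[of S "\<lambda>i q. q \<in> kernel m I u \<and> (\<forall>l. q $ l \<ge> 0) \<and> q $ i > 0"] by blast
  define p where "p = (\<Sum>i\<in>S. r i)"
  have pI: "p \<in> kernel m I u" unfolding p_def using r by (intro subspace_sum subspace_kernel) auto
  have p0: "p $ l \<ge> 0" for l unfolding p_def sum_component using r by (intro sum_nonneg) auto
  have "p \<in> kernel m S u" unfolding kerS using pI nonneg_zero[OF pI] p0 by auto
  moreover have "\<forall>i\<in>S. p $ i > 0"
  proof
    fix i assume i: "i \<in> S"
    have "r i $ i \<le> p $ i" unfolding p_def sum_component using r i by (intro member_le_sum) auto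
    moreover have "r i $ i > 0" using r i by blast
    ultimately show "p $ i > 0" by linarith
  qed
  moreover have dS: "\<forall>i\<in>S. d i > 0" using d SI by auto
  ultimately obtain N where N: "qpoly N (dim (kernel m S u)) (signed_count m S d u {})"
    using reciprocalD[OF reciprocal[OF dS], of "{}" p m u] by (metis Diff_empty empty_iff empty_subsetI)
  have "kernel m S u \<subset> kernel m I u"
  proof -
    have "q1 \<notin> kernel m S u" unfolding kerS using j0(3) S1 by blast
    then show ?thesis using j0(2) unfolding kerS by blast
  qed
  then have less: "dim (kernel m S u) < dim (kernel m I u)"
    by (intro dim_psubset) (simp add: iffD2[OF span_eq_iff subspace_kernel])
  have sol: "solutions m I d u {} t = solutions m S d u {} t" for t
  proof (rule set_eqI)
    fix a
    show "a \<in> solutions m I d u {} t \<longleftrightarrow> a \<in> solutions m S d u {} t"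
    proof (cases "\<forall>i. i \<notin> S \<longrightarrow> a i = 0")
      case True
      then have "(\<Sum>i\<in>S. int (a i) * v i) = (\<Sum>i\<in>I. int (a i) * v i)" for v
        by (intro sumS) auto
      then show ?thesis using True SI unfolding solutions_def by auto
    next
      case False
      have "a \<notin> solutions m I d u {} t"
      proof
        assume "a \<in> solutions m I d u {} t"
        from nonneg_zero[OF solution_in_kernel[OF this]] have "\<forall>i. i \<notin> S \<longrightarrow> a i = 0" by simp
        then show False using False by blast
      qed
      then show ?thesis using False unfolding solutions_def by blast
    qed
  qed
  have "S \<noteq> {}" using S0 by auto
  then show ?thesis
    using less N signed_count_closed(1,3)[OF dS] unfolding sol
    by (intro exI[of _ N] exI[of _ "dim (kernel m S u)"] exI[of _ "signed_count m S d u {}"]) auto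
qed

subsection \<open>Order simplices of permutations\<close>

definition form_space :: "nat \<Rightarrow> (nat \<Rightarrow> 'n \<Rightarrow> int) \<Rightarrow> (real^'n) set" where
  "form_space m a = {x. \<forall>k<m. (\<Sum>i\<in>UNIV. of_int (a k i) * x $ i) = 0}"

lemma subspace_form_space: "subspace (form_space m a)"
proof -
  have [simp]: "(\<Sum>i\<in>UNIV. of_int (a k i) * (c * x $ i)) = c * (\<Sum>i\<in>UNIV. of_int (a k i) * x $ i)"
    for c k and x :: "real^'a"
    by (simp add: sum_distrib_left mult_ac)
  show ?thesis unfolding subspace_def form_space_def
    by (auto simp: distrib_left sum.distrib)
qed

text \<open>The order simplex \<open>0 \<le> x\<^bsub>\<sigma> 1\<^esub> \<le> \<dots> \<le> x\<^bsub>\<sigma> d\<^esub> \<le> t\<close> in the coordinates given by the consecutive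
  differences: \<open>y (Some l)\<close> is the step below \<open>x\<^bsub>\<sigma> l\<^esub>\<close> and \<open>y None\<close> the one from \<open>x\<^bsub>\<sigma> d\<^esub>\<close> to \<open>t\<close>.\<close>

definition chain_point ::
  "('n::{finite,linorder} \<Rightarrow> 'n) \<Rightarrow> ('n::{finite,linorder} option \<Rightarrow> real) \<Rightarrow> real^'n::{finite,linorder}" where
  "chain_point \<sigma> y = (\<chi> i. \<Sum>l\<in>{..inv \<sigma> i}. y (Some l))"

text \<open>The step \<open>Some l\<close> raises every coordinate \<open>x $ \<sigma> i\<close>
  with \<open>i \<ge> l\<close>, so its coefficient is a tail sum. The slack \<open>None\<close>
  raises none.\<close>

definition chain_forms ::
  "(nat \<Rightarrow> 'n::{finite,linorder} \<Rightarrow> int) \<Rightarrow> ('n \<Rightarrow> 'n) \<Rightarrow> 'n option \<Rightarrow> nat \<Rightarrow> int" where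
  "chain_forms a \<sigma> z k = (case z of None \<Rightarrow> 0 | Some l \<Rightarrow> \<Sum>i\<in>{l..}. a k (\<sigma> i))"

lemma sum_UNIV_option:
  "(\<Sum>z\<in>UNIV. g z) = g None + (\<Sum>l\<in>(UNIV::'n::finite set). g (Some l))"
  by (simp add: UNIV_option_conv sum.reindex)

lemma chain_point_apply:
  "\<sigma> permutes UNIV \<Longrightarrow> chain_point \<sigma> y $ \<sigma> l = (\<Sum>i\<in>{..l}. y (Some i))"
  by (simp add: chain_point_def permutes_inverses)

text \<open>The default 0 below the least index stands for the lower wall of the cube, so the first
  difference is the smallest coordinate itself.\<close>

definition pred_value :: "('n::{finite,linorder} \<Rightarrow> real) \<Rightarrow> 'n \<Rightarrow> real" where
  "pred_value X i = (if {..<i} = {} then 0 else X (Max {..<i}))"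

lemma lessThan_eq_atMost_Max:
  fixes i :: "'n::{finite,linorder}"
  assumes "{..<i} \<noteq> {}"
  shows "{..<i} = {..Max {..<i}}"
proof -
  have "Max {..<i} \<in> {..<i}" using assms by (intro Max_in) auto
  then show ?thesis by (auto intro: Max_ge le_less_trans)
qed

lemma sum_atMost_pred:
  fixes y :: "'n::{finite,linorder} \<Rightarrow> real"
  shows "y i = (\<Sum>l\<in>{..i}. y l) - pred_value (\<lambda>j. \<Sum>l\<in>{..j}. y l) i"
proof -
  have "(\<Sum>l\<in>{..i}. y l) = y i + (\<Sum>l\<in>{..<i}. y l)"
    by (simp flip: ivl_disj_un_singleton(2))
  moreover have "pred_value (\<lambda>j. \<Sum>l\<in>{..j}. y l) i = (\<Sum>l\<in>{..<i}. y l)"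
    using lessThan_eq_atMost_Max[of i] unfolding pred_value_def by auto
  ultimately show ?thesis by simp
qed

lemma sum_atMost_differences:
  fixes X :: "'n::{finite,linorder} \<Rightarrow> real"
  shows "(\<Sum>l\<in>{..i}. X l - pred_value X l) = X i"
proof (induction "card {..<i}" arbitrary: i rule: less_induct)
  case less
  have "(\<Sum>l\<in>{..i}. X l - pred_value X l) = X i - pred_value X i + (\<Sum>l\<in>{..<i}. X l - pred_value X l)"
    by (simp flip: ivl_disj_un_singleton(2))
  also have "(\<Sum>l\<in>{..<i}. X l - pred_value X l) = pred_value X i"
  proof (cases "{..<i} = {}")
    case False
    then have "Max {..<i} \<in> {..<i}" by (intro Max_in) auto
    then have "Max {..<i} < i" by simp
    then have "{..<Max {..<i}} \<subset> {..<i}" by auto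
    then have "card {..<Max {..<i}} < card {..<i}" by (intro psubset_card_mono) auto
    from less[OF this] show ?thesis
      using lessThan_eq_atMost_Max[OF False] False unfolding pred_value_def by simp
  qed (simp add: pred_value_def)
  finally show ?case by simp
qed

lemma chain_coordinates:
  assumes "\<sigma> permutes UNIV"
  shows "y (Some l) = chain_point \<sigma> y $ \<sigma> l - pred_value (\<lambda>j. chain_point \<sigma> y $ \<sigma> j) l"
    and "y None = (\<Sum>z\<in>UNIV. y z) - chain_point \<sigma> y $ \<sigma> (Max UNIV)"
proof -
  show "y (Some l) = chain_point \<sigma> y $ \<sigma> l - pred_value (\<lambda>j. chain_point \<sigma> y $ \<sigma> j) l"
    unfolding chain_point_apply[OF assms] using sum_atMost_pred[of "\<lambda>l. y (Some l)" l] .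
  have "{..Max UNIV} = (UNIV :: 'a set)" by (auto intro: Max_ge)
  then show "y None = (\<Sum>z\<in>UNIV. y z) - chain_point \<sigma> y $ \<sigma> (Max UNIV)"
    unfolding chain_point_apply[OF assms] sum_UNIV_option by simp
qed

lemma chain_point_surj:
  assumes "\<sigma> permutes UNIV"
  obtains y where "chain_point \<sigma> y = x" "(\<Sum>z\<in>UNIV. y z) = t"
proof -
  define X where "X l = x $ \<sigma> l" for l
  define y where "y z = (case z of Some l \<Rightarrow> X l - pred_value X l
      | None \<Rightarrow> t - (\<Sum>l\<in>UNIV. X l - pred_value X l))" for z
  have "chain_point \<sigma> y $ \<sigma> l = x $ \<sigma> l" for l
    unfolding chain_point_apply[OF assms] y_def using sum_atMost_differences[of X l] by (simp add: X_def)
  then have "chain_point \<sigma> y = x" unfolding vec_eq_iff by (metis assms permutes_inverses(1))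
  moreover have "(\<Sum>z\<in>UNIV. y z) = t" unfolding sum_UNIV_option y_def by simp
  ultimately show ?thesis using that by blast
qed

lemma chain_point_inj:
  assumes "\<sigma> permutes UNIV" "chain_point \<sigma> y = chain_point \<sigma> y'" "(\<Sum>z\<in>UNIV. y z) = (\<Sum>z\<in>UNIV. y' z)"
  shows "y = y'"
proof
  fix z show "y z = y' z"
    using chain_coordinates[OF assms(1), of y] chain_coordinates[OF assms(1), of y'] assms(2,3)
    by (cases z) metis+
qed

text \<open>Summation by parts: the step \<open>Some l\<close> occurs in
  \<open>x $ \<sigma> i\<close> exactly when \<open>l \<le> i\<close>.\<close>

lemma chain_point_in_form_space_iff:
  assumes "\<sigma> permutes UNIV"
  shows "chain_point \<sigma> y \<in> form_space m a \<longleftrightarrow>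
    (\<forall>k<m. (\<Sum>z\<in>UNIV. y z * of_int (chain_forms a \<sigma> z k)) = 0)"
proof -
  have "(\<Sum>z\<in>UNIV. y z * of_int (chain_forms a \<sigma> z k)) = (\<Sum>i\<in>UNIV. of_int (a k i) * chain_point \<sigma> y $ i)" for k
  proof -
    have "(\<Sum>z\<in>UNIV. y z * of_int (chain_forms a \<sigma> z k)) =
        (\<Sum>l\<in>UNIV. \<Sum>i\<in>{l..}. y (Some l) * of_int (a k (\<sigma> i)))"
      by (simp add: sum_UNIV_option chain_forms_def sum_distrib_left)
    also have "\<dots> = (\<Sum>l\<in>UNIV. \<Sum>i\<in>UNIV. if l \<le> i then y (Some l) * of_int (a k (\<sigma> i)) else 0)"
      by (intro sum.cong refl sum.mono_neutral_cong_left) auto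
    also have "\<dots> = (\<Sum>i\<in>UNIV. \<Sum>l\<in>UNIV. if l \<le> i then y (Some l) * of_int (a k (\<sigma> i)) else 0)"
      by (rule sum.swap)
    also have "\<dots> = (\<Sum>i\<in>UNIV. \<Sum>l\<in>{..i}. y (Some l) * of_int (a k (\<sigma> i)))"
      by (intro sum.cong refl sum.mono_neutral_cong_right) auto
    also have "\<dots> = (\<Sum>i\<in>UNIV. of_int (a k (\<sigma> i)) * chain_point \<sigma> y $ \<sigma> i)"
      unfolding chain_point_apply[OF assms] by (simp add: sum_distrib_left mult.commute)
    also have "\<dots> = (\<Sum>i\<in>UNIV. of_int (a k i) * chain_point \<sigma> y $ i)"
      using sum.reindex_bij_betw[OF permutes_imp_bij[OF assms], of "\<lambda>i. of_int (a k i) * chain_point \<sigma> y $ i"] .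
    finally show ?thesis .
  qed
  then show ?thesis unfolding form_space_def by simp
qed

lemma Max_lessThan_less:
  fixes l :: "'n::{finite,linorder}"
  assumes "{..<l} \<noteq> {}"
  shows "Max {..<l} < l"
proof -
  have "Max {..<l} \<in> {..<l}" using assms by (intro Max_in) auto
  then show ?thesis by simp
qed

lemma sum_option_ge:
  fixes y :: "'n::{finite,linorder} option \<Rightarrow> real"
  assumes "\<forall>z. y z \<ge> 0"
  shows "(\<Sum>i\<in>{..l}. y (Some i)) + y None \<le> (\<Sum>z\<in>UNIV. y z)"
  unfolding sum_UNIV_option using assms sum_mono2[of UNIV "{..l}" "\<lambda>i. y (Some i)"] by simp

lemma chain_nonneg_iff:
  assumes \<sigma>: "\<sigma> permutes UNIV"
  shows "(\<forall>z. y z \<ge> 0) \<longleftrightarrow> compatible (chain_point \<sigma> y) \<sigma> \<and>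
    (\<forall>i. 0 \<le> chain_point \<sigma> y $ i \<and> chain_point \<sigma> y $ i \<le> (\<Sum>z\<in>UNIV. y z))" (is "?L \<longleftrightarrow> ?R")
proof
  assume y: ?L
  have "mono (\<lambda>l. chain_point \<sigma> y $ \<sigma> l)"
    unfolding chain_point_apply[OF \<sigma>] using y by (intro monoI sum_mono2) auto
  moreover have "0 \<le> chain_point \<sigma> y $ \<sigma> l \<and> chain_point \<sigma> y $ \<sigma> l \<le> (\<Sum>z\<in>UNIV. y z)" for l
    unfolding chain_point_apply[OF \<sigma>] using y sum_option_ge[OF y, of l]
    by (auto intro: sum_nonneg dest: spec[of _ None])
  ultimately show ?R unfolding compatible_def by (metis permutes_inverses(1)[OF \<sigma>])
next
  assume R: ?R
  let ?X = "\<lambda>l. chain_point \<sigma> y $ \<sigma> l"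
  have "y (Some l) \<ge> 0" for l
  proof (cases "{..<l} = {}")
    case True
    then show ?thesis using chain_coordinates(1)[OF \<sigma>, of y l] R by (simp add: pred_value_def)
  next
    case False
    have "?X (Max {..<l}) \<le> ?X l"
      using R Max_lessThan_less[OF False] monoD[of ?X "Max {..<l}" l] unfolding compatible_def by auto
    then show ?thesis using chain_coordinates(1)[OF \<sigma>, of y l] False by (simp add: pred_value_def)
  qed
  moreover have "y None \<ge> 0" using chain_coordinates(2)[OF \<sigma>, of y] R by simp
  ultimately show ?L by (metis not_None_eq)
qed

lemma chain_pos_iff:
  assumes \<sigma>: "\<sigma> permutes UNIV"
  shows "(\<forall>z. y z > 0) \<longleftrightarrow> realizes (chain_point \<sigma> y) \<sigma> \<and>
    (\<forall>i. 0 < chain_point \<sigma> y $ i \<and> chain_point \<sigma> y $ i < (\<Sum>z\<in>UNIV. y z))" (is "?L \<longleftrightarrow> ?R")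
proof
  assume y: ?L
  then have y0: "\<forall>z. y z \<ge> 0" by (auto intro: less_imp_le)
  have "strict_mono (\<lambda>l. chain_point \<sigma> y $ \<sigma> l)"
    unfolding chain_point_apply[OF \<sigma>]
  proof (rule strict_monoI)
    fix i j :: 'a assume ij: "i < j"
    show "(\<Sum>l\<in>{..i}. y (Some l)) < (\<Sum>l\<in>{..j}. y (Some l))"
      using y y0 ij by (intro sum_strict_mono2[of _ _ j]) auto
  qed
  moreover have "0 < chain_point \<sigma> y $ \<sigma> l \<and> chain_point \<sigma> y $ \<sigma> l < (\<Sum>z\<in>UNIV. y z)" for l
  proof -
    have "0 < (\<Sum>i\<in>{..l}. y (Some i))" using y by (intro sum_pos) auto
    moreover have "y None > 0" using y by blast
    ultimately show ?thesis unfolding chain_point_apply[OF \<sigma>] using sum_option_ge[OF y0, of l] by linarith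
  qed
  ultimately show ?R unfolding realizes_def by (metis permutes_inverses(1)[OF \<sigma>])
next
  assume R: ?R
  let ?X = "\<lambda>l. chain_point \<sigma> y $ \<sigma> l"
  have "y (Some l) > 0" for l
  proof (cases "{..<l} = {}")
    case True
    then show ?thesis using chain_coordinates(1)[OF \<sigma>, of y l] R by (simp add: pred_value_def)
  next
    case False
    have "?X (Max {..<l}) < ?X l"
      using R Max_lessThan_less[OF False] unfolding realizes_def by (auto dest: strict_monoD)
    then show ?thesis using chain_coordinates(1)[OF \<sigma>, of y l] False by (simp add: pred_value_def)
  qed
  moreover have "y None > 0" using chain_coordinates(2)[OF \<sigma>, of y] R by simp
  ultimately show ?L by (metis not_None_eq)
qed

lemma kernel_chain_forms:
  assumes "\<sigma> permutes UNIV"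
  shows "q \<in> kernel m UNIV (chain_forms a \<sigma>) \<longleftrightarrow> chain_point \<sigma> (($) q) \<in> form_space m a"
  unfolding chain_point_in_form_space_iff[OF assms] kernel_def by simp

text \<open>The steps determine, and are determined by, a point of \<open>s\<close> together with
  the total \<open>t\<close>. The total is unconstrained, which adds one dimension.\<close>

lemma dim_kernel_chain_forms:
  fixes a :: "nat \<Rightarrow> 'n::{finite,linorder} \<Rightarrow> int"
  assumes \<sigma>: "\<sigma> permutes UNIV"
  shows "dim (kernel m UNIV (chain_forms a \<sigma>)) = Suc (dim (form_space m a))"
proof -
  let ?h = "\<lambda>q::real^('n option). (chain_point \<sigma> (($) q), \<Sum>z\<in>UNIV. q $ z)"
  have img: "?h ` kernel m UNIV (chain_forms a \<sigma>) = form_space m a \<times> UNIV"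
  proof
    show "?h ` kernel m UNIV (chain_forms a \<sigma>) \<subseteq> form_space m a \<times> UNIV"
      using kernel_chain_forms[OF \<sigma>] by blast
    show "form_space m a \<times> UNIV \<subseteq> ?h ` kernel m UNIV (chain_forms a \<sigma>)"
    proof
      fix xt :: "(real^'n::{finite,linorder}) \<times> real" assume xt: "xt \<in> form_space m a \<times> UNIV"
      obtain y where y: "chain_point \<sigma> y = fst xt" "(\<Sum>z\<in>UNIV. y z) = snd xt"
        using chain_point_surj[OF \<sigma>] by blast
      have eq: "($) (\<chi> z. y z) = y" by auto
      have "(\<chi> z. y z) \<in> kernel m UNIV (chain_forms a \<sigma>)"
        unfolding kernel_chain_forms[OF \<sigma>] eq using y xt by auto
      moreover have "xt = ?h (\<chi> z. y z)" unfolding eq using y by (simp add: prod_eq_iff)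
      ultimately show "xt \<in> ?h ` kernel m UNIV (chain_forms a \<sigma>)" by blast
    qed
  qed
  have lin: "linear ?h"
    by (rule linearI)
      (auto simp: chain_point_def vec_eq_iff sum.distrib sum_distrib_left)
  have inj: "inj ?h"
  proof (rule injI)
    fix q r assume "?h q = ?h r"
    then have "($) q = ($) r" by (intro chain_point_inj[OF \<sigma>]) auto
    then show "q = r" by (simp add: vec_eq_iff)
  qed
  have "dim (kernel m UNIV (chain_forms a \<sigma>)) = dim (form_space m a \<times> (UNIV::real set))"
    unfolding img[symmetric] by (rule dim_image_eq[OF lin inj_on_subset[OF inj subset_UNIV], symmetric])
  also have "\<dots> = Suc (dim (form_space m a))"
    using dim_Times[OF subspace_form_space[of m a] subspace_UNIV[where 'a=real]] by simp
  finally show ?thesis .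
qed

lemma Ints_differences:
  assumes "\<And>l. X l \<in> \<int>"
  shows "X l - pred_value X l \<in> \<int>"
  using assms by (auto simp: pred_value_def)

text \<open>All generators have degree 1, so the degree of a solution is the sum of all steps
  including the slack, that is, \<open>t\<close>. Differences of integers are integers, so integer
  points have integer steps.\<close>

lemma bij_betw_chain_solutions:
  fixes a :: "nat \<Rightarrow> 'n::{finite,linorder} \<Rightarrow> int"
  assumes \<sigma>: "\<sigma> permutes UNIV"
  shows "bij_betw (\<lambda>b. chain_point \<sigma> (\<lambda>z. real (b z)))
    (solutions m UNIV (\<lambda>_. 1) (chain_forms a \<sigma>) {} (int t))
    {x \<in> int_lattice \<inter> form_space m a. compatible x \<sigma> \<and> (\<forall>i. 0 \<le> x $ i \<and> x $ i \<le> real t)}"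
  (is "bij_betw ?f ?S ?T")
proof -
  have sol: "b \<in> ?S \<longleftrightarrow> ?f b \<in> form_space m a \<and> (\<Sum>z\<in>UNIV. real (b z)) = real t" for b
  proof -
    have "(\<Sum>z\<in>UNIV. real (b z) * of_int (chain_forms a \<sigma> z k)) =
        of_int (\<Sum>z\<in>UNIV. int (b z) * chain_forms a \<sigma> z k)" for k by simp
    moreover have "(\<Sum>z\<in>UNIV. real (b z)) = of_int (\<Sum>z\<in>UNIV. int (b z) * int 1)" by simp
    ultimately show ?thesis
      unfolding solutions_def chain_point_in_form_space_iff[OF \<sigma>]
      by (simp only: of_int_eq_0_iff) (simp flip: of_nat_sum)
  qed
  have "inj_on ?f ?S"
  proof (rule inj_onI)
    fix b c assume bc: "b \<in> ?S" "c \<in> ?S" "?f b = ?f c"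
    have "(\<lambda>z. real (b z)) = (\<lambda>z. real (c z))"
      using bc sol by (intro chain_point_inj[OF \<sigma>]) auto
    then show "b = c" by (metis of_nat_eq_iff ext)
  qed
  moreover have "?f ` ?S = ?T"
  proof
    show "?f ` ?S \<subseteq> ?T"
    proof (rule image_subsetI)
      fix b assume b: "b \<in> ?S"
      have "?f b \<in> int_lattice" unfolding int_lattice_def chain_point_def by (auto intro: Ints_sum)
      moreover have "compatible (?f b) \<sigma> \<and> (\<forall>i. 0 \<le> ?f b $ i \<and> ?f b $ i \<le> (\<Sum>z\<in>UNIV. real (b z)))"
        using chain_nonneg_iff[OF \<sigma>, of "\<lambda>z. real (b z)"] by auto
      ultimately show "?f b \<in> ?T" using b sol by auto
    qed
    show "?T \<subseteq> ?f ` ?S"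
    proof
      fix x assume x: "x \<in> ?T"
      obtain y where y: "chain_point \<sigma> y = x" "(\<Sum>z\<in>UNIV. y z) = real t"
        using chain_point_surj[OF \<sigma>] by blast
      have nonneg: "y z \<ge> 0" for z using chain_nonneg_iff[OF \<sigma>, of y] x y by auto
      have int: "x $ i \<in> \<int>" for i using x by (auto simp: int_lattice_def)
      have ints: "y z \<in> \<int>" for z
      proof (cases z)
        case None
        then show ?thesis using chain_coordinates(2)[OF \<sigma>, of y] y int by simp
      next
        case (Some l)
        then show ?thesis using chain_coordinates(1)[OF \<sigma>, of y l] y int Ints_differences[of "\<lambda>j. x $ \<sigma> j" l]
          by simp
      qed
      define b where "b z = nat \<lfloor>y z\<rfloor>" for z
      have by_eq: "(\<lambda>z. real (b z)) = y"
        using nonneg ints unfolding b_def by (auto elim!: Ints_cases)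
      then have "?f b = x" using y by simp
      moreover have "b \<in> ?S" unfolding sol by_eq using x y by auto
      ultimately show "x \<in> ?f ` ?S" by blast
    qed
  qed
  ultimately show ?thesis unfolding bij_betw_def by blast
qed

lemma card_chain_solutions_closed:
  fixes a :: "nat \<Rightarrow> 'n::{finite,linorder} \<Rightarrow> int"
  assumes \<sigma>: "\<sigma> permutes UNIV"
  shows "card {x \<in> int_lattice \<inter> form_space m a. compatible x \<sigma> \<and> (\<forall>i. 0 \<le> x $ i \<and> x $ i \<le> real t)} =
    card (solutions m UNIV (\<lambda>_. 1) (chain_forms a \<sigma>) {} (int t))"
  using bij_betw_same_card[OF bij_betw_chain_solutions[OF \<sigma>]] by metis

lemma card_chain_solutions_open:
  fixes a :: "nat \<Rightarrow> 'n::{finite,linorder} \<Rightarrow> int"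
  assumes \<sigma>: "\<sigma> permutes UNIV"
  shows "card {x \<in> int_lattice \<inter> form_space m a. realizes x \<sigma> \<and> (\<forall>i. 0 < x $ i \<and> x $ i < real t)} =
    card (solutions m UNIV (\<lambda>_. 1) (chain_forms a \<sigma>) UNIV (int t))"
proof -
  let ?f = "\<lambda>b. chain_point \<sigma> (\<lambda>z. real (b z))"
  let ?S = "solutions m UNIV (\<lambda>_. 1) (chain_forms a \<sigma>) {} (int t)"
  let ?S' = "solutions m UNIV (\<lambda>_. 1) (chain_forms a \<sigma>) UNIV (int t)"
  let ?T = "{x \<in> int_lattice \<inter> form_space m a. compatible x \<sigma> \<and> (\<forall>i. 0 \<le> x $ i \<and> x $ i \<le> real t)}"
  let ?T' = "{x \<in> int_lattice \<inter> form_space m a. realizes x \<sigma> \<and> (\<forall>i. 0 < x $ i \<and> x $ i < real t)}"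
  have bij: "bij_betw ?f ?S ?T" by (rule bij_betw_chain_solutions[OF \<sigma>])
  have SS: "?S' = {b \<in> ?S. \<forall>z. b z \<noteq> 0}" unfolding solutions_def by auto
  have TT: "?T' \<subseteq> ?T" unfolding realizes_def compatible_def
    by (auto intro: less_imp_le strict_mono_mono)
  have iff: "(\<forall>z. b z \<noteq> 0) \<longleftrightarrow> ?f b \<in> ?T'" if b: "b \<in> ?S" for b
  proof -
    have "?f b \<in> ?T" using bij b by (auto simp: bij_betw_def)
    moreover have "(\<Sum>z\<in>UNIV. real (b z)) = real t"
    proof -
      have "(\<Sum>z\<in>UNIV. int (b z)) = int t" using b unfolding solutions_def by simp
      then have "(\<Sum>z\<in>UNIV. b z) = t" by (simp flip: of_nat_sum)
      then show ?thesis by (simp flip: of_nat_sum)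
    qed
    ultimately show ?thesis using chain_pos_iff[OF \<sigma>, of "\<lambda>z. real (b z)"] by simp
  qed
  have img: "?f ` ?S' = ?T'"
  proof
    show "?f ` ?S' \<subseteq> ?T'"
    proof (rule image_subsetI)
      fix b assume "b \<in> ?S'"
      then have "b \<in> ?S" "\<forall>z. b z \<noteq> 0" unfolding SS by auto
      then show "?f b \<in> ?T'" by (simp only: iff)
    qed
    show "?T' \<subseteq> ?f ` ?S'"
    proof
      fix x assume x: "x \<in> ?T'"
      then have "x \<in> ?f ` ?S" using TT bij unfolding bij_betw_def by blast
      then obtain b where b: "b \<in> ?S" "x = ?f b" by blast
      then have "\<forall>z. b z \<noteq> 0" using x by (simp only: iff[OF b(1)])
      then have "b \<in> ?S'" unfolding SS using b(1) by blast
      then show "x \<in> ?f ` ?S'" unfolding b(2) by (rule imageI)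
    qed
  qed
  have "inj_on ?f ?S'"
    by (rule inj_on_subset[OF bij_betw_imp_inj_on[OF bij]]) (use SS in blast)
  from card_image[OF this] show ?thesis unfolding img .
qed

section \<open>The permutation realized by a point\<close>

lemma rank_less_iff:
  fixes x :: "'n::finite \<Rightarrow> 'b::linorder"
  shows "card {l. x l < x i} < card {l. x l < x j} \<longleftrightarrow> x i < x j"
proof
  assume "x i < x j"
  then have "{l. x l < x i} \<subset> {l. x l < x j}" by (auto intro: less_trans)
  then show "card {l. x l < x i} < card {l. x l < x j}" by (intro psubset_card_mono) auto
next
  assume less: "card {l. x l < x i} < card {l. x l < x j}"
  show "x i < x j"
  proof (rule ccontr)
    assume "\<not> x i < x j"
    then have "{l. x l < x j} \<subseteq> {l. x l < x i}" by auto
    then have "card {l. x l < x j} \<le> card {l. x l < x i}" by (intro card_mono) auto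
    then show False using less by simp
  qed
qed

lemma bij_betw_rank:
  fixes x :: "'n::finite \<Rightarrow> 'b::linorder"
  assumes "inj x"
  shows "bij_betw (\<lambda>i. card {l. x l < x i}) UNIV {..<CARD('n)}"
proof -
  have inj: "inj (\<lambda>i. card {l. x l < x i})"
  proof (rule injI)
    fix i j assume "card {l. x l < x i} = card {l. x l < x j}"
    then have "\<not> x i < x j" "\<not> x j < x i"
      using rank_less_iff[of x i j] rank_less_iff[of x j i] by simp_all
    then show "i = j" using assms by (meson injD linorder_less_linear)
  qed
  have "card {l. x l < x i} < CARD('n)" for i
    by (intro psubset_card_mono) auto
  then have "(\<lambda>i. card {l. x l < x i}) ` UNIV \<subseteq> {..<CARD('n)}" by auto
  then have "(\<lambda>i. card {l. x l < x i}) ` UNIV = {..<CARD('n)}"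
    using card_image[OF inj] by (intro card_subset_eq) auto
  then show ?thesis using inj by (simp add: bij_betw_def)
qed

text \<open>Sorting by rank: \<open>\<sigma>\<close> sends \<open>i\<close> to the coordinate whose
  rank in \<open>x\<close> equals the rank of \<open>i\<close> among the indices.\<close>

lemma ex_realized_perm:
  fixes x :: "real^'n::{finite,linorder}"
  assumes "inj (\<lambda>i. x $ i)"
  shows "\<exists>\<sigma>. \<sigma> permutes UNIV \<and> realizes x \<sigma>"
proof -
  let ?r = "\<lambda>i. card {l. x $ l < x $ i}" and ?o = "\<lambda>i::'n. card {l. l < i}"
  have br: "bij_betw ?r UNIV {..<CARD('n)}" by (rule bij_betw_rank[OF assms])
  have bo: "bij_betw ?o UNIV {..<CARD('n)}" using bij_betw_rank[of "\<lambda>i::'n. i"] by simp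
  define \<sigma> where "\<sigma> = inv_into UNIV ?r \<circ> ?o"
  have "bij \<sigma>" unfolding \<sigma>_def by (rule bij_betw_trans[OF bo bij_betw_inv_into[OF br]])
  then have "\<sigma> permutes UNIV" by (intro bij_imp_permutes) auto
  moreover have r\<sigma>: "?r (\<sigma> i) = ?o i" for i
  proof -
    have "?o i \<in> range ?r" using bij_betw_apply[OF bo, of i] br by (simp add: bij_betw_def)
    then show ?thesis unfolding \<sigma>_def o_def by (rule f_inv_into_f)
  qed
  have "x $ \<sigma> i < x $ \<sigma> j" if "i < j" for i j
  proof -
    have "?o i < ?o j" using rank_less_iff[of "\<lambda>i::'n. i" i j] that by simp
    then show ?thesis unfolding r\<sigma>[symmetric] rank_less_iff .
  qed
  then have "realizes x \<sigma>" unfolding realizes_def by (rule strict_monoI)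
  ultimately show ?thesis by blast
qed

text \<open>Whichever permutation realizes \<open>x\<close>, the coordinate in position
  \<open>i\<close> has as many smaller coordinates as there are indices below
  \<open>i\<close>.\<close>

lemma realized_perm_unique:
  fixes x :: "real^'n::{finite,linorder}"
  assumes "\<sigma> permutes UNIV" "realizes x \<sigma>" "\<tau> permutes UNIV" "realizes x \<tau>"
  shows "\<sigma> = \<tau>"
proof
  fix i
  have rank: "card {l. x $ l < x $ \<rho> i} = card {..<i}" if \<rho>: "\<rho> permutes UNIV" "realizes x \<rho>" for \<rho>
  proof -
    have mono: "strict_mono (\<lambda>i. x $ \<rho> i)" using \<rho>(2) by (simp add: realizes_def)
    have "{l. x $ l < x $ \<rho> i} = \<rho> ` {..<i}"
    proof (intro set_eqI iffI)
      fix l assume "l \<in> {l. x $ l < x $ \<rho> i}"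
      moreover obtain k where k: "l = \<rho> k" using permutes_surj[OF \<rho>(1)] by (metis surjD)
      ultimately show "l \<in> \<rho> ` {..<i}" using strict_mono_less[OF mono] by auto
    qed (use strict_mono_less[OF mono] in auto)
    then show ?thesis using permutes_inj[OF \<rho>(1)] by (simp add: card_image inj_on_subset)
  qed
  have "card {l. x $ l < x $ \<sigma> i} = card {l. x $ l < x $ \<tau> i}"
    using rank[OF assms(1,2)] rank[OF assms(3,4)] by simp
  then have "\<not> x $ \<sigma> i < x $ \<tau> i" "\<not> x $ \<tau> i < x $ \<sigma> i"
    using rank_less_iff[of "($) x" "\<sigma> i" "\<tau> i"] rank_less_iff[of "($) x" "\<tau> i" "\<sigma> i"] by simp_all
  then have eq: "x $ \<sigma> i = x $ \<tau> i" by simp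
  obtain k where k: "\<tau> i = \<sigma> k" using permutes_surj[OF assms(1)] by (metis surjD)
  have "i = k" using eq k assms(2) strict_mono_eq[of "\<lambda>i. x $ \<sigma> i" i k] unfolding realizes_def by simp
  then show "\<sigma> i = \<tau> i" using k by simp
qed

lemma realizes_imp_inj:
  assumes "\<sigma> permutes UNIV" "realizes x \<sigma>"
  shows "inj (\<lambda>i. x $ i)"
proof (rule injI)
  fix i j assume eq: "x $ i = x $ j"
  obtain k l where kl: "i = \<sigma> k" "j = \<sigma> l" using permutes_surj[OF assms(1)] by (metis surjD)
  then have "k = l" using eq assms(2) strict_mono_eq[of "\<lambda>i. x $ \<sigma> i" k l] unfolding realizes_def by simp
  then show "i = j" using kl by simp
qed

section \<open>The counting functions as sums over permutations\<close>

lemma finite_int_lattice_box: "finite {x \<in> int_lattice :: (real^'n) set. \<forall>i. 0 \<le> x $ i \<and> x $ i \<le> real t}"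
proof (rule finite_subset)
  show "{x \<in> int_lattice :: (real^'n) set. \<forall>i. 0 \<le> x $ i \<and> x $ i \<le> real t} \<subseteq>
    (\<lambda>f. \<chi> i. real_of_int (f i)) ` PiE UNIV (\<lambda>_. {0..int t})"
  proof
    fix x :: "real^'n" assume x: "x \<in> {x \<in> int_lattice. \<forall>i. 0 \<le> x $ i \<and> x $ i \<le> real t}"
    define f where "f i = \<lfloor>x $ i\<rfloor>" for i
    have f: "real_of_int (f i) = x $ i" for i
      using x unfolding f_def int_lattice_def by (auto elim: Ints_cases)
    have "0 \<le> f i \<and> f i \<le> int t" for i
    proof -
      have "0 \<le> real_of_int (f i)" "real_of_int (f i) \<le> real_of_int (int t)" using x unfolding f by auto
      then show ?thesis by (simp only: of_int_le_iff of_int_0_le_iff)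
    qed
    then have "f \<in> PiE UNIV (\<lambda>_. {0..int t})" by auto
    moreover have "x = (\<chi> i. real_of_int (f i))" using f by (simp add: vec_eq_iff)
    ultimately show "x \<in> (\<lambda>f. \<chi> i. real_of_int (f i)) ` PiE UNIV (\<lambda>_. {0..int t})" by blast
  qed
  show "finite ((\<lambda>f. \<chi> i. real_of_int (f i)) ` (PiE UNIV (\<lambda>_. {0..int t}) :: ('n \<Rightarrow> int) set) :: (real^'n) set)"
    by (intro finite_imageI finite_PiE) auto
qed

lemma closed_count_eq_sum:
  fixes s A :: "(real^'n::{finite,linorder}) set"
  shows "closed_count A s t = (\<Sum>\<sigma>\<in>realizable_perms A.
    card {x \<in> int_lattice \<inter> s. compatible x \<sigma> \<and> (\<forall>i. 0 \<le> x $ i \<and> x $ i \<le> real t)})"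
proof -
  let ?X = "\<lambda>\<sigma>. {x \<in> int_lattice \<inter> s. compatible x \<sigma> \<and> (\<forall>i. 0 \<le> x $ i \<and> x $ i \<le> real t)}"
  have "{(x, \<sigma>). x \<in> int_lattice \<inter> s \<and> (\<forall>i. 0 \<le> x $ i \<and> x $ i \<le> real t) \<and>
      \<sigma> \<in> realizable_perms A \<and> compatible x \<sigma>} = prod.swap ` (SIGMA \<sigma>:realizable_perms A. ?X \<sigma>)" (is "?L = ?R")
  proof (rule set_eqI)
    fix z :: "(real^'n::{finite,linorder}) \<times> ('n \<Rightarrow> 'n)"
    obtain x \<sigma> where z: "z = (x, \<sigma>)" by (cases z)
    show "z \<in> ?L \<longleftrightarrow> z \<in> ?R"
      unfolding z by (simp only: pair_in_swap_image mem_Sigma_iff mem_Collect_eq prod.case) blast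
  qed
  then have "closed_count A s t = card (prod.swap ` (SIGMA \<sigma>:realizable_perms A. ?X \<sigma>))"
    unfolding closed_count_def by (rule arg_cong)
  also have "\<dots> = card (SIGMA \<sigma>:realizable_perms A. ?X \<sigma>)"
    by (intro card_image inj_swap)
  also have "\<dots> = (\<Sum>\<sigma>\<in>realizable_perms A. card (?X \<sigma>))"
  proof (rule card_SigmaI)
    show "\<forall>\<sigma>\<in>realizable_perms A. finite (?X \<sigma>)"
    proof
      fix \<sigma> :: "'n \<Rightarrow> 'n"
      have "?X \<sigma> \<subseteq> {x \<in> int_lattice. \<forall>i. 0 \<le> x $ i \<and> x $ i \<le> real t}" by blast
      then show "finite (?X \<sigma>)" by (rule finite_subset[OF _ finite_int_lattice_box])
    qed
  qed simp
  finally show ?thesis .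
qed

text \<open>A point of the open count, divided by \<open>t\<close>, lies in \<open>P\<close> and
  realizes the same permutation. So only permutations realizable in \<open>P\<close> occur, even
  though \<open>s\<close> may realize more.\<close>

lemma open_count_eq_sum:
  fixes s P :: "(real^'n::{finite,linorder}) set"
  assumes s: "subspace s" and P: "P = {x. \<forall>i. 0 \<le> x $ i \<and> x $ i \<le> 1} \<inter> s" and t: "t \<ge> 1"
  shows "open_count s t = (\<Sum>\<sigma>\<in>realizable_perms P.
    card {x \<in> int_lattice \<inter> s. realizes x \<sigma> \<and> (\<forall>i. 0 < x $ i \<and> x $ i < real t)})"
proof -
  let ?X = "\<lambda>\<sigma>. {x \<in> int_lattice \<inter> s. realizes x \<sigma> \<and> (\<forall>i. 0 < x $ i \<and> x $ i < real t)}"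
  let ?U = "{x \<in> int_lattice \<inter> s. inj (\<lambda>i. x $ i) \<and> (\<forall>i. 0 < x $ i \<and> x $ i < real t)}"
  have "?U = (\<Union>\<sigma>\<in>realizable_perms P. ?X \<sigma>)"
  proof (rule subset_antisym)
    show "?U \<subseteq> (\<Union>\<sigma>\<in>realizable_perms P. ?X \<sigma>)"
    proof
      fix x assume x: "x \<in> ?U"
      obtain \<sigma> where \<sigma>: "\<sigma> permutes UNIV" "realizes x \<sigma>" using ex_realized_perm[of x] x by auto
      have "(1 / real t) *\<^sub>R x \<in> P"
        unfolding P using x t subspace_scale[OF s] by (auto simp: field_simps intro: less_imp_le)
      moreover have "realizes ((1 / real t) *\<^sub>R x) \<sigma>"
        using \<sigma>(2) t unfolding realizes_def strict_mono_def by (simp add: divide_strict_right_mono)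
      ultimately have "\<sigma> \<in> realizable_perms P" using \<sigma>(1) unfolding realizable_perms_def by blast
      then show "x \<in> (\<Union>\<sigma>\<in>realizable_perms P. ?X \<sigma>)" using x \<sigma> by blast
    qed
    show "(\<Union>\<sigma>\<in>realizable_perms P. ?X \<sigma>) \<subseteq> ?U"
    proof
      fix x assume "x \<in> (\<Union>\<sigma>\<in>realizable_perms P. ?X \<sigma>)"
      then obtain \<sigma> where \<sigma>: "\<sigma> \<in> realizable_perms P" "x \<in> ?X \<sigma>" by blast
      then have "inj (\<lambda>i. x $ i)" unfolding realizable_perms_def by (intro realizes_imp_inj[of \<sigma>]) auto
      then show "x \<in> ?U" using \<sigma>(2) by auto
    qed
  qed
  then have "open_count s t = card (\<Union>\<sigma>\<in>realizable_perms P. ?X \<sigma>)"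
    unfolding open_count_def by (rule arg_cong)
  also have "\<dots> = (\<Sum>\<sigma>\<in>realizable_perms P. card (?X \<sigma>))"
  proof (rule card_UN_disjoint)
    show "\<forall>\<sigma>\<in>realizable_perms P. finite (?X \<sigma>)"
    proof
      fix \<sigma> :: "'n \<Rightarrow> 'n"
      have "?X \<sigma> \<subseteq> {x \<in> int_lattice. \<forall>i. 0 \<le> x $ i \<and> x $ i \<le> real t}" by (auto intro: less_imp_le)
      then show "finite (?X \<sigma>)" by (rule finite_subset[OF _ finite_int_lattice_box])
    qed
    show "\<forall>\<sigma>\<in>realizable_perms P. \<forall>\<tau>\<in>realizable_perms P. \<sigma> \<noteq> \<tau> \<longrightarrow> ?X \<sigma> \<inter> ?X \<tau> = {}"
      using realized_perm_unique unfolding realizable_perms_def by blast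
  qed simp
  finally show ?thesis .
qed

section \<open>Interior points and realizability\<close>

lemma ex_small_multiplier:
  fixes g h :: "'k \<Rightarrow> real"
  assumes "finite A" "\<forall>k\<in>A. 0 < g k"
  shows "\<exists>\<delta>>0. \<forall>k\<in>A. \<delta> * \<bar>h k\<bar> < g k"
proof -
  \<comment> \<open>The inserted 1 covers an empty \<open>A\<close>, the added 1 a vanishing
    \<open>h k\<close>.\<close>
  define \<delta> where "\<delta> = Min (insert 1 ((\<lambda>k. g k / (\<bar>h k\<bar> + 1)) ` A))"
  have "\<delta> > 0" unfolding \<delta>_def using assms by (subst Min_gr_iff) (auto intro!: divide_pos_pos add_nonneg_pos)
  moreover have "\<delta> * \<bar>h k\<bar> < g k" if "k \<in> A" for k
  proof -
    have "\<delta> \<le> g k / (\<bar>h k\<bar> + 1)" unfolding \<delta>_def using that assms by (intro Min_le) auto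
    then have "\<delta> * (\<bar>h k\<bar> + 1) \<le> g k" by (simp add: pos_le_divide_eq add_nonneg_pos)
    then show ?thesis using \<open>\<delta> > 0\<close> by (simp add: distrib_left)
  qed
  ultimately show ?thesis by blast
qed

text \<open>For each \<open>i\<close> some point of \<open>P\<close> has a positive
  \<open>i\<close>-th coordinate. The sum of these points is positive everywhere and at most
  \<open>d\<close> in each coordinate, so dividing by \<open>d + 1\<close> moves it into the open
  cube.\<close>

lemma ex_interior_point:
  fixes s P :: "(real^'n) set"
  assumes s: "subspace s" and P: "P = {x. \<forall>i. 0 \<le> x $ i \<and> x $ i \<le> 1} \<inter> s"
    and nz: "\<forall>i. \<not> P \<subseteq> {x. x $ i = 0}"
  shows "\<exists>w\<in>s. \<forall>i. 0 < w $ i \<and> w $ i < 1"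
proof -
  have "\<forall>i. \<exists>x. x \<in> P \<and> x $ i \<noteq> 0" using nz by blast
  then obtain x where x: "\<And>i. x i \<in> P" "\<And>i. x i $ i \<noteq> 0" by metis
  have bnd: "0 \<le> x i $ j" "x i $ j \<le> 1" for i j using x(1)[of i] unfolding P by auto
  define w where "w = (1 / (real CARD('n) + 1)) *\<^sub>R (\<Sum>i\<in>UNIV. x i)"
  have "(\<Sum>i\<in>UNIV. x i) \<in> s" using x(1) unfolding P by (intro subspace_sum[OF s]) auto
  then have "w \<in> s" unfolding w_def by (rule subspace_scale[OF s])
  moreover have "0 < w $ j \<and> w $ j < 1" for j
  proof -
    have "x j $ j \<le> (\<Sum>i\<in>UNIV. x i $ j)" using bnd by (intro member_le_sum) auto
    moreover have "x j $ j > 0" using bnd(1)[of j j] x(2)[of j] by linarith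
    moreover have "(\<Sum>i\<in>UNIV. x i $ j) \<le> (\<Sum>i\<in>(UNIV::'n set). 1)" using bnd by (intro sum_mono) auto
    ultimately have "0 < (\<Sum>i\<in>UNIV. x i $ j)" "(\<Sum>i\<in>UNIV. x i $ j) < real CARD('n) + 1" by auto
    then show ?thesis unfolding w_def by (simp add: field_simps)
  qed
  ultimately show ?thesis by blast
qed

text \<open>A realizing point of \<open>P\<close> may touch the walls of the cube. A small multiple
  of \<open>w\<close> makes it positive without disturbing the strict order, and scaling then brings
  it below 1.\<close>

lemma realizable_in_interior:
  fixes s P :: "(real^'n::{finite,linorder}) set"
  assumes s: "subspace s" and P: "P = {x. \<forall>i. 0 \<le> x $ i \<and> x $ i \<le> 1} \<inter> s"
    and w: "w \<in> s" "\<forall>i. 0 < w $ i" and \<sigma>: "\<sigma> \<in> realizable_perms P"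
  shows "\<exists>x\<in>s. realizes x \<sigma> \<and> (\<forall>i. 0 < x $ i \<and> x $ i < 1)"
proof -
  obtain x where x: "x \<in> P" "realizes x \<sigma>" using \<sigma> unfolding realizable_perms_def by blast
  let ?A = "{(i, j). i < j}" and ?g = "\<lambda>(i, j). x $ \<sigma> j - x $ \<sigma> i" and ?h = "\<lambda>(i, j). w $ \<sigma> j - w $ \<sigma> i"
  have "\<forall>k\<in>?A. 0 < ?g k" using x(2) unfolding realizes_def strict_mono_def by auto
  then obtain \<delta> where \<delta>: "\<delta> > 0" "\<forall>k\<in>?A. \<delta> * \<bar>?h k\<bar> < ?g k"
    using ex_small_multiplier[of ?A ?g ?h] by auto
  define v where "v = x + \<delta> *\<^sub>R w"
  have v0: "v $ i > 0" for i
    using x(1) w(2) \<delta>(1) unfolding v_def P by (auto intro!: add_nonneg_pos)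
  have vs: "v \<in> s" unfolding v_def using x(1) w(1) unfolding P by (auto intro: subspace_add[OF s] subspace_scale[OF s])
  have vr: "v $ \<sigma> i < v $ \<sigma> j" if "i < j" for i j
  proof -
    have "\<delta> * \<bar>w $ \<sigma> j - w $ \<sigma> i\<bar> < x $ \<sigma> j - x $ \<sigma> i" using \<delta>(2) that by auto
    moreover have "\<delta> * (w $ \<sigma> i - w $ \<sigma> j) \<le> \<delta> * \<bar>w $ \<sigma> j - w $ \<sigma> i\<bar>"
      using \<delta>(1) by (intro mult_left_mono) auto
    ultimately show ?thesis unfolding v_def by (simp add: right_diff_distrib)
  qed
  define c where "c = (\<Sum>i\<in>UNIV. v $ i) + 1"
  have vc: "v $ i < c" for i
  proof -
    have "v $ i \<le> (\<Sum>i\<in>UNIV. v $ i)" using v0 by (intro member_le_sum) (auto intro: less_imp_le)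
    then show ?thesis unfolding c_def by simp
  qed
  have c: "c > 0" using v0 vc by (meson less_trans)
  let ?x = "(1 / c) *\<^sub>R v"
  have "?x \<in> s" using subspace_scale[OF s vs] .
  moreover have "realizes ?x \<sigma>"
    unfolding realizes_def using vr c by (intro strict_monoI) (simp add: divide_strict_right_mono)
  moreover have "\<forall>i. 0 < ?x $ i \<and> ?x $ i < 1" using v0 vc c by simp
  ultimately show ?thesis by blast
qed

text \<open>The steps of an interior realizing point are all positive. They form the point
  \<open>p\<close> of \<open>reciprocal\<close> for \<open>J = {}\<close>.\<close>

lemma signed_count_chain_qpoly:
  fixes a :: "nat \<Rightarrow> 'n::{finite,linorder} \<Rightarrow> int" and P :: "(real^'n::{finite,linorder}) set"
  assumes P: "P = {x. \<forall>i. 0 \<le> x $ i \<and> x $ i \<le> 1} \<inter> form_space m a"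
    and w: "w \<in> form_space m a" "\<forall>i. 0 < w $ i" and \<sigma>: "\<sigma> \<in> realizable_perms P"
  shows "\<exists>N. qpoly N (Suc (dim (form_space m a))) (signed_count m UNIV (\<lambda>_. 1) (chain_forms a \<sigma>) {})"
proof -
  have perm: "\<sigma> permutes UNIV" using \<sigma> unfolding realizable_perms_def by blast
  obtain x where x: "x \<in> form_space m a" "realizes x \<sigma>" "\<forall>i. 0 < x $ i \<and> x $ i < 1"
    using realizable_in_interior[OF subspace_form_space P w \<sigma>] by blast
  obtain y where y: "chain_point \<sigma> y = x" "(\<Sum>z\<in>UNIV. y z) = 1"
    using chain_point_surj[OF perm] by blast
  have pos: "\<forall>z. y z > 0" using chain_pos_iff[OF perm, of y] x y by simp
  have eq: "($) (\<chi> z. y z) = y" by auto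
  have ker: "(\<chi> z. y z) \<in> kernel m UNIV (chain_forms a \<sigma>)"
    unfolding kernel_chain_forms[OF perm] eq using y x by simp
  have "\<forall>i\<in>UNIV - {}. (\<chi> z. y z) $ i > 0" using pos by simp
  then show ?thesis
    unfolding dim_kernel_chain_forms[OF perm, symmetric]
    by (intro reciprocalD[OF reciprocal _ ker]) auto
qed

text \<open>If each step were positive on some nonnegative kernel element, the sum of these elements
  would, after scaling, realize \<open>\<sigma>\<close> in \<open>P\<close>. So some step vanishes
  on all nonnegative kernel elements but not on the whole kernel, and
  \<open>closed_solutions_qpoly\<close> lowers the degree.\<close>

lemma closed_chain_qpoly:
  fixes a :: "nat \<Rightarrow> 'n::{finite,linorder} \<Rightarrow> int" and P :: "(real^'n::{finite,linorder}) set"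
  assumes P: "P = {x. \<forall>i. 0 \<le> x $ i \<and> x $ i \<le> 1} \<inter> form_space m a"
    and w: "w \<in> form_space m a" "\<forall>i. 0 < w $ i"
    and \<sigma>: "\<sigma> \<in> realizable_perms (form_space m a)" "\<sigma> \<notin> realizable_perms P"
  shows "\<exists>N Q. qpoly N (dim (form_space m a)) Q \<and>
    (\<forall>t>0. Q t = real (card (solutions m UNIV (\<lambda>_. 1) (chain_forms a \<sigma>) {} t))) \<and> Q 0 = 1"
proof -
  let ?K = "kernel m UNIV (chain_forms a \<sigma>)"
  have perm: "\<sigma> permutes UNIV" using \<sigma> unfolding realizable_perms_def by blast
  have eq: "($) (\<chi> z. y z) = y" for y :: "'n option \<Rightarrow> real" by auto
  obtain x where x: "x \<in> form_space m a" "realizes x \<sigma>"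
    using \<sigma>(1) unfolding realizable_perms_def by blast
  \<comment> \<open>The origin of \<open>s\<close> with total 1, all of it slack. It shows that the
    vanishing coordinate \<open>j0\<close> is not the slack.\<close>
  define q0 :: "real^'n option" where "q0 = (\<chi> z. if z = None then (1::real) else 0)"
  have "chain_point \<sigma> (($) q0) = 0" unfolding chain_point_def q0_def by (simp add: vec_eq_iff)
  then have q0: "q0 \<in> ?K" "\<forall>l. q0 $ l \<ge> 0" "q0 $ None > 0"
    unfolding kernel_chain_forms[OF perm] using subspace_0[OF subspace_form_space[of m a]]
    by (auto simp: q0_def)
  have "\<exists>j0. \<forall>q\<in>?K. (\<forall>l. q $ l \<ge> 0) \<longrightarrow> q $ j0 = 0"
  proof (rule ccontr)
    assume "\<not> ?thesis"
    then have "\<forall>j. \<exists>q. q \<in> ?K \<and> (\<forall>l. q $ l \<ge> 0) \<and> q $ j \<noteq> 0" by blast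
    then obtain r where r: "\<And>j. r j \<in> ?K" "\<And>j l. r j $ l \<ge> 0" "\<And>j. r j $ j \<noteq> 0" by metis
    define p where "p = (\<Sum>j\<in>UNIV. r j)"
    have pK: "p \<in> ?K" unfolding p_def by (intro subspace_sum[OF subspace_kernel] r)
    have pos: "\<forall>z. p $ z > 0"
    proof
      fix z
      have "r z $ z \<le> p $ z" unfolding p_def sum_component using r(2) by (intro member_le_sum) auto
      moreover have "r z $ z > 0" using r(2)[of z z] r(3)[of z] by linarith
      ultimately show "p $ z > 0" by linarith
    qed
    define T where "T = (\<Sum>z\<in>UNIV. p $ z)"
    have T: "T > 0" unfolding T_def using pos by (intro sum_pos) auto
    let ?x = "chain_point \<sigma> (($) p)"
    have R: "realizes ?x \<sigma>" "\<forall>i. 0 < ?x $ i \<and> ?x $ i < T"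
      using chain_pos_iff[OF perm, of "($) p"] pos unfolding T_def by auto
    have "(1 / T) *\<^sub>R ?x \<in> P"
      unfolding P using subspace_scale[OF subspace_form_space] pK R(2) T
      by (auto simp: kernel_chain_forms[OF perm] field_simps intro: less_imp_le)
    moreover have "realizes ((1 / T) *\<^sub>R ?x) \<sigma>"
      using R(1) T unfolding realizes_def strict_mono_def by (simp add: divide_strict_right_mono)
    ultimately show False using \<sigma>(2) perm unfolding realizable_perms_def by blast
  qed
  then obtain j0 where j0: "\<And>q. q \<in> ?K \<Longrightarrow> \<forall>l. q $ l \<ge> 0 \<Longrightarrow> q $ j0 = 0" by blast
  have "j0 \<noteq> None"
  proof
    assume "j0 = None"
    then show False using j0[OF q0(1,2)] q0(3) by simp
  qed
  then obtain l where l: "j0 = Some l" by auto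
  have "\<exists>q1\<in>?K. q1 $ j0 \<noteq> 0"
  proof -
    \<comment> \<open>If \<open>l\<close> is the least index, its step at \<open>w\<close> is a
      coordinate of \<open>w\<close> and so positive; otherwise its step at \<open>x\<close> is a
      strict increase, because \<open>x\<close> realizes \<open>\<sigma>\<close>. Signs of the other
      steps, slack included, do not matter here.\<close>
    define v where "v = (if {..<l} = {} then w else x)"
    obtain y where y: "chain_point \<sigma> y = v" "(\<Sum>z\<in>UNIV. y z) = 0"
      using chain_point_surj[OF perm] by blast
    have "(\<chi> z. y z) \<in> ?K" unfolding kernel_chain_forms[OF perm] eq y using w x unfolding v_def by simp
    moreover have "y (Some l) \<noteq> 0"
    proof (cases "{..<l} = {}")
      case True
      then show ?thesis using chain_coordinates(1)[OF perm, of y l] w(2) unfolding y v_def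
        by (simp add: pred_value_def less_imp_neq[symmetric])
    next
      case False
      have "x $ \<sigma> (Max {..<l}) < x $ \<sigma> l"
        using x(2) Max_lessThan_less[OF False] unfolding realizes_def strict_mono_def by blast
      then show ?thesis using chain_coordinates(1)[OF perm, of y l] False unfolding y v_def
        by (simp add: pred_value_def)
    qed
    ultimately show ?thesis unfolding l by (intro bexI[of _ "\<chi> z. y z"]) auto
  qed
  then obtain q1 where q1: "q1 \<in> ?K" "q1 $ j0 \<noteq> 0" by blast
  have "\<exists>N k Q. k < dim ?K \<and> qpoly N k Q \<and>
    (\<forall>t>0. Q t = real (card (solutions m UNIV (\<lambda>_. 1) (chain_forms a \<sigma>) {} t))) \<and> Q 0 = 1"
    by (rule closed_solutions_qpoly[OF _ UNIV_I q0 UNIV_I q1 j0]) simp_all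
  then obtain N k Q where Q: "k < dim ?K" "qpoly N k Q"
    "\<forall>t>0. Q t = real (card (solutions m UNIV (\<lambda>_. 1) (chain_forms a \<sigma>) {} t))" "Q 0 = 1"
    by blast
  have "qpoly N (dim (form_space m a)) Q"
    using Q(1,2) qpoly_mono unfolding dim_kernel_chain_forms[OF perm] by (metis less_Suc_eq_le)
  then show ?thesis using Q(3,4) by blast
qed

subsection \<open>Lattice bases of rational subspaces\<close>

lemma common_denominator:
  fixes c :: "'k \<Rightarrow> real"
  assumes "finite A" "\<forall>i\<in>A. c i \<in> \<rat>"
  shows "\<exists>D::int. D > 0 \<and> (\<forall>i\<in>A. of_int D * c i \<in> \<int>)"
  using assms
proof (induction A rule: finite_induct)
  case empty
  then show ?case by (intro exI[of _ 1]) simp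
next
  case (insert i A)
  then obtain D :: int where D: "D > 0" "\<forall>i\<in>A. of_int D * c i \<in> \<int>" by auto
  obtain p q where q: "q > 0" "c i = of_int p / of_int q"
    using insert.prems by (auto elim: Rats_cases')
  have "of_int (D * q) * c j \<in> \<int>" if "j \<in> insert i A" for j
  proof (cases "j = i")
    case True
    then have "of_int (D * q) * c j = of_int (D * p)" using q by simp
    then show ?thesis by (metis Ints_of_int)
  next
    case False
    then have "of_int D * c j \<in> \<int>" using D that by blast
    then have "of_int q * (of_int D * c j) \<in> \<int>" by (rule Ints_mult[OF Ints_of_int])
    then show ?thesis by (simp add: mult_ac)
  qed
  then show ?case using D q by (intro exI[of _ "D * q"]) auto
qed

lemma rational_forms_eq_form_space:
  fixes f :: "nat \<Rightarrow> real^'n \<Rightarrow> real"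
  assumes "\<forall>j\<in>{1..m}. rational_linear_form (f j)"
  shows "\<exists>a. {x. \<forall>j\<in>{1..m}. f j x = 0} = form_space m a"
proof -
  have "\<exists>a. \<forall>x. f (Suc k) x = 0 \<longleftrightarrow> (\<Sum>i\<in>UNIV. of_int (a i) * x $ i) = 0" if "k < m" for k
  proof -
    have "rational_linear_form (f (Suc k))" using assms that by simp
    then obtain c where c: "\<forall>i. c i \<in> \<rat>" "f (Suc k) = (\<lambda>x. \<Sum>i\<in>UNIV. c i * x $ i)"
      unfolding rational_linear_form_def by blast
    obtain D :: int where D: "D > 0" "\<forall>i\<in>UNIV. of_int D * c i \<in> \<int>"
      using common_denominator[of UNIV c] c(1) by auto
    define a where "a i = \<lfloor>of_int D * c i\<rfloor>" for i
    have "of_int (a i) = of_int D * c i" for i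
    proof -
      have "of_int D * c i \<in> \<int>" using D(2) by blast
      then obtain e where "of_int D * c i = of_int e" by (rule Ints_cases)
      then show ?thesis by (simp add: a_def)
    qed
    then have "(\<Sum>i\<in>UNIV. of_int (a i) * x $ i) = of_int D * f (Suc k) x" for x
      unfolding c(2) by (simp add: sum_distrib_left mult.assoc)
    then show ?thesis using D(1) by (intro exI[of _ a]) auto
  qed
  then have "\<forall>k. \<exists>a. k < m \<longrightarrow> (\<forall>x. f (Suc k) x = 0 \<longleftrightarrow> (\<Sum>i\<in>UNIV. of_int (a i) * x $ i) = 0)"
    by blast
  from choice[OF this] obtain a where
    a: "\<forall>k. k < m \<longrightarrow> (\<forall>x. f (Suc k) x = 0 \<longleftrightarrow> (\<Sum>i\<in>UNIV. of_int (a k i) * x $ i) = 0)" ..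
  have "(\<forall>j\<in>{1..m}. f j x = 0) \<longleftrightarrow> (\<forall>k<m. f (Suc k) x = 0)" for x
  proof
    assume *: "\<forall>k<m. f (Suc k) x = 0"
    show "\<forall>j\<in>{1..m}. f j x = 0"
    proof
      fix j assume "j \<in> {1..m}"
      then obtain k where "j = Suc k" "k < m" by (cases j) auto
      then show "f j x = 0" using * by simp
    qed
  qed auto
  then have "{x. \<forall>j\<in>{1..m}. f j x = 0} = form_space m a" unfolding form_space_def using a by auto
  then show ?thesis by blast
qed

text \<open>One form \<open>g\<close> at a time: for \<open>b0\<close> in \<open>B\<close> with
  \<open>g b0 \<noteq> 0\<close>, the map \<open>x \<mapsto> g b0 * x - g x * b0\<close> sends the
  span of \<open>B\<close> into the kernel of \<open>g\<close>, preserves integrality, and is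
  multiplication by \<open>g b0\<close> on that kernel, hence onto. So integer points span
  \<open>s\<close>, and the lattice has full rank.\<close>

lemma form_space_spanned:
  fixes a :: "nat \<Rightarrow> 'n::finite \<Rightarrow> int"
  shows "\<exists>B. B \<subseteq> int_lattice \<and> span B = form_space m a"
proof (induction m)
  case 0
  have "(Basis :: (real^'n) set) \<subseteq> int_lattice"
    unfolding int_lattice_def by (auto simp: Basis_vec_def axis_def)
  moreover have "span Basis = form_space 0 a" by (simp add: form_space_def)
  ultimately show ?case by blast
next
  case (Suc m)
  then obtain B where B: "B \<subseteq> int_lattice" "span B = form_space m a" by blast
  define g where "g x = (\<Sum>i\<in>UNIV. of_int (a m i) * x $ i)" for x :: "real^'n"
  have g: "linear g"
    by (rule linearI) (auto simp: g_def distrib_left sum.distrib sum_distrib_left mult_ac)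
  have eq: "form_space (Suc m) a = {x \<in> form_space m a. g x = 0}"
    unfolding form_space_def g_def by (auto simp: less_Suc_eq)
  show ?case
  proof (cases "\<forall>b\<in>B. g b = 0")
    case True
    then have "g x = 0" if "x \<in> span B" for x
      using linear_eq_0_on_span[OF g _ that] by blast
    then have "form_space (Suc m) a = span B" unfolding eq B(2)[symmetric] by auto
    then show ?thesis using B(1) by metis
  next
    case False
    then obtain b0 where b0: "b0 \<in> B" "g b0 \<noteq> 0" by blast
    define T where "T x = g b0 *\<^sub>R x - g x *\<^sub>R b0" for x
    have T: "linear T"
      by (rule linearI) (auto simp: T_def linear_add[OF g] linear_cmul[OF g] algebra_simps)
    have int: "T b \<in> int_lattice" if "b \<in> B" for b
    proof -
      have "g b \<in> \<int>" "g b0 \<in> \<int>" "\<And>i. b $ i \<in> \<int>" "\<And>i. b0 $ i \<in> \<int>"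
        using B(1) that b0(1) unfolding g_def int_lattice_def by (auto intro!: Ints_sum Ints_mult)
      then show ?thesis unfolding T_def int_lattice_def by (auto intro!: Ints_diff Ints_mult)
    qed
    have "span (T ` B) = form_space (Suc m) a"
    proof (rule subset_antisym)
      show "span (T ` B) \<subseteq> form_space (Suc m) a"
      proof (rule span_minimal[OF _ subspace_form_space])
        show "T ` B \<subseteq> form_space (Suc m) a"
        proof (rule image_subsetI)
          fix b assume b: "b \<in> B"
          have "T b \<in> span B" unfolding T_def using b b0 by (intro span_diff span_scale span_base)
          moreover have "g (T b) = 0"
            unfolding T_def by (simp add: linear_diff[OF g] linear_cmul[OF g] mult.commute)
          ultimately show "T b \<in> form_space (Suc m) a" unfolding eq B(2) by simp
        qed
      qed
      show "form_space (Suc m) a \<subseteq> span (T ` B)"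
      proof
        fix x assume x: "x \<in> form_space (Suc m) a"
        have "T ((1 / g b0) *\<^sub>R x) = x"
          using x b0(2) unfolding eq T_def by (simp add: linear_cmul[OF g])
        moreover have "(1 / g b0) *\<^sub>R x \<in> span B" using x unfolding eq B(2)[symmetric] by (simp add: span_scale)
        ultimately show "x \<in> span (T ` B)" unfolding linear_span_image[OF T] by (metis imageI)
      qed
    qed
    then show ?thesis using int by (metis image_subsetI)
  qed
qed

lemma span_int_lattice_form_space: "span (int_lattice \<inter> form_space m a) = form_space m (a :: nat \<Rightarrow> 'n::finite \<Rightarrow> int)"
proof (rule subset_antisym)
  show "span (int_lattice \<inter> form_space m a) \<subseteq> form_space m a"
    by (rule span_minimal) (auto simp: subspace_form_space)
  obtain B where B: "B \<subseteq> int_lattice" "span B = form_space m a" using form_space_spanned by blast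
  then have "B \<subseteq> int_lattice \<inter> form_space m a" using span_superset[of B] by auto
  then show "form_space m a \<subseteq> span (int_lattice \<inter> form_space m a)" unfolding B(2)[symmetric] by (rule span_mono)
qed

lemma int_lattice_add: "x \<in> int_lattice \<Longrightarrow> y \<in> int_lattice \<Longrightarrow> x + y \<in> int_lattice"
  and int_lattice_diff: "x \<in> int_lattice \<Longrightarrow> y \<in> int_lattice \<Longrightarrow> x - y \<in> int_lattice"
  and int_lattice_scale: "x \<in> int_lattice \<Longrightarrow> of_int z *\<^sub>R x \<in> int_lattice"
  by (auto simp: int_lattice_def)

text \<open>Induction on the set of coordinates that are not identically zero on \<open>s\<close>: an element whose
  \<open>l\<close>-th coordinate is positive and minimal completes a basis of the sublattice \<open>x\<^sub>l = 0\<close>.\<close>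

lemma lattice_basis_exists_supported:
  fixes s :: "(real^'n::finite) set"
  assumes "finite S" "subspace s" "\<forall>x\<in>s. \<forall>i. i \<notin> S \<longrightarrow> x $ i = 0"
  shows "\<exists>B. independent B \<and> int_lattice \<inter> s = {\<Sum>b\<in>B. of_int (z b) *\<^sub>R b | z :: real^'n \<Rightarrow> int. True}"
  using assms
proof (induction S arbitrary: s rule: finite_induct)
  case empty
  have "x = 0" if "x \<in> s" for x using empty that by (simp add: vec_eq_iff)
  then have "int_lattice \<inter> s = {0}"
    using subspace_0[OF empty(1)] by (auto simp: int_lattice_def)
  then show ?case by (intro exI[of _ "{}"]) (simp add: independent_empty)
next
  case (insert l S)
  define s0 where "s0 = {x \<in> s. x $ l = 0}"
  have s0: "subspace s0"
    using insert.prems(1) unfolding s0_def subspace_def by auto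
  have "\<exists>B. independent B \<and> int_lattice \<inter> s0 = {\<Sum>b\<in>B. of_int (z b) *\<^sub>R b | z :: real^'n \<Rightarrow> int. True}"
    using insert.prems(2) s0 unfolding s0_def by (intro insert.IH) (auto simp: s0_def)
  then obtain B where B: "independent B"
      "int_lattice \<inter> s0 = {\<Sum>b\<in>B. of_int (z b) *\<^sub>R b | z :: real^'n \<Rightarrow> int. True}" by blast
  show ?case
  proof (cases "\<exists>x\<in>int_lattice \<inter> s. x $ l \<noteq> 0")
    case False
    then have "int_lattice \<inter> s = int_lattice \<inter> s0" unfolding s0_def by blast
    from trans[OF this B(2)] show ?thesis by (intro exI[of _ B] conjI B(1))
  next
    case True
    have ex: "\<exists>n::nat. n > 0 \<and> (\<exists>v\<in>int_lattice \<inter> s. v $ l = real n)"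
    proof -
      obtain x where x: "x \<in> int_lattice" "x \<in> s" "x $ l \<noteq> 0" using True by blast
      obtain q where q: "x $ l = of_int q" using x(1) unfolding int_lattice_def by (auto elim: Ints_cases)
      let ?v = "of_int (sgn q) *\<^sub>R x"
      have "?v \<in> int_lattice \<inter> s" 
        using x by (auto intro: int_lattice_scale subspace_scale[OF insert.prems(1)])
      moreover have "?v $ l = real (nat \<bar>q\<bar>)"
        using q by (simp add: sgn_if)
      moreover have "nat \<bar>q\<bar> > 0" using q x(3) by simp
      ultimately show ?thesis by (intro exI[of _ "nat \<bar>q\<bar>"] conjI bexI[of _ ?v])
    qed
    define g where "g = (LEAST n::nat. n > 0 \<and> (\<exists>v\<in>int_lattice \<inter> s. v $ l = real n))"
    have g: "g > 0" "\<exists>v\<in>int_lattice \<inter> s. v $ l = real g"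
      using LeastI_ex[OF ex] unfolding g_def by blast+
    have g_least: "g \<le> n" if "n > 0" "v \<in> int_lattice \<inter> s" "v $ l = real n" for n v
      unfolding g_def by (rule Least_le) (use that in blast)
    obtain v where v: "v \<in> int_lattice" "v \<in> s" "v $ l = real g" using g(2) by blast
    have finB: "finite B" using B(1) independent_imp_finite by blast
    have Bs0: "B \<subseteq> s0"
    proof
      fix b assume b: "b \<in> B"
      have "(\<Sum>b'\<in>B. of_int (if b' = b then 1 else 0) *\<^sub>R b') = (\<Sum>b'\<in>B. if b' = b then b' else 0)"
        by (intro sum.cong) auto
      also have "\<dots> = b" using b finB by simp
      finally have eq: "b = (\<Sum>b'\<in>B. of_int (if b' = b then 1 else 0) *\<^sub>R b')" by simp
      have "b \<in> int_lattice \<inter> s0" unfolding B(2) mem_Collect_eq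
        by (rule exI[of _ "\<lambda>b'. if b' = b then 1 else 0"]) (use eq in simp)
      then show "b \<in> s0" by simp
    qed
    have vB: "v \<notin> span B"
    proof
      assume "v \<in> span B"
      then have "v \<in> s0" using span_minimal[OF Bs0 s0] by blast
      then show False using v(3) g(1) unfolding s0_def by simp
    qed
    then have vnB: "v \<notin> B" using span_base by blast
    have sum: "(\<Sum>b\<in>insert v B. of_int (z b) *\<^sub>R b) = of_int (z v) *\<^sub>R v + (\<Sum>b\<in>B. of_int (z b) *\<^sub>R b)"
      for z :: "real^'n \<Rightarrow> int" using finB vnB by simp
    have "int_lattice \<inter> s = {\<Sum>b\<in>insert v B. of_int (z b) *\<^sub>R b | z :: real^'n \<Rightarrow> int. True}"
    proof (rule subset_antisym; rule subsetI)
      fix x assume x: "x \<in> int_lattice \<inter> s"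
      obtain e where e: "x $ l = of_int e" using x unfolding int_lattice_def by (auto elim: Ints_cases)
      define q where "q = e div int g"
      define y where "y = x - of_int q *\<^sub>R v"
      have y: "y \<in> int_lattice" "y \<in> s"
        unfolding y_def using x v(1,2)
        by (auto intro: int_lattice_diff int_lattice_scale subspace_diff[OF insert.prems(1)]
            subspace_scale[OF insert.prems(1)])
      have yl: "y $ l = real (nat (e mod int g))"
      proof -
        have "y $ l = of_int (e - q * int g)" unfolding y_def using e v(3) by simp
        also have "e - q * int g = e mod int g" unfolding q_def by (simp add: minus_div_mult_eq_mod)
        finally show ?thesis using g(1) by simp
      qed
      \<comment> \<open>Division with remainder by \<open>v\<close>: a nonzero remainder would be a
        smaller positive \<open>l\<close>-th coordinate than \<open>g\<close>.\<close>
      have "nat (e mod int g) = 0"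
      proof (rule ccontr)
        assume "nat (e mod int g) \<noteq> 0"
        then have "g \<le> nat (e mod int g)" using g_least[of "nat (e mod int g)" y] y yl by blast
        moreover have "e mod int g < int g" using g(1) by simp
        ultimately show False using g(1) by linarith
      qed
      then have "y \<in> int_lattice \<inter> s0" using y yl unfolding s0_def by simp
      then obtain z :: "real^'n \<Rightarrow> int" where z: "y = (\<Sum>b\<in>B. of_int (z b) *\<^sub>R b)" unfolding B(2) by blast
      have "(\<Sum>b\<in>B. of_int ((z(v := q)) b) *\<^sub>R b) = (\<Sum>b\<in>B. of_int (z b) *\<^sub>R b)"
        using vnB by (intro sum.cong) auto
      moreover have "x = of_int q *\<^sub>R v + y" unfolding y_def by simp
      ultimately have "x = (\<Sum>b\<in>insert v B. of_int ((z(v := q)) b) *\<^sub>R b)"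
        unfolding sum using z by simp
      then show "x \<in> {\<Sum>b\<in>insert v B. of_int (z b) *\<^sub>R b | z :: real^'n \<Rightarrow> int. True}" by blast
    next
      fix x assume "x \<in> {\<Sum>b\<in>insert v B. of_int (z b) *\<^sub>R b | z :: real^'n \<Rightarrow> int. True}"
      then obtain z :: "real^'n \<Rightarrow> int" where z: "x = of_int (z v) *\<^sub>R v + (\<Sum>b\<in>B. of_int (z b) *\<^sub>R b)"
        unfolding sum by blast
      have "(\<Sum>b\<in>B. of_int (z b) *\<^sub>R b) \<in> int_lattice \<inter> s0" unfolding B(2) by blast
      then have "(\<Sum>b\<in>B. of_int (z b) *\<^sub>R b) \<in> int_lattice \<inter> s" unfolding s0_def by blast
      then show "x \<in> int_lattice \<inter> s"
        unfolding z using v(1,2)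
        by (auto intro: int_lattice_add int_lattice_scale subspace_add[OF insert.prems(1)]
            subspace_scale[OF insert.prems(1)])
    qed
    moreover have "independent (insert v B)" using B(1) vB by (simp add: independent_insert vnB)
    ultimately show ?thesis by blast
  qed
qed

text \<open>Around \<open>w\<close> the section contains small pieces of every direction of
  \<open>s\<close>, so \<open>P\<close> spans \<open>s\<close>; since \<open>0\<close> lies in
  \<open>P\<close>, the affine hull is the span.\<close>

lemma affine_hull_cube_section:
  fixes s P :: "(real^'n) set"
  assumes s: "subspace s" and P: "P = {x. \<forall>i. 0 \<le> x $ i \<and> x $ i \<le> 1} \<inter> s"
    and w: "w \<in> s" "\<forall>i. 0 < w $ i \<and> w $ i < 1"
  shows "affine hull P = s" "nat (aff_dim P) = dim s"
proof -
  have "0 \<in> P" unfolding P using subspace_0[OF s] by simp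
  have "x \<in> span P" if x: "x \<in> s" for x
  proof -
    obtain \<delta> where \<delta>: "\<delta> > 0" "\<forall>i\<in>UNIV. \<delta> * \<bar>x $ i\<bar> < min (w $ i) (1 - w $ i)"
      using ex_small_multiplier[of UNIV "\<lambda>i. min (w $ i) (1 - w $ i)" "\<lambda>i. x $ i"] w(2) by auto
    have "0 \<le> (w + \<delta> *\<^sub>R x) $ i \<and> (w + \<delta> *\<^sub>R x) $ i \<le> 1" for i
    proof -
      have "\<bar>\<delta> * x $ i\<bar> < min (w $ i) (1 - w $ i)" using \<delta> by (simp add: abs_mult)
      then show ?thesis by auto
    qed
    then have "w + \<delta> *\<^sub>R x \<in> P" unfolding P using subspace_add[OF s w(1) subspace_scale[OF s x]] by blast
    moreover have "w \<in> P" unfolding P using w by (auto intro: less_imp_le)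
    ultimately have "(1 / \<delta>) *\<^sub>R ((w + \<delta> *\<^sub>R x) - w) \<in> span P" by (intro span_scale span_diff span_base)
    then show ?thesis using \<delta>(1) by simp
  qed
  then have sp: "span P = s" using span_minimal[of P s] s unfolding P by blast
  have "0 \<in> affine hull P" using \<open>0 \<in> P\<close> by (rule hull_inc)
  then show "affine hull P = s" using affine_hull_span_0 sp by metis
  show "nat (aff_dim P) = dim s" using aff_dim_zero[OF \<open>0 \<in> affine hull P\<close>] sp dim_span[of P] by simp
qed

lemma lattice_frame_exists:
  fixes s P :: "(real^'n) set"
  assumes s: "subspace s" and sp: "span (int_lattice \<inter> s) = s"
    and P: "affine hull P = s" "nat (aff_dim P) = dim s"
  shows "\<exists>p b. lattice_frame P p b"
proof -
  obtain B where B: "independent B"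
      "int_lattice \<inter> s = {\<Sum>b\<in>B. of_int (z b) *\<^sub>R b | z :: real^'n \<Rightarrow> int. True}"
    using lattice_basis_exists_supported[of UNIV s] s by auto
  have fin: "finite B" using B(1) independent_imp_finite by blast
  have "span B = s"
  proof (rule subset_antisym)
    have "int_lattice \<inter> s \<subseteq> span B" unfolding B(2)
      by clarify (intro span_sum span_scale span_base)
    then show "s \<subseteq> span B" using span_minimal[of "int_lattice \<inter> s" "span B"] sp by simp
    have "B \<subseteq> s"
    proof
      fix b assume b: "b \<in> B"
      have "(\<Sum>b'\<in>B. of_int (if b' = b then 1 else 0) *\<^sub>R b') = (\<Sum>b'\<in>B. if b' = b then b' else 0)"
        by (intro sum.cong) auto
      also have "\<dots> = b" using b fin by simp
      finally have eq: "b = (\<Sum>b'\<in>B. of_int (if b' = b then 1 else 0) *\<^sub>R b')" by simp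
      have "b \<in> int_lattice \<inter> s" unfolding B(2) mem_Collect_eq
        by (rule exI[of _ "\<lambda>b'. if b' = b then 1 else 0"]) (use eq in simp)
      then show "b \<in> s" by simp
    qed
    then show "span B \<subseteq> s" by (rule span_minimal[OF _ s])
  qed
  then have card: "card B = dim s" using B(1) by (metis dim_eq_card_independent dim_span)
  obtain b where b: "bij_betw b {..<dim s} B"
    using ex_bij_betw_nat_finite[OF fin] card by (auto simp: atLeast0LessThan)
  have sum: "(\<Sum>i<dim s. of_int (z (b i)) *\<^sub>R b i) = (\<Sum>b\<in>B. of_int (z b) *\<^sub>R b)" for z :: "real^'n \<Rightarrow> int"
    using sum.reindex_bij_betw[OF b, of "\<lambda>b. of_int (z b) *\<^sub>R b"] .
  have "int_lattice \<inter> s = {0 + (\<Sum>i<dim s. of_int (z i) *\<^sub>R b i) | z :: nat \<Rightarrow> int. True}"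
  proof (rule subset_antisym; rule subsetI)
    fix x assume "x \<in> int_lattice \<inter> s"
    then obtain z :: "real^'n \<Rightarrow> int" where "x = (\<Sum>b\<in>B. of_int (z b) *\<^sub>R b)" unfolding B(2) by blast
    then have "x = 0 + (\<Sum>i<dim s. of_int ((\<lambda>i. z (b i)) i) *\<^sub>R b i)" using sum[of z] by simp
    then show "x \<in> {0 + (\<Sum>i<dim s. of_int (z i) *\<^sub>R b i) | z :: nat \<Rightarrow> int. True}"
      unfolding mem_Collect_eq by (intro exI[of _ "\<lambda>i. z (b i)"]) simp
  next
    fix x assume "x \<in> {0 + (\<Sum>i<dim s. of_int (z i) *\<^sub>R b i) | z :: nat \<Rightarrow> int. True}"
    then obtain z :: "nat \<Rightarrow> int" where z: "x = (\<Sum>i<dim s. of_int (z i) *\<^sub>R b i)" by auto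
    define y where "y = z \<circ> inv_into {..<dim s} b"
    have "y (b i) = z i" if "i < dim s" for i
      using that b unfolding y_def bij_betw_def by (simp add: inv_into_f_f)
    then have "x = (\<Sum>i<dim s. of_int (y (b i)) *\<^sub>R b i)" unfolding z by (intro sum.cong) auto
    then show "x \<in> int_lattice \<inter> s" unfolding sum B(2) by blast
  qed
  then have "lattice_frame P 0 b"
    unfolding lattice_frame_def P Let_def using b B(1) by (simp add: bij_betw_def)
  then show ?thesis by blast
qed

subsection \<open>Lattice points and volume\<close>

text \<open>The frame is left arbitrary, since \<open>lattice_volume\<close> obtains one by choice;
  in particular \<open>p\<close> can be any lattice point of \<open>s\<close>.\<close>

locale cube_section =
  fixes s P :: "(real^'n::finite) set" and w p :: "real^'n" and b :: "nat \<Rightarrow> real^'n" and k :: nat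
  assumes s: "subspace s" and P: "P = {x. \<forall>i. 0 \<le> x $ i \<and> x $ i \<le> 1} \<inter> s"
    and w: "w \<in> s" "\<forall>i. 0 < w $ i \<and> w $ i < 1"
    and sp: "span (int_lattice \<inter> s) = s"
    and inj_b: "inj_on b {..<k}" and indep_b: "independent (b ` {..<k})"
    and frame: "int_lattice \<inter> s = {p + (\<Sum>i<k. of_int (z i) *\<^sub>R b i) | z :: nat \<Rightarrow> int. True}"
begin

definition F :: "(nat \<Rightarrow> real) \<Rightarrow> real^'n" where
  "F c = p + (\<Sum>i<k. c i *\<^sub>R b i)"

definition U :: "(real^'n) set" where
  "U = {x \<in> s. inj (\<lambda>i. x $ i) \<and> (\<forall>i. 0 < x $ i \<and> x $ i < 1)}"

abbreviation M :: "(nat \<Rightarrow> real) measure" where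
  "M \<equiv> PiM {..<k} (\<lambda>_. lborel)"

lemma P_iff: "x \<in> P \<longleftrightarrow> x \<in> s \<and> (\<forall>i. 0 \<le> x $ i \<and> x $ i \<le> 1)"
  by (subst P) auto

lemma lattice_pointI: "p + (\<Sum>i<k. of_int (z i) *\<^sub>R b i) \<in> int_lattice \<inter> s" for z :: "nat \<Rightarrow> int"
  unfolding frame by blast

lemma p_lattice: "p \<in> int_lattice" "p \<in> s"
  using lattice_pointI[of "\<lambda>_. 0"] by simp_all

lemma b_in_s:
  assumes "i < k"
  shows "b i \<in> s"
proof -
  have "(\<Sum>j<k. of_int (if j = i then 1 else 0) *\<^sub>R b j) = (\<Sum>j<k. if j = i then b j else 0)"
    by (intro sum.cong) auto
  also have "\<dots> = b i" using assms by simp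
  finally have "p + b i \<in> s" using lattice_pointI[of "\<lambda>j. if j = i then 1 else 0"] by simp
  then have "(p + b i) - p \<in> s" by (rule subspace_diff[OF s _ p_lattice(2)])
  then show ?thesis by simp
qed

lemma F_in_s: "F c \<in> s"
  unfolding F_def using b_in_s p_lattice
  by (intro subspace_add[OF s] subspace_sum[OF s] subspace_scale[OF s]) auto

lemma F_component: "F c $ j = p $ j + (\<Sum>i<k. c i * b i $ j)"
  unfolding F_def by simp

lemma span_b: "span (b ` {..<k}) = s"
proof (rule subset_antisym)
  show "span (b ` {..<k}) \<subseteq> s" using b_in_s by (intro span_minimal[OF _ s]) auto
  have sums: "(\<Sum>i<k. c i *\<^sub>R b i) \<in> span (b ` {..<k})" for c
    by (intro span_sum span_scale span_base) auto
  \<comment> \<open>The origin is itself a lattice point; its expansion in the frame shows that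
    \<open>p\<close> lies in the span of the vectors \<open>b i\<close>.\<close>
  have "0 \<in> int_lattice \<inter> s" using subspace_0[OF s] by (simp add: int_lattice_def)
  then obtain z :: "nat \<Rightarrow> int" where "0 = p + (\<Sum>i<k. of_int (z i) *\<^sub>R b i)" unfolding frame by blast
  then have "p = - (\<Sum>i<k. of_int (z i) *\<^sub>R b i)" by (simp add: eq_neg_iff_add_eq_0)
  then have "p \<in> span (b ` {..<k})" using span_neg[OF sums[of "\<lambda>i. of_int (z i)"]] by simp
  then have "int_lattice \<inter> s \<subseteq> span (b ` {..<k})"
    unfolding frame using sums by (auto intro: span_add)
  then show "s \<subseteq> span (b ` {..<k})" using span_minimal[of "int_lattice \<inter> s" "span (b ` {..<k})"] sp by simp
qed

text \<open>The dual basis, extended linearly to the whole space. It yields both the uniqueness of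
  frame coordinates and their boundedness on the cube.\<close>

lemma coordinate_functionals:
  obtains h :: "nat \<Rightarrow> real^'n \<Rightarrow> real" where
    "\<And>i. linear (h i)" "\<And>i c. i < k \<Longrightarrow> h i (F c - p) = c i"
proof -
  have "\<exists>g. linear g \<and> (\<forall>x\<in>b ` {..<k}. g x = (if x = b i then 1 else 0 :: real))" for i
    by (rule linear_independent_extend[OF indep_b])
  then have "\<forall>i. \<exists>g. linear g \<and> (\<forall>x\<in>b ` {..<k}. g x = (if x = b i then 1 else 0 :: real))" by blast
  from choice[OF this] obtain h :: "nat \<Rightarrow> real^'n \<Rightarrow> real"
    where h: "\<forall>i. linear (h i) \<and> (\<forall>x\<in>b ` {..<k}. h i x = (if x = b i then 1 else 0))" ..
  then have lin: "linear (h i)" for i by blast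
  have hb: "h i (b j) = (if j = i then 1 else 0)" if "i < k" "j < k" for i j
  proof -
    have "h i (b j) = (if b j = b i then 1 else 0)" using h that by blast
    then show ?thesis using inj_on_eq_iff[OF inj_b, of j i] that by simp
  qed
  have "h i (F c - p) = c i" if i: "i < k" for i c
  proof -
    have "h i (F c - p) = (\<Sum>j<k. c j * h i (b j))"
      unfolding F_def by (simp add: linear_sum[OF lin] linear_cmul[OF lin])
    also have "\<dots> = (\<Sum>j<k. if j = i then c j else 0)" using hb i by (intro sum.cong) auto
    also have "\<dots> = c i" using i by simp
    finally show ?thesis .
  qed
  then show ?thesis using that lin by blast
qed

lemma F_surj:
  assumes "x \<in> s"
  obtains c where "F c = x"
proof -
  have "x - p \<in> span (b ` {..<k})" unfolding span_b by (rule subspace_diff[OF s assms p_lattice(2)])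
  then obtain u where "x - p = (\<Sum>v\<in>b ` {..<k}. u v *\<^sub>R v)"
    unfolding span_finite[OF finite_imageI[OF finite_lessThan]] by blast
  also have "\<dots> = (\<Sum>i<k. u (b i) *\<^sub>R b i)" using sum.reindex[OF inj_b] by (simp add: o_def)
  finally have "F (\<lambda>i. u (b i)) = x" unfolding F_def by (simp add: algebra_simps)
  then show ?thesis by (rule that)
qed

lemma coordinates_bounded: "\<exists>R. \<forall>c. (\<forall>j. 0 \<le> F c $ j \<and> F c $ j \<le> 1) \<longrightarrow> (\<forall>i<k. \<bar>c i\<bar> \<le> R)"
proof -
  obtain h where h: "\<And>i. linear (h i)" "\<And>i c. i < k \<Longrightarrow> h i (F c - p) = c i"
    using coordinate_functionals by blast
  have "\<forall>i. \<exists>B. B > 0 \<and> (\<forall>x. norm (h i x) \<le> B * norm x)"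
    using linear_bounded_pos[OF h(1)] by blast
  from choice[OF this] obtain B where B: "\<forall>i. B i > 0 \<and> (\<forall>x. norm (h i x) \<le> B i * norm x)" ..
  define C where "C = real CARD('n) + norm p"
  have "C \<ge> 0" unfolding C_def by simp
  have "\<bar>c i\<bar> \<le> (\<Sum>i<k. B i * C)" if c: "\<forall>j. 0 \<le> F c $ j \<and> F c $ j \<le> 1" and i: "i < k" for c i
  proof -
    have "norm (F c) \<le> (\<Sum>j\<in>UNIV. \<bar>F c $ j\<bar>)" by (rule norm_le_l1_cart)
    also have "\<dots> \<le> (\<Sum>j\<in>(UNIV::'n set). 1)" using c by (intro sum_mono) auto
    finally have "norm (F c - p) \<le> C" unfolding C_def using norm_triangle_ineq4[of "F c" p] by simp
    have "\<bar>c i\<bar> = norm (h i (F c - p))" using h(2)[OF i] by simp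
    also have "\<dots> \<le> B i * norm (F c - p)" using B by blast
    also have "\<dots> \<le> B i * C" using B \<open>norm (F c - p) \<le> C\<close> by (intro mult_left_mono) (auto intro: less_imp_le)
    also have "\<dots> \<le> (\<Sum>i<k. B i * C)"
      using i B \<open>C \<ge> 0\<close> by (intro member_le_sum[of i "{..<k}" "\<lambda>i. B i * C"]) (auto intro!: mult_nonneg_nonneg intro: less_imp_le)
    finally show ?thesis .
  qed
  then show ?thesis by blast
qed

section \<open>Riemann sums over the scaled lattice\<close>

definition Z :: "nat \<Rightarrow> (nat \<Rightarrow> int) set" where
  "Z t = {z \<in> PiE {..<k} (\<lambda>_. UNIV). F (\<lambda>i. of_int (z i) / real t) \<in> U}"

lemma scaled_F:
  assumes "t \<ge> 1"
  shows "real t *\<^sub>R F (\<lambda>i. of_int (z i) / real t) = real t *\<^sub>R p + (\<Sum>i<k. of_int (z i) *\<^sub>R b i)"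
  using assms unfolding F_def by (simp add: scaleR_add_right scaleR_sum_right)

text \<open>Scaling by \<open>t\<close> moves the frame origin to \<open>t * p\<close>, which
  differs from \<open>p\<close> by the lattice vector \<open>(t - 1) * p\<close> and so is an
  equally good origin.\<close>

lemma lattice_scaled_frame:
  "x \<in> int_lattice \<inter> s \<longleftrightarrow> (\<exists>z::nat \<Rightarrow> int. x = real t *\<^sub>R p + (\<Sum>i<k. of_int (z i) *\<^sub>R b i))"
proof -
  let ?q = "of_int (int t - 1) *\<^sub>R p"
  have q: "?q \<in> int_lattice" "?q \<in> s"
    by (rule int_lattice_scale[OF p_lattice(1)], rule subspace_scale[OF s p_lattice(2)])
  have eq: "real t *\<^sub>R p + y = ?q + (p + y)" for y by (simp add: algebra_simps)
  have "x \<in> int_lattice \<inter> s \<longleftrightarrow> x - ?q \<in> int_lattice \<inter> s"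
  proof
    assume "x - ?q \<in> int_lattice \<inter> s"
    then have "(x - ?q) + ?q \<in> int_lattice" "(x - ?q) + ?q \<in> s"
      using int_lattice_add[of "x - ?q" ?q] subspace_add[OF s, of "x - ?q" ?q] q by blast+
    then show "x \<in> int_lattice \<inter> s" by simp
  qed (use q in \<open>auto intro: int_lattice_diff subspace_diff[OF s]\<close>)
  also have "\<dots> \<longleftrightarrow> (\<exists>z::nat \<Rightarrow> int. x - ?q = p + (\<Sum>i<k. of_int (z i) *\<^sub>R b i))"
    unfolding frame by blast
  also have "\<dots> \<longleftrightarrow> (\<exists>z::nat \<Rightarrow> int. x = real t *\<^sub>R p + (\<Sum>i<k. of_int (z i) *\<^sub>R b i))"
    unfolding eq diff_eq_eq by (simp only: add.commute)
  finally show ?thesis .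
qed

lemma scaled_in_U_iff:
  assumes "t \<ge> 1"
  shows "real t *\<^sub>R x \<in> s \<and> inj (\<lambda>i. (real t *\<^sub>R x) $ i) \<and> (\<forall>i. 0 < (real t *\<^sub>R x) $ i \<and> (real t *\<^sub>R x) $ i < real t)
    \<longleftrightarrow> x \<in> U"
proof -
  have t: "real t > 0" using assms by simp
  have "real t *\<^sub>R x \<in> s \<longleftrightarrow> x \<in> s"
  proof
    assume "real t *\<^sub>R x \<in> s"
    from subspace_scale[OF s this, of "1 / real t"] show "x \<in> s" using t by simp
  qed (rule subspace_scale[OF s])
  moreover have "inj (\<lambda>i. (real t *\<^sub>R x) $ i) \<longleftrightarrow> inj (\<lambda>i. x $ i)"
    using t by (simp add: inj_def)
  moreover have "0 < (real t *\<^sub>R x) $ i \<and> (real t *\<^sub>R x) $ i < real t \<longleftrightarrow> 0 < x $ i \<and> x $ i < 1" for i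
    using t by (simp add: zero_less_mult_iff)
  ultimately show ?thesis unfolding U_def by simp
qed

lemma open_count_eq_card_Z:
  assumes t: "t \<ge> 1"
  shows "finite (Z t)" "open_count s t = card (Z t)"
proof -
  let ?G = "\<lambda>z. real t *\<^sub>R F (\<lambda>i. of_int (z i) / real t)"
  let ?A = "{x \<in> int_lattice \<inter> s. inj (\<lambda>i. x $ i) \<and> (\<forall>i. 0 < x $ i \<and> x $ i < real t)}"
  have t0: "real t \<noteq> 0" using t by simp
  obtain h where h: "\<And>i. linear (h i)" "\<And>i c. i < k \<Longrightarrow> h i (F c - p) = c i"
    using coordinate_functionals by blast
  have inj: "inj_on ?G (Z t)"
  proof (rule inj_onI)
    fix y z assume yz: "y \<in> Z t" "z \<in> Z t" and eq: "?G y = ?G z"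
    have F: "F (\<lambda>i. of_int (y i) / real t) = F (\<lambda>i. of_int (z i) / real t)" using eq t0 by simp
    have "of_int (y i) / real t = of_int (z i) / real t" if "i < k" for i
      using h(2)[OF that, of "\<lambda>i. of_int (y i) / real t"] h(2)[OF that, of "\<lambda>i. of_int (z i) / real t"]
      unfolding F by metis
    then have eq: "y i = z i" if "i < k" for i using that t0 by simp
    have "y \<in> PiE {..<k} (\<lambda>_. UNIV)" "z \<in> PiE {..<k} (\<lambda>_. UNIV)" using yz unfolding Z_def by blast+
    then show "y = z" by (rule PiE_ext) (simp add: eq)
  qed
  have img: "?G ` Z t = ?A"
  proof (rule subset_antisym)
    show "?G ` Z t \<subseteq> ?A"
    proof (rule image_subsetI)
      fix z assume z: "z \<in> Z t"
      have "?G z \<in> int_lattice \<inter> s" unfolding scaled_F[OF t] lattice_scaled_frame[of _ t] by blast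
      moreover have "F (\<lambda>i. of_int (z i) / real t) \<in> U" using z unfolding Z_def by blast
      ultimately show "?G z \<in> ?A" using scaled_in_U_iff[OF t] by blast
    qed
    show "?A \<subseteq> ?G ` Z t"
    proof
      fix x assume x: "x \<in> ?A"
      then have "\<exists>z::nat \<Rightarrow> int. x = real t *\<^sub>R p + (\<Sum>i<k. of_int (z i) *\<^sub>R b i)"
        using lattice_scaled_frame[of x t] by blast
      then obtain z :: "nat \<Rightarrow> int" where z: "x = real t *\<^sub>R p + (\<Sum>i<k. of_int (z i) *\<^sub>R b i)" ..
      define y where "y = restrict z {..<k}"
      have "(\<Sum>i<k. of_int (y i) *\<^sub>R b i) = (\<Sum>i<k. of_int (z i) *\<^sub>R b i)" by (intro sum.cong) (auto simp: y_def)
      then have xy: "x = ?G y" unfolding scaled_F[OF t] z by simp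
      have "F (\<lambda>i. of_int (y i) / real t) \<in> U"
        using x scaled_in_U_iff[OF t, of "F (\<lambda>i. of_int (y i) / real t)"] unfolding xy by blast
      then have "y \<in> Z t" unfolding Z_def y_def by auto
      then show "x \<in> ?G ` Z t" unfolding xy by (rule imageI)
    qed
  qed
  have "?A \<subseteq> {x \<in> int_lattice. \<forall>i. 0 \<le> x $ i \<and> x $ i \<le> real t}" by (auto intro: less_imp_le)
  then have "finite ?A" by (rule finite_subset[OF _ finite_int_lattice_box])
  then show "finite (Z t)" unfolding img[symmetric] using inj by (simp add: finite_image_iff)
  show "open_count s t = card (Z t)" unfolding open_count_def img[symmetric] by (rule card_image[OF inj])
qed

sublocale product_sigma_finite "\<lambda>_::nat. lborel :: real measure"
  by standard

text \<open>The points whose coordinates, rounded down to multiples of \<open>1 / t\<close>, land in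
  \<open>U\<close>. This is a disjoint union of half-open cubes of side \<open>1 / t\<close>, one
  for each point of the open count, so its measure is the Riemann sum
  \<open>open_count s t / t ^ k\<close>.\<close>

definition W :: "nat \<Rightarrow> (nat \<Rightarrow> real) set" where
  "W t = {c \<in> space M. F (\<lambda>i. of_int \<lfloor>real t * c i\<rfloor> / real t) \<in> U}"

definition cell :: "nat \<Rightarrow> (nat \<Rightarrow> int) \<Rightarrow> (nat \<Rightarrow> real) set" where
  "cell t z = PiE {..<k} (\<lambda>i. {of_int (z i) / real t ..< (of_int (z i) + 1) / real t})"

lemma space_M: "space M = PiE {..<k} (\<lambda>_. UNIV)"
  by (simp add: space_PiM)

lemma cell_iff:
  assumes "t \<ge> 1" "z \<in> PiE {..<k} (\<lambda>_. UNIV)"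
  shows "c \<in> cell t z \<longleftrightarrow> c \<in> space M \<and> z = restrict (\<lambda>i. \<lfloor>real t * c i\<rfloor>) {..<k}"
proof -
  have t: "real t > 0" using assms by simp
  have iff: "of_int e / real t \<le> x \<and> x < (of_int e + 1) / real t \<longleftrightarrow> \<lfloor>real t * x\<rfloor> = e" for e x
    using t by (auto simp: floor_eq_iff field_simps)
  have "z = restrict (\<lambda>i. \<lfloor>real t * c i\<rfloor>) {..<k} \<longleftrightarrow> (\<forall>i<k. \<lfloor>real t * c i\<rfloor> = z i)"
    using assms(2) by (auto simp: fun_eq_iff PiE_def extensional_def restrict_def)
  then show ?thesis unfolding cell_def space_M PiE_iff by (auto simp: iff)
qed

lemma cell_iff_Z:
  assumes "t \<ge> 1" "z \<in> Z t"
  shows "c \<in> cell t z \<longleftrightarrow> c \<in> space M \<and> z = restrict (\<lambda>i. \<lfloor>real t * c i\<rfloor>) {..<k}"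
proof (rule cell_iff[OF assms(1)])
  show "z \<in> PiE {..<k} (\<lambda>_. UNIV)" using assms(2) unfolding Z_def by blast
qed

lemma emeasure_cell:
  assumes "t \<ge> 1"
  shows "cell t z \<in> sets M" "emeasure M (cell t z) = ennreal ((1 / real t) ^ k)"
proof -
  show "cell t z \<in> sets M" unfolding cell_def by (intro sets_PiM_I_finite) auto
  have "(of_int (z i) + 1) / real t - of_int (z i) / real t = 1 / real t" for i
    by (simp add: add_divide_distrib)
  then have "emeasure M (cell t z) = (\<Prod>i<k. ennreal (1 / real t))"
    unfolding cell_def using assms by (subst emeasure_PiM) (auto simp: divide_right_mono)
  also have "\<dots> = ennreal ((1 / real t) ^ k)" by (simp add: ennreal_power)
  finally show "emeasure M (cell t z) = ennreal ((1 / real t) ^ k)" .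
qed

lemma W_eq_Union:
  assumes t: "t \<ge> 1"
  shows "W t = (\<Union>z\<in>Z t. cell t z)"
proof (rule set_eqI)
  fix c
  let ?z = "restrict (\<lambda>i. \<lfloor>real t * c i\<rfloor>) {..<k}"
  have F: "F (\<lambda>i. of_int (?z i) / real t) = F (\<lambda>i. of_int \<lfloor>real t * c i\<rfloor> / real t)"
    unfolding F_def by (intro arg_cong2[where f="(+)"] refl sum.cong) auto
  have z: "?z \<in> Z t \<longleftrightarrow> F (\<lambda>i. of_int \<lfloor>real t * c i\<rfloor> / real t) \<in> U"
    unfolding Z_def mem_Collect_eq F by simp
  have "c \<in> (\<Union>z\<in>Z t. cell t z) \<longleftrightarrow> (\<exists>z\<in>Z t. c \<in> space M \<and> z = ?z)"
    using cell_iff_Z[OF t, of _ c] by blast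
  then show "c \<in> W t \<longleftrightarrow> c \<in> (\<Union>z\<in>Z t. cell t z)" unfolding W_def mem_Collect_eq z[symmetric] by blast
qed

lemma measure_W:
  assumes t: "t \<ge> 1"
  shows "W t \<in> sets M" "measure M (W t) = real (open_count s t) / real t ^ k"
proof -
  show "W t \<in> sets M" unfolding W_eq_Union[OF t]
    using open_count_eq_card_Z(1)[OF t] emeasure_cell(1)[OF t] by (intro sets.finite_UN) auto
  have disj: "disjoint_family_on (cell t) (Z t)"
    unfolding disjoint_family_on_def
  proof (intro ballI impI)
    fix y z assume yz: "y \<in> Z t" "z \<in> Z t" "y \<noteq> z"
    have "c \<notin> cell t y \<inter> cell t z" for c
      using cell_iff_Z[OF t yz(1), of c] cell_iff_Z[OF t yz(2), of c] yz(3) by blast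
    then show "cell t y \<inter> cell t z = {}" by blast
  qed
  have "measure M (W t) = (\<Sum>z\<in>Z t. measure M (cell t z))"
    unfolding W_eq_Union[OF t]
    using open_count_eq_card_Z(1)[OF t] emeasure_cell[OF t] disj by (intro measure_finite_Union) auto
  also have "\<dots> = real (card (Z t)) * (1 / real t) ^ k"
    using emeasure_cell(2)[OF t] by (simp add: measure_def)
  finally show "measure M (W t) = real (open_count s t) / real t ^ k"
    using open_count_eq_card_Z(2)[OF t] by (simp add: power_one_over)
qed

section \<open>Convergence of the Riemann sums\<close>

lemma AE_not_hyperplane:
  assumes l: "l < k" "g l \<noteq> 0"
  shows "AE c in M. (\<Sum>i<k. c i * g i) \<noteq> (\<alpha>::real)"
proof -
  let ?A = "{c \<in> space M. (\<Sum>i<k. c i * g i) = \<alpha>}"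
  have A: "?A \<in> sets M" by measurable
  define J where "J = {..<k} - {l}"
  have J: "{..<k} = insert l J" "l \<notin> J" "finite J" using l unfolding J_def by auto
  \<comment> \<open>Every line in direction \<open>l\<close> meets the hyperplane in a single point
    because \<open>g l \<noteq> 0\<close>; integrating over the coordinate \<open>l\<close> first
    then gives measure zero.\<close>
  have inner: "(\<integral>\<^sup>+y. indicator ?A (c(l := y)) \<partial>lborel) = 0" for c
  proof -
    define y0 where "y0 = (\<alpha> - (\<Sum>i\<in>J. c i * g i)) / g l"
    have "indicator ?A (c(l := y)) \<le> (indicator {y0} y :: ennreal)" for y
    proof (cases "c(l := y) \<in> ?A")
      case True
      then have "(\<Sum>i\<in>insert l J. (c(l := y)) i * g i) = \<alpha>" unfolding J(1) by blast
      moreover have "(\<Sum>i\<in>J. (c(l := y)) i * g i) = (\<Sum>i\<in>J. c i * g i)" using J(2) by (intro sum.cong) auto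
      ultimately have "y * g l + (\<Sum>i\<in>J. c i * g i) = \<alpha>" using J(2,3) by simp
      then have "y = y0" unfolding y0_def using l(2) by (simp add: field_simps)
      then show ?thesis by (simp add: indicator_def)
    qed simp
    then have "(\<integral>\<^sup>+y. indicator ?A (c(l := y)) \<partial>lborel) \<le> (\<integral>\<^sup>+y. indicator {y0} y \<partial>lborel)"
      by (intro nn_integral_mono)
    then show ?thesis by simp
  qed
  have "emeasure M ?A = (\<integral>\<^sup>+c. indicator ?A c \<partial>M)" using A by simp
  also have "\<dots> = (\<integral>\<^sup>+c. (\<integral>\<^sup>+y. indicator ?A (c(l := y)) \<partial>lborel) \<partial>PiM J (\<lambda>_. lborel))"
    using product_nn_integral_insert[OF J(3,2), of "indicator ?A"] A unfolding J(1) by simp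
  also have "\<dots> = 0" by (simp only: inner nn_integral_const) simp
  finally have "emeasure M ?A = 0" .
  then have "?A \<in> null_sets M" using A by blast
  from AE_not_in[OF this] show ?thesis by (rule AE_mp) (rule AE_I2, auto)
qed

definition D :: "(nat \<Rightarrow> real) set" where
  "D = {c \<in> space M. F c \<in> P}"

lemma D_iff: "c \<in> D \<longleftrightarrow> c \<in> space M \<and> (\<forall>j. 0 \<le> F c $ j \<and> F c $ j \<le> 1)"
  unfolding D_def using F_in_s by (auto simp: P_iff)

lemma D_sets: "D \<in> sets M"
proof -
  have "D = {c \<in> space M. \<forall>j\<in>UNIV. 0 \<le> p $ j + (\<Sum>i<k. c i * b i $ j) \<and> p $ j + (\<Sum>i<k. c i * b i $ j) \<le> 1}"
    unfolding set_eq_iff D_iff F_component by auto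
  also have "\<dots> \<in> sets M" by measurable
  finally show ?thesis .
qed

lemma coordinate_dependence:
  assumes "linear g" "x \<in> s" "g x \<noteq> 0"
  shows "\<exists>l<k. g (b l) \<noteq> (0::real)"
proof (rule ccontr)
  assume "\<not> ?thesis"
  then have "\<And>v. v \<in> b ` {..<k} \<Longrightarrow> g v = 0" by auto
  moreover have "x \<in> span (b ` {..<k})" using assms(2) span_b by simp
  ultimately have "g x = 0" by (rule linear_eq_0_on_span[OF assms(1)])
  then show False using assms(3) by blast
qed

text \<open>Each excluded condition is a hyperplane in the coordinates \<open>c\<close>: by
  \<open>w\<close> no coordinate vanishes identically on \<open>s\<close>, and by \<open>nd\<close>
  no difference of two coordinates does, so some \<open>b l\<close> has a nonzero
  coefficient.\<close>

lemma AE_generic: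
  assumes nd: "\<forall>i j. i \<noteq> j \<longrightarrow> \<not> s \<subseteq> {x. x $ i = x $ j}"
  shows "AE c in M. \<forall>i j. F c $ i \<noteq> 0 \<and> F c $ i \<noteq> 1 \<and> (i \<noteq> j \<longrightarrow> F c $ i \<noteq> F c $ j)"
proof -
  have lin: "linear (\<lambda>x::real^'n. x $ i)" "linear (\<lambda>x::real^'n. x $ i - x $ j)" for i j
    by (rule linearI; simp add: algebra_simps)+
  have coord: "AE c in M. F c $ i \<noteq> \<alpha>" for i \<alpha>
  proof -
    obtain l where "l < k" "b l $ i \<noteq> 0"
      using coordinate_dependence[OF lin(1) w(1), of i] w(2) by (metis less_irrefl)
    from AE_not_hyperplane[of l "\<lambda>l. b l $ i", OF this, of "\<alpha> - p $ i"] show ?thesis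
      by (rule AE_mp) (rule AE_I2, auto simp: F_component)
  qed
  have diag: "AE c in M. i \<noteq> j \<longrightarrow> F c $ i \<noteq> F c $ j" for i j
  proof (cases "i = j")
    case False
    then obtain x where x: "x \<in> s" "x $ i - x $ j \<noteq> 0" using nd by auto
    obtain l where "l < k" "b l $ i - b l $ j \<noteq> 0"
      using coordinate_dependence[OF lin(2) x] by blast
    from AE_not_hyperplane[of l "\<lambda>l. b l $ i - b l $ j", OF this, of "p $ j - p $ i"] show ?thesis
      by (rule AE_mp) (rule AE_I2, auto simp: F_component right_diff_distrib sum_subtractf)
  qed simp
  have "AE c in M. \<forall>i\<in>UNIV. \<forall>j\<in>UNIV. F c $ i \<noteq> 0 \<and> F c $ i \<noteq> 1 \<and> (i \<noteq> j \<longrightarrow> F c $ i \<noteq> F c $ j)"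
    by (intro AE_finite_allI AE_conjI coord diag) auto
  then show ?thesis by simp
qed

lemma F_floor_tendsto:
  "(\<lambda>n. F (\<lambda>i. of_int \<lfloor>real (Suc n) * c i\<rfloor> / real (Suc n)) $ j) \<longlonglongrightarrow> F c $ j"
proof -
  have "(\<lambda>n. of_int \<lfloor>real (Suc n) * x\<rfloor> / real (Suc n)) \<longlonglongrightarrow> x" for x :: real
  proof (rule tendsto_sandwich)
    show "\<forall>\<^sub>F n in sequentially. x - 1 / real (Suc n) \<le> of_int \<lfloor>real (Suc n) * x\<rfloor> / real (Suc n)"
    proof (rule always_eventually, rule allI)
      fix n
      have "real (Suc n) * x - 1 \<le> of_int \<lfloor>real (Suc n) * x\<rfloor>" by linarith
      then have "(real (Suc n) * x - 1) / real (Suc n) \<le> of_int \<lfloor>real (Suc n) * x\<rfloor> / real (Suc n)"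
        by (rule divide_right_mono) simp
      then show "x - 1 / real (Suc n) \<le> of_int \<lfloor>real (Suc n) * x\<rfloor> / real (Suc n)"
        by (simp add: diff_divide_distrib del: of_nat_Suc)
    qed
    show "\<forall>\<^sub>F n in sequentially. of_int \<lfloor>real (Suc n) * x\<rfloor> / real (Suc n) \<le> x"
    proof (rule always_eventually, rule allI)
      fix n
      have "of_int \<lfloor>real (Suc n) * x\<rfloor> / real (Suc n) \<le> (real (Suc n) * x) / real (Suc n)"
        by (rule divide_right_mono) auto
      then show "of_int \<lfloor>real (Suc n) * x\<rfloor> / real (Suc n) \<le> x" by (simp del: of_nat_Suc)
    qed
    show "(\<lambda>n. x - 1 / real (Suc n)) \<longlonglongrightarrow> x"
      using tendsto_diff[OF tendsto_const LIMSEQ_inverse_real_of_nat, of x] by (simp add: inverse_eq_divide)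
  qed simp
  then show ?thesis unfolding F_component by (intro tendsto_intros)
qed

text \<open>At a generic point all relevant inequalities are strict. They therefore survive rounding
  for large \<open>t\<close>, inside \<open>D\<close> as well as outside.\<close>

lemma indicator_W_tendsto:
  assumes c: "c \<in> space M"
    and gen: "\<forall>i j. F c $ i \<noteq> 0 \<and> F c $ i \<noteq> 1 \<and> (i \<noteq> j \<longrightarrow> F c $ i \<noteq> F c $ j)"
  shows "(\<lambda>n. indicator (W (Suc n)) c) \<longlonglongrightarrow> (indicator D c :: real)"
proof -
  let ?x = "\<lambda>n. F (\<lambda>i. of_int \<lfloor>real (Suc n) * c i\<rfloor> / real (Suc n))"
  note lim = F_floor_tendsto[of c]
  have "\<forall>\<^sub>F n in sequentially. indicator (W (Suc n)) c = (indicator D c :: real)"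
  proof (cases "c \<in> D")
    case True
    then have "0 \<le> F c $ i \<and> F c $ i \<le> 1" for i unfolding D_iff by blast
    then have F01: "0 < F c $ i" "F c $ i < 1" for i
      using gen by (simp_all add: less_le)
    have "\<forall>\<^sub>F n in sequentially. 0 < ?x n $ i \<and> ?x n $ i < 1" for i
      by (rule eventually_conj[OF order_tendstoD(1)[OF lim F01(1)] order_tendstoD(2)[OF lim F01(2)]])
    then have 1: "\<forall>\<^sub>F n in sequentially. \<forall>i. 0 < ?x n $ i \<and> ?x n $ i < 1"
      by (intro eventually_all_finite)
    have "\<forall>\<^sub>F n in sequentially. i \<noteq> j \<longrightarrow> ?x n $ i \<noteq> ?x n $ j" for i j
    proof (cases "i = j")
      case False
      have "(\<lambda>n. ?x n $ i - ?x n $ j) \<longlonglongrightarrow> F c $ i - F c $ j" by (intro tendsto_diff lim)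
      moreover have "F c $ i - F c $ j \<noteq> 0" using gen False by simp
      ultimately have "\<forall>\<^sub>F n in sequentially. ?x n $ i - ?x n $ j \<noteq> 0" by (rule tendsto_imp_eventually_ne)
      then show ?thesis by (rule eventually_mono) simp
    qed simp
    then have 2: "\<forall>\<^sub>F n in sequentially. \<forall>i j. i \<noteq> j \<longrightarrow> ?x n $ i \<noteq> ?x n $ j"
      by (intro eventually_all_finite)
    from 1 2 show ?thesis
    proof eventually_elim
      case (elim n)
      have "inj (\<lambda>i. ?x n $ i)" using elim(2) by (intro injI) blast
      then have "?x n \<in> U" unfolding U_def mem_Collect_eq using F_in_s elim(1) by (intro conjI)
      then have "c \<in> W (Suc n)" unfolding W_def mem_Collect_eq using c by (intro conjI)
      then show ?case using True by simp
    qed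
  next
    case False
    then obtain i where "\<not> (0 \<le> F c $ i \<and> F c $ i \<le> 1)" unfolding D_iff using c by blast
    then consider "F c $ i < 0" | "1 < F c $ i" by linarith
    then have "\<forall>\<^sub>F n in sequentially. ?x n $ i < 0 \<or> 1 < ?x n $ i"
    proof cases
      case 1
      show ?thesis using order_tendstoD(2)[OF lim 1] by (rule eventually_mono) simp
    next
      case 2
      show ?thesis using order_tendstoD(1)[OF lim 2] by (rule eventually_mono) simp
    qed
    then show ?thesis
    proof eventually_elim
      case (elim n)
      have "?x n \<notin> U"
      proof
        assume "?x n \<in> U"
        then have "0 < ?x n $ i" "?x n $ i < 1" unfolding U_def mem_Collect_eq by blast+
        then show False using elim by linarith
      qed
      then have "c \<notin> W (Suc n)" unfolding W_def mem_Collect_eq by (rule contrapos_nn) (rule conjunct2)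
      then show ?case using False by simp
    qed
  qed
  then show ?thesis by (rule tendsto_eventually)
qed

lemma bounding_box:
  obtains R where "\<And>t. t \<ge> 1 \<Longrightarrow> W t \<subseteq> PiE {..<k} (\<lambda>_. {-R..R})" "D \<subseteq> PiE {..<k} (\<lambda>_. {-R..R})"
proof -
  obtain R where R: "\<forall>c. (\<forall>j. 0 \<le> F c $ j \<and> F c $ j \<le> 1) \<longrightarrow> (\<forall>i<k. \<bar>c i\<bar> \<le> R)"
    using coordinates_bounded by blast
  \<comment> \<open>Rounding moves a coordinate by at most \<open>1 / t \<le> 1\<close>, hence the
    enlarged radius \<open>R + 1\<close>.\<close>
  have "W t \<subseteq> PiE {..<k} (\<lambda>_. {-(R + 1)..R + 1})" if t: "t \<ge> 1" for t
  proof
    fix c assume c: "c \<in> W t"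
    have "\<forall>j. 0 \<le> F (\<lambda>i. of_int \<lfloor>real t * c i\<rfloor> / real t) $ j \<and> F (\<lambda>i. of_int \<lfloor>real t * c i\<rfloor> / real t) $ j \<le> 1"
      using c unfolding W_def U_def by (auto intro: less_imp_le)
    then have bnd: "\<bar>of_int \<lfloor>real t * c i\<rfloor> / real t\<bar> \<le> R" if "i < k" for i using R that by blast
    have "\<bar>c i\<bar> \<le> R + 1" if i: "i < k" for i
    proof -
      let ?e = "of_int \<lfloor>real t * c i\<rfloor> / real t"
      have "\<bar>real t * c i - of_int \<lfloor>real t * c i\<rfloor>\<bar> \<le> 1" by linarith
      then have "\<bar>real t * c i - of_int \<lfloor>real t * c i\<rfloor>\<bar> / real t \<le> 1" using t by (simp add: pos_divide_le_eq)
      moreover have "c i - ?e = (real t * c i - of_int \<lfloor>real t * c i\<rfloor>) / real t" using t by (simp add: diff_divide_distrib)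
      ultimately have "\<bar>c i - ?e\<bar> \<le> 1" by (simp add: abs_divide)
      then show ?thesis using bnd[OF i] by linarith
    qed
    then show "c \<in> PiE {..<k} (\<lambda>_. {-(R + 1)..R + 1})"
      using c unfolding W_def space_M PiE_iff by (simp add: abs_le_iff) force
  qed
  moreover have "D \<subseteq> PiE {..<k} (\<lambda>_. {-(R + 1)..R + 1})"
  proof
    fix c assume c: "c \<in> D"
    then have "\<forall>i<k. \<bar>c i\<bar> \<le> R" using R unfolding D_iff by blast
    then have "\<bar>c i\<bar> \<le> R + 1" if "i < k" for i using that by force
    then show "c \<in> PiE {..<k} (\<lambda>_. {-(R + 1)..R + 1})"
      using c unfolding D_iff space_M PiE_iff by (simp add: abs_le_iff) force
  qed
  ultimately show ?thesis by (rule that)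
qed

lemma box_fmeasurable: "PiE {..<k} (\<lambda>i. {x i..y i}) \<in> fmeasurable M"
proof (rule fmeasurableI)
  show "PiE {..<k} (\<lambda>i. {x i..y i}) \<in> sets M" by (intro sets_PiM_I_finite) auto
  have "emeasure M (PiE {..<k} (\<lambda>i. {x i..y i})) = (\<Prod>i<k. emeasure lborel {x i..y i})"
    by (intro emeasure_PiM) auto
  also have "\<dots> = (\<Prod>i<k. ennreal (if x i \<le> y i then y i - x i else 0))"
    by (simp add: emeasure_lborel_Icc_eq)
  also have "\<dots> < \<infinity>" by (subst prod_ennreal) auto
  finally show "emeasure M (PiE {..<k} (\<lambda>i. {x i..y i})) < \<infinity>" .
qed

text \<open>Dominated convergence for the indicator functions of the sets \<open>W t\<close>, with
  the indicator of a fixed box as the dominating function.\<close>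

lemma open_count_tendsto:
  assumes nd: "\<forall>i j. i \<noteq> j \<longrightarrow> \<not> s \<subseteq> {x. x $ i = x $ j}"
  shows "(\<lambda>t. real (open_count s t) / real t ^ k) \<longlonglongrightarrow> measure M D"
proof -
  obtain R where R: "\<And>t. t \<ge> 1 \<Longrightarrow> W t \<subseteq> PiE {..<k} (\<lambda>_. {-R..R})" "D \<subseteq> PiE {..<k} (\<lambda>_. {-R..R})"
    using bounding_box by blast
  let ?Q = "PiE {..<k} (\<lambda>_. {-R..R})"
  have Q: "?Q \<in> fmeasurable M" by (rule box_fmeasurable)
  have "(\<lambda>n. integral\<^sup>L M (indicator (W (Suc n)) :: _ \<Rightarrow> real)) \<longlonglongrightarrow> integral\<^sup>L M (indicator D :: _ \<Rightarrow> real)"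
  proof (rule integral_dominated_convergence[where w = "indicator ?Q"])
    show "integrable M (indicator ?Q :: _ \<Rightarrow> real)"
      using Q by (auto simp: fmeasurable_def intro!: integrable_real_indicator)
    show "AE c in M. (\<lambda>n. indicator (W (Suc n)) c) \<longlonglongrightarrow> (indicator D c :: real)"
      by (rule AE_mp[OF AE_generic[OF nd]], rule AE_I2, rule impI, rule indicator_W_tendsto)
    show "AE c in M. norm (indicator (W (Suc n)) c :: real) \<le> indicator ?Q c" for n
    proof (rule AE_I2)
      fix c
      have "c \<in> W (Suc n) \<Longrightarrow> c \<in> ?Q" using R(1)[of "Suc n"] by auto
      then show "norm (indicator (W (Suc n)) c :: real) \<le> indicator ?Q c" by (simp add: indicator_def)
    qed
    show "(indicator D :: _ \<Rightarrow> real) \<in> borel_measurable M"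
      by (rule borel_measurable_indicator[OF D_sets])
    show "(indicator (W (Suc n)) :: _ \<Rightarrow> real) \<in> borel_measurable M" for n
      by (rule borel_measurable_indicator[OF measure_W(1)]) simp
  qed
  moreover have "integral\<^sup>L M (indicator (W (Suc n)) :: _ \<Rightarrow> real) = real (open_count s (Suc n)) / real (Suc n) ^ k" for n
    using measure_W(2)[of "Suc n"] sets.Int_space_eq2[OF measure_W(1)[of "Suc n"]] by (simp del: of_nat_Suc)
  moreover have "integral\<^sup>L M (indicator D :: _ \<Rightarrow> real) = measure M D"
    using sets.Int_space_eq2[OF D_sets] by simp
  ultimately have "(\<lambda>n. real (open_count s (Suc n)) / real (Suc n) ^ k) \<longlonglongrightarrow> measure M D" by (simp only:)
  then show ?thesis by (rule LIMSEQ_imp_Suc)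
qed

text \<open>A cube around the frame coordinates of \<open>w\<close> lies in \<open>D\<close> once
  the deviation \<open>\<delta> * ?h j\<close> stays below the distance \<open>?g j\<close> of
  \<open>w\<close> from the walls. Positivity supplies the nonzero leading coefficient that
  \<open>has_leading_term\<close> demands.\<close>

lemma measure_D_pos: "measure M D > 0"
proof -
  obtain c0 where c0: "F c0 = w" using F_surj[OF w(1)] by blast
  let ?h = "\<lambda>j. \<Sum>i<k. \<bar>b i $ j\<bar>" and ?g = "\<lambda>j. min (w $ j) (1 - w $ j)"
  have "\<forall>j\<in>UNIV. 0 < ?g j" using w(2) by simp
  then obtain \<delta> where \<delta>: "\<delta> > 0" "\<forall>j\<in>UNIV. \<delta> * \<bar>?h j\<bar> < ?g j"
    using ex_small_multiplier[of UNIV ?g ?h] by auto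
  let ?C = "PiE {..<k} (\<lambda>i. {c0 i - \<delta>..c0 i + \<delta>})"
  have sub: "?C \<subseteq> D"
  proof
    fix c assume c: "c \<in> ?C"
    have "0 \<le> F c $ j \<and> F c $ j \<le> 1" for j
    proof -
      have "F c $ j - F c0 $ j = (\<Sum>i<k. (c i - c0 i) * b i $ j)"
        unfolding F_component by (simp add: left_diff_distrib sum_subtractf)
      then have "\<bar>F c $ j - w $ j\<bar> = \<bar>\<Sum>i<k. (c i - c0 i) * b i $ j\<bar>" unfolding c0 by (rule arg_cong)
      also have "\<dots> \<le> (\<Sum>i<k. \<bar>(c i - c0 i) * b i $ j\<bar>)" by (rule sum_abs)
      also have "\<dots> \<le> (\<Sum>i<k. \<delta> * \<bar>b i $ j\<bar>)"
      proof (rule sum_mono)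
        fix i assume "i \<in> {..<k}"
        then have "c i \<in> {c0 i - \<delta>..c0 i + \<delta>}" using c by (auto simp: PiE_iff)
        then have "\<bar>c i - c0 i\<bar> \<le> \<delta>" by (auto simp: abs_le_iff)
        then show "\<bar>(c i - c0 i) * b i $ j\<bar> \<le> \<delta> * \<bar>b i $ j\<bar>" by (simp add: abs_mult mult_right_mono)
      qed
      also have "\<dots> = \<delta> * \<bar>?h j\<bar>" by (simp add: sum_distrib_left sum_nonneg)
      also have "\<dots> < ?g j" using \<delta>(2) by blast
      finally show ?thesis by linarith
    qed
    then show "c \<in> D" unfolding D_iff space_M using c by (auto simp: PiE_iff)
  qed
  obtain R where R: "D \<subseteq> PiE {..<k} (\<lambda>_. {-R..R})" using bounding_box by metis
  have "D \<in> fmeasurable M" by (rule fmeasurableI2[OF box_fmeasurable R D_sets])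
  then have "measure M ?C \<le> measure M D"
    by (rule measure_mono_fmeasurable[OF sub fmeasurableD[OF box_fmeasurable]])
  moreover have "measure M ?C > 0"
  proof -
    have "emeasure M ?C = (\<Prod>i<k. emeasure lborel {c0 i - \<delta>..c0 i + \<delta>})" by (intro emeasure_PiM) auto
    also have "\<dots> = ennreal ((2 * \<delta>) ^ k)" using \<delta>(1) by (simp add: ennreal_power)
    finally show ?thesis using \<delta>(1) by (simp add: measure_def)
  qed
  ultimately show ?thesis by linarith
qed

end

subsection \<open>Leading terms and the theorem\<close>

lemma has_leading_term_reflect:
  assumes "has_leading_term Q V n"
  shows "has_leading_term (\<lambda>t. (-1) ^ n * Q (- t)) V n"
proof -
  obtain c where c: "V \<noteq> 0" "\<forall>i\<le>n. periodic (c i)" "\<forall>t. Q t = (\<Sum>i\<le>n. c i t * of_int t ^ i)" "\<forall>t. c n t = V"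
    using assms unfolding has_leading_term_def by blast
  define e where "e i t = (-1) ^ n * ((-1) ^ i * c i (- t))" for i t
  have "periodic (e i)" if i: "i \<le> n" for i
  proof -
    obtain q where q: "q > 0" "\<forall>t. c i (t + q) = c i t" using c(2) i unfolding periodic_def by blast
    have "c i (- (t + q)) = c i (- t)" for t using q(2)[rule_format, of "- (t + q)"] by simp
    then show ?thesis unfolding periodic_def e_def using q(1) by auto
  qed
  moreover have "(-1) ^ n * Q (- t) = (\<Sum>i\<le>n. e i t * of_int t ^ i)" for t
    unfolding c(3)[rule_format, of "- t"] e_def sum_distrib_left
    by (intro sum.cong refl) (simp add: power_minus[of "real_of_int t"] mult_ac)
  moreover have "e n t = V" for t
    unfolding e_def using c(4) by (simp add: mult.assoc[symmetric] power_add[symmetric] flip: mult_2)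
  ultimately show ?thesis unfolding has_leading_term_def using c(1) by blast
qed

lemma has_leading_term_add_lower:
  assumes "has_leading_term Q V n" "qpoly N n R"
  shows "has_leading_term (\<lambda>t. Q t + R t) V n"
proof -
  obtain c where c: "V \<noteq> 0" "\<forall>i\<le>n. periodic (c i)" "\<forall>t. Q t = (\<Sum>i\<le>n. c i t * of_int t ^ i)" "\<forall>t. c n t = V"
    using assms(1) unfolding has_leading_term_def by blast
  obtain r where r: "\<And>i t. r i (t + int N) = r i t" "\<And>t. R t = (\<Sum>i<n. r i t * of_int t ^ i)" and N: "N > 0"
    using assms(2) unfolding qpoly_def by blast
  define e where "e i t = (if i < n then c i t + r i t else c i t)" for i t
  have "periodic (e i)" if i: "i \<le> n" for i
  proof -
    obtain q where q: "q > 0" "\<forall>t. c i (t + q) = c i t" using c(2) i unfolding periodic_def by blast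
    have "c i (t + q * int N) = c i t" for t
      using periodic_mult[of "c i" "nat q" t "int N"] q by simp
    moreover have "r i (t + q * int N) = r i t" for t
      using periodic_mult[of "r i" N t q] r(1) by (simp add: mult.commute)
    ultimately show ?thesis
      unfolding periodic_def e_def using q(1) N by (intro exI[of _ "q * int N"]) auto
  qed
  moreover have "Q t + R t = (\<Sum>i\<le>n. e i t * of_int t ^ i)" for t
  proof -
    have "(\<Sum>i\<le>n. e i t * of_int t ^ i) = (\<Sum>i<n. e i t * of_int t ^ i) + e n t * of_int t ^ n"
      by (simp flip: lessThan_Suc_atMost)
    also have "(\<Sum>i<n. e i t * of_int t ^ i) = (\<Sum>i<n. c i t * of_int t ^ i) + R t"
      unfolding r(2) e_def by (simp add: distrib_right sum.distrib)
    also have "Q t = (\<Sum>i<n. c i t * of_int t ^ i) + c n t * of_int t ^ n"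
      unfolding c(3)[rule_format, of t] by (simp flip: lessThan_Suc_atMost)
    ultimately show ?thesis by (simp add: e_def)
  qed
  moreover have "e n t = V" for t unfolding e_def using c(4) by simp
  ultimately show ?thesis unfolding has_leading_term_def using c(1) by blast
qed

lemma lattice_volume_limit:
  fixes s P :: "(real^'n) set"
  assumes s: "subspace s" and P: "P = {x. \<forall>i. 0 \<le> x $ i \<and> x $ i \<le> 1} \<inter> s"
    and w: "w \<in> s" "\<forall>i. 0 < w $ i \<and> w $ i < 1" and sp: "span (int_lattice \<inter> s) = s"
    and nd: "\<forall>i j. i \<noteq> j \<longrightarrow> \<not> s \<subseteq> {x. x $ i = x $ j}"
  shows "(\<lambda>t. real (open_count s t) / real t ^ dim s) \<longlonglongrightarrow> lattice_volume P" "lattice_volume P > 0"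
proof -
  note hull = affine_hull_cube_section[OF s P w]
  obtain p b where pb: "(SOME (p, b). lattice_frame P p b) = (p, b)" by (rule prod.exhaust)
  have "\<exists>x. case_prod (lattice_frame P) x" using lattice_frame_exists[OF s sp hull] by auto
  from someI_ex[OF this] have frame: "lattice_frame P p b" unfolding pb by simp
  interpret cube_section s P w p b "dim s"
    using frame unfolding lattice_frame_def hull Let_def by unfold_locales (use s P w sp in auto)
  have "lattice_volume P = measure M D"
    unfolding lattice_volume_def D_def F_def Let_def hull pb by simp
  then show "(\<lambda>t. real (open_count s t) / real t ^ dim s) \<longlonglongrightarrow> lattice_volume P" "lattice_volume P > 0"
    using open_count_tendsto[OF nd] measure_D_pos by simp_all
qed

text \<open>\<open>B\<close> uses the permutations realizable in \<open>s\<close>,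
  \<open>B_P\<close> those realizable in \<open>P\<close>. Reciprocity always holds for
  \<open>B_P\<close>, and for \<open>B\<close> when the two sets of permutations agree; they may
  differ, as \<open>realizable_in_subspace_not_in_polytope\<close> shows. The leading terms require
  that \<open>s\<close> lies in no diagonal hyperplane, where all counts would vanish.\<close>

theorem theorem3p4:
  fixes f :: "nat \<Rightarrow> real^'n::{finite,linorder} \<Rightarrow> real" and m :: nat
    and s P :: "(real^'n::{finite,linorder}) set"
  assumes "\<forall>j\<in>{1..m}. rational_linear_form (f j)"
    and "s = {x. \<forall>j\<in>{1..m}. f j x = 0}"
    and "P = {x. \<forall>i. 0 \<le> x $ i \<and> x $ i \<le> 1} \<inter> s"
    and "\<forall>i. \<not> P \<subseteq> {x. x $ i = 0}"
  shows "\<exists>B_open B B_P.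
    quasipolynomial B_open \<and> (\<forall>t\<ge>1. B_open (int t) = real (open_count s t)) \<and>
    quasipolynomial B \<and> (\<forall>t\<ge>1. B (int t) = real (closed_count s s t)) \<and>
    quasipolynomial B_P \<and> (\<forall>t\<ge>1. B_P (int t) = real (closed_count P s t)) \<and>
    ((\<forall>i j. i \<noteq> j \<longrightarrow> \<not> s \<subseteq> {x. x $ i = x $ j}) \<longrightarrow>
       has_leading_term B_open (lattice_volume P) (dim s) \<and>
       has_leading_term B (lattice_volume P) (dim s) \<and>
       has_leading_term B_P (lattice_volume P) (dim s)) \<and>
    B 0 = real (card (realizable_perms s)) \<and>
    B_P 0 = real (card (realizable_perms P)) \<and>
    (realizable_perms s \<subseteq> realizable_perms P \<longrightarrow> (\<forall>t. (-1) ^ dim s * B_open (- t) = B t)) \<and>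
    (\<forall>t. (-1) ^ dim s * B_open (- t) = B_P t)"
proof -
  obtain a :: "nat \<Rightarrow> 'n::{finite,linorder} \<Rightarrow> int" where sa: "s = form_space m a"
    using rational_forms_eq_form_space[OF assms(1)] assms(2) by blast
  have sub: "subspace s" unfolding sa by (rule subspace_form_space)
  obtain w where w: "w \<in> s" "\<forall>i. 0 < w $ i \<and> w $ i < 1"
    using ex_interior_point[OF sub assms(3,4)] by blast
  have Pa: "P = {x. \<forall>i. 0 \<le> x $ i \<and> x $ i \<le> 1} \<inter> form_space m a" using assms(3) sa by simp
  have wa: "w \<in> form_space m a" "\<forall>i. 0 < w $ i" using w sa by auto
  let ?R = "realizable_perms P" and ?Rs = "realizable_perms s" and ?D = "dim s"
  have R_sub: "?R \<subseteq> ?Rs" unfolding realizable_perms_def assms(3) by blast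
  define S where "S \<sigma> J t = real (card (solutions m UNIV (\<lambda>_. 1) (chain_forms a \<sigma>) J t))" for \<sigma> J t
  define Q where "Q \<sigma> = signed_count m UNIV (\<lambda>_. 1) (chain_forms a \<sigma>) {}" for \<sigma>
  have perm: "\<sigma> permutes UNIV" if "\<sigma> \<in> ?Rs" for \<sigma> using that unfolding realizable_perms_def by blast
  have Q_pos: "Q \<sigma> t = S \<sigma> {} t" if "t > 0" for \<sigma> t
    unfolding Q_def S_def using that by (intro signed_count_closed(1)) auto
  have Q_zero: "Q \<sigma> 0 = 1" for \<sigma>
    unfolding Q_def by (intro signed_count_closed(3)) auto
  \<comment> \<open>The kernel has dimension \<open>Suc ?D\<close>, so the minus sign in
    \<open>signed_count\<close> leaves \<open>(-1) ^ ?D\<close>.\<close>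
  have Q_neg: "Q \<sigma> (- t) = (-1) ^ ?D * S \<sigma> UNIV t" if "t > 0" "\<sigma> \<in> ?Rs" for \<sigma> t
  proof -
    have "Q \<sigma> (- t) = - ((-1) ^ dim (kernel m UNIV (chain_forms a \<sigma>))) * S \<sigma> UNIV t"
      unfolding Q_def S_def using that(1) by (intro signed_count_closed(2)) auto
    then show ?thesis unfolding dim_kernel_chain_forms[OF perm[OF that(2)]] sa by simp
  qed
  have "\<exists>N. qpoly N (Suc ?D) (Q \<sigma>)" if "\<sigma> \<in> ?R" for \<sigma>
    unfolding Q_def sa by (rule signed_count_chain_qpoly[OF Pa wa that])
  then obtain N where N: "N > 0" "\<forall>\<sigma>\<in>?R. qpoly N (Suc ?D) (Q \<sigma>)"
    using qpoly_common_period[of ?R "\<lambda>_. Suc ?D" Q] by auto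
  have "\<exists>q. (\<exists>N. qpoly N ?D q) \<and> (\<forall>t>0. q t = S \<sigma> {} t) \<and> q 0 = 1" if "\<sigma> \<in> ?Rs - ?R" for \<sigma>
    using closed_chain_qpoly[OF Pa wa, of \<sigma>] that unfolding S_def sa by blast
  then have "\<forall>\<sigma>\<in>?Rs - ?R. \<exists>q. (\<exists>N. qpoly N ?D q) \<and> (\<forall>t>0. q t = S \<sigma> {} t) \<and> q 0 = 1" by blast
  from bchoice[OF this] obtain q where
    q: "\<forall>\<sigma>\<in>?Rs - ?R. (\<exists>N. qpoly N ?D (q \<sigma>)) \<and> (\<forall>t>0. q \<sigma> t = S \<sigma> {} t) \<and> q \<sigma> 0 = 1" ..
  obtain N' where N': "N' > 0" "\<forall>\<sigma>\<in>?Rs - ?R. qpoly N' ?D (q \<sigma>)"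
    using qpoly_common_period[of "?Rs - ?R" "\<lambda>_. ?D" q] q by auto
  define B_P where "B_P t = (\<Sum>\<sigma>\<in>?R. Q \<sigma> t)" for t
  \<comment> \<open>The permutations realizable in \<open>s\<close> but not in \<open>P\<close>:
    each contributes 1 at \<open>t = 0\<close>, but only terms of degree below
    \<open>?D\<close>.\<close>
  define E where "E t = (\<Sum>\<sigma>\<in>?Rs - ?R. q \<sigma> t)" for t
  \<comment> \<open>With \<open>B_open\<close> defined by reflection, reciprocity is an identity;
    its content moves to \<open>v_open\<close>, which identifies the values by
    \<open>Q_neg\<close>.\<close>
  define B_open where "B_open t = (-1) ^ ?D * B_P (- t)" for t
  define B where "B t = B_P t + E t" for t
  have qP: "qpoly N (Suc ?D) B_P" unfolding B_P_def using N by (intro qpoly_sum) auto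
  have qE: "qpoly N' ?D E" unfolding E_def using N' by (intro qpoly_sum) auto
  have qO: "qpoly N (Suc ?D) B_open" unfolding B_open_def by (intro qpoly_cmult qpoly_reflect qP)
  have qB: "qpoly (N * N') (Suc ?D) B"
    unfolding B_def using qpoly_mult_period[OF qP N'(1)] qpoly_mult_period[OF qpoly_Suc[OF qE] N(1)]
    by (intro qpoly_add) (auto simp: mult.commute)
  have sq: "(-1) ^ ?D * ((-1) ^ ?D * x) = (x::real)" for x
    by (simp add: mult.assoc[symmetric] power_add[symmetric] flip: mult_2)
  have recip: "(-1) ^ ?D * B_open (- t) = B_P t" for t unfolding B_open_def by (simp add: sq)
  have v_open: "B_open (int t) = real (open_count s t)" if "t \<ge> 1" for t
  proof -
    have "B_P (- int t) = (\<Sum>\<sigma>\<in>?R. (-1) ^ ?D * S \<sigma> UNIV (int t))"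
      unfolding B_P_def using that R_sub by (intro sum.cong Q_neg) auto
    then have "B_open (int t) = (\<Sum>\<sigma>\<in>?R. S \<sigma> UNIV (int t))"
      unfolding B_open_def by (simp add: sum_distrib_left[symmetric] sq)
    also have "\<dots> = real (open_count s t)"
      unfolding open_count_eq_sum[OF sub assms(3) that] of_nat_sum
    proof (rule sum.cong)
      fix \<sigma> assume "\<sigma> \<in> ?R"
      then have "\<sigma> permutes UNIV" using R_sub perm by blast
      then show "S \<sigma> UNIV (int t) = real (card {x \<in> int_lattice \<inter> s. realizes x \<sigma> \<and> (\<forall>i. 0 < x $ i \<and> x $ i < real t)})"
        unfolding S_def sa by (subst card_chain_solutions_open) auto
    qed simp
    finally show ?thesis .
  qed
  have v_closed: "real (closed_count A s t) = (\<Sum>\<sigma>\<in>realizable_perms A. S \<sigma> {} (int t))" for A t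
    unfolding closed_count_eq_sum of_nat_sum
  proof (rule sum.cong)
    fix \<sigma> assume "\<sigma> \<in> realizable_perms A"
    then have "\<sigma> permutes UNIV" unfolding realizable_perms_def by blast
    then show "real (card {x \<in> int_lattice \<inter> s. compatible x \<sigma> \<and> (\<forall>i. 0 \<le> x $ i \<and> x $ i \<le> real t)}) = S \<sigma> {} (int t)"
      unfolding S_def sa by (subst card_chain_solutions_closed) auto
  qed simp
  have v_P: "B_P (int t) = real (closed_count P s t)" if "t \<ge> 1" for t
    unfolding v_closed B_P_def using that by (intro sum.cong refl Q_pos) auto
  have v_B: "B (int t) = real (closed_count s s t)" if "t \<ge> 1" for t
  proof -
    have "E (int t) = (\<Sum>\<sigma>\<in>?Rs - ?R. S \<sigma> {} (int t))"
      unfolding E_def using that q by (intro sum.cong) auto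
    then show ?thesis
      unfolding B_def v_P[OF that] v_closed using sum.subset_diff[OF R_sub, of "\<lambda>\<sigma>. S \<sigma> {} (int t)"] by simp
  qed
  have z_P: "B_P 0 = real (card ?R)" unfolding B_P_def by (simp add: Q_zero)
  have z_B: "B 0 = real (card ?Rs)"
  proof -
    have "E 0 = real (card (?Rs - ?R))" unfolding E_def using q by simp
    moreover have "card ?R + card (?Rs - ?R) = card ?Rs"
      using card_Diff_subset[OF _ R_sub] card_mono[OF _ R_sub] by simp
    ultimately show ?thesis unfolding B_def z_P by linarith
  qed
  have B_eq: "B = B_P" if "?Rs \<subseteq> ?R"
  proof -
    have "?Rs - ?R = {}" using that by blast
    then have "B t = B_P t" for t unfolding B_def E_def by (simp only: sum.empty add_0_right)
    then show ?thesis by (rule ext)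
  qed
  have lead: "has_leading_term B_open (lattice_volume P) ?D \<and> has_leading_term B (lattice_volume P) ?D \<and>
      has_leading_term B_P (lattice_volume P) ?D"
    if nd: "\<forall>i j. i \<noteq> j \<longrightarrow> \<not> s \<subseteq> {x. x $ i = x $ j}"
  proof -
    have sp: "span (int_lattice \<inter> s) = s" unfolding sa by (rule span_int_lattice_form_space)
    note vol = lattice_volume_limit[OF sub assms(3) w sp nd]
    have "\<forall>\<^sub>F t in sequentially. real (open_count s t) / real t ^ ?D = B_open (int t) / real t ^ ?D"
      by (rule eventually_sequentiallyI[of 1]) (simp add: v_open)
    from Lim_transform_eventually[OF vol(1) this]
    have lo: "has_leading_term B_open (lattice_volume P) ?D"
      using vol(2) by (intro qpoly_leading_term[OF qO]) auto
    \<comment> \<open>Only the open count is compared with the volume. Reflection transports the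
      leading term to \<open>B_P\<close>, and \<open>E\<close> is of lower degree.\<close>
    have "has_leading_term (\<lambda>t. (-1) ^ ?D * B_open (- t)) (lattice_volume P) ?D"
      by (rule has_leading_term_reflect[OF lo])
    then have lP: "has_leading_term B_P (lattice_volume P) ?D" unfolding recip .
    have "has_leading_term B (lattice_volume P) ?D"
      unfolding B_def by (rule has_leading_term_add_lower[OF lP qE])
    then show ?thesis using lo lP by blast
  qed
  show ?thesis
  proof (rule exI[of _ B_open], rule exI[of _ B], rule exI[of _ B_P], intro conjI)
    show "(\<forall>i j. i \<noteq> j \<longrightarrow> \<not> s \<subseteq> {x. x $ i = x $ j}) \<longrightarrow>
       has_leading_term B_open (lattice_volume P) ?D \<and>
       has_leading_term B (lattice_volume P) ?D \<and> has_leading_term B_P (lattice_volume P) ?D"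
      using lead by blast
    show "?Rs \<subseteq> ?R \<longrightarrow> (\<forall>t. (-1) ^ ?D * B_open (- t) = B t)" using recip B_eq by simp
  qed (use qpoly_imp_quasipolynomial[OF qO] qpoly_imp_quasipolynomial[OF qB] qpoly_imp_quasipolynomial[OF qP]
      v_open v_B v_P z_P z_B recip in simp_all)
qed

end
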